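(* Let $\Omega$ be a Polish space equipped with a probability measure $\mu$. Consider a reversible, ergodic Markov semigroup $(P_t)_{t\ge0}$ with stationary measure $\mu$, induced by a time-homogeneous Markov process on $\Omega$ and acting on suitable functions $\boldsymbol{f}:\Omega\to\mathbb{H}_d$. Assume that the Bakry--\'Emery criterion holds with a constant $c>0$: $$\Gamma(\boldsymbol{f})\preccurlyeq c\cdot\Gamma_2(\boldsymbol{f})\quad\text{($\mu$-almost everywhere) for all suitable }\boldsymbol{f}:\Omega\to\mathbb{H}_d.$$ For suitable $\boldsymbol{f}:\Omega\to\mathbb{H}_d$ define $$r_{\boldsymbol{f}}(\beta):=\frac1\beta\log\mathbb{E}_\mu\,\overline{\operatorname{tr}}\,e^{\beta\Gamma(\boldsymbol{f})}\quad\text{for }\beta>0.$$ Then, for all $t\ge0$, $$\mathbb{P}_\mu\{\lambda_{\max}(\boldsymbol{f}-\mathbb{E}_\mu\boldsymbol{f})\ge t\}\le d\cdot\inf_{\beta>0}\exp\left(\frac{-t^2}{2c\,r_{\boldsymbol{f}}(\beta)+2t\sqrt{c/\beta}}\right).$$ In addition, suppose that the variance proxy $v_{\boldsymbol{f}}:=\big\|\,\|\Gamma(\boldsymbol{f})\|\,\big\|_{L_\infty(\mu)}$ is finite. Then, for all $t\ge0$, $$\mathbb{P}_\mu\{\lambda_{\max}(\boldsymbol{f}-\mathbb{E}_\mu\boldsymbol{f})\ge t\}\le d\cdot\exp\left(\frac{-t^2}{2c\,v_{\boldsymbol{f}}}\right),$$ and furthermore $$\mathbb{E}_\mu\lambda_{\max}(\boldsymbol{f}-\mathbb{E}_\mu\boldsymbol{f})\le\sqrt{2c\,v_{\boldsymbol{f}}\log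 d}.$$ Parallel inequalities hold for the minimum eigenvalue: under the respective hypotheses, the two probability bounds hold with $\mathbb{P}_\mu\{\lambda_{\min}(\boldsymbol{f}-\mathbb{E}_\mu\boldsymbol{f})\le-t\}$ on the left-hand side, and $\mathbb{E}_\mu\lambda_{\min}(\boldsymbol{f}-\mathbb{E}_\mu\boldsymbol{f})\ge-\sqrt{2c\,v_{\boldsymbol{f}}\log d}$.
   Context: $\mathbb{M}_d$ is the algebra of $d\times d$ complex matrices, $\mathbb{H}_d$ its real subspace of Hermitian matrices; $\preccurlyeq$ is the positive-semidefinite order; $\|\cdot\|$ is the $\ell_2$ operator norm; $\operatorname{tr}$ is the trace and $\overline{\operatorname{tr}}=d^{-1}\operatorname{tr}$ the normalized trace. Scalar functions are applied to Hermitian matrices via the eigenvalue decomposition, and nonlinear functions bind before trace and expectation. $\mathbb{E}_\mu$ acts entrywise. $\lambda_{\max},\lambda_{\min}$ are the largest and smallest eigenvalues. Semigroup: $(Z_t)_{t\ge0}$ is a time-homogeneous Markov process on $\Omega$ with stationary measure $\mu$, and for each $d$ and (bounded) measurable $\boldsymbol{f}:\Omega\to\mathbb{H}_d$, $(P_t\boldsymbol{f})(z)=\mathbb{E}[\boldsymbol{f}(Z_t)\mid Z_0=z]$ (entrywise). It is reversible if $\mathbb{E}_\mu[(P_tf)g]=\mathbb{E}_\mu[f(P_tg)]$ for all $t\ge0$ and real-valued $f,g$, and ergodic if $P_tf\to\mathbb{E}_\mu f$ in $L_2(\mu)$ as $t\to\infty$ for all real-valued (square-integrable) $f$. The infinitesimal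 generator is $\mathcal{L}\boldsymbol{f}=\lim_{t\downarrow0}(P_t\boldsymbol{f}-\boldsymbol{f})/t$ (entrywise, also for $\mathbb{M}_d$-valued functions). The matrix carr\'e du champ and iterated carr\'e du champ operators are $$\Gamma(\boldsymbol{f},\boldsymbol{g})=\tfrac12[\mathcal{L}(\boldsymbol{f}\boldsymbol{g})-\boldsymbol{f}\mathcal{L}(\boldsymbol{g})-\mathcal{L}(\boldsymbol{f})\boldsymbol{g}],\qquad \Gamma_2(\boldsymbol{f},\boldsymbol{g})=\tfrac12[\mathcal{L}\Gamma(\boldsymbol{f},\boldsymbol{g})-\Gamma(\boldsymbol{f},\mathcal{L}(\boldsymbol{g}))-\Gamma(\mathcal{L}(\boldsymbol{f}),\boldsymbol{g})],$$ with $\Gamma(\boldsymbol{f})=\Gamma(\boldsymbol{f},\boldsymbol{f})$ and $\Gamma_2(\boldsymbol{f})=\Gamma_2(\boldsymbol{f},\boldsymbol{f})$. Suitable functions: for each $d$, a fixed class of functions $\Omega\to\mathbb{H}_d$ (an algebra of nice functions, e.g. smooth compactly supported ones in concrete cases) on which $\mathcal{L},\Gamma,\Gamma_2$ are defined, which is compatible with the operations used ($P_t$, $\mathcal{L}$, sums, products, constants, standard matrix functions; $\boldsymbol{f}$ is suitable iff the real and imaginary parts of its entries are suitable), and on which all limits, time derivatives and expectations involved exist and may be interchanged; in particular $\frac{d}{dt}P_t=\mathcal{L}P_t=P_t\mathcal{L}$ and $\mathbb{E}_\mu[\mathcal{L}\boldsymbol{f}]=\boldsymbol{0}$. *)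

theory Defs
  imports "HOL-Probability.Probability"
begin

definition cmat_adjoint :: "complex^'n^'m \<Rightarrow> complex^'m^'n" where
  "cmat_adjoint A = (\<chi> i j. cnj (A $ j $ i))"

definition cmat_hermitian :: "complex^'n^'n \<Rightarrow> bool" where
  "cmat_hermitian A \<longleftrightarrow> cmat_adjoint A = A"

definition cmat_unitary :: "complex^'n^'n \<Rightarrow> bool" where
  "cmat_unitary U \<longleftrightarrow> cmat_adjoint U ** U = mat 1 \<and> U ** cmat_adjoint U = mat 1"

definition cmat_psd :: "complex^'n^'n \<Rightarrow> bool" where
  "cmat_psd A \<longleftrightarrow> cmat_hermitian A \<and>
     (\<forall>x :: complex^'n. 0 \<le> Re (\<Sum>i\<in>UNIV. cnj (x $ i) * (A *v x) $ i))"

definition loewner_le :: "complex^'n^'n \<Rightarrow> complex^'n^'n \<Rightarrow> bool" where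
  "loewner_le A B \<longleftrightarrow> cmat_psd (B - A)"

definition real_diag :: "('n \<Rightarrow> real) \<Rightarrow> complex^'n^'n" where
  "real_diag x = (\<chi> i j. if i = j then complex_of_real (x i) else 0)"

text \<open>
  The functional calculus. For Hermitian \<open>A\<close> an eigenvalue decomposition exists and the
  result does not depend on the one chosen; for other \<open>A\<close> the value is unspecified.
\<close>

definition spectral_fun :: "(real \<Rightarrow> real) \<Rightarrow> complex^'n^'n \<Rightarrow> complex^'n^'n" where
  "spectral_fun \<phi> A = (THE B. \<exists>U x. cmat_unitary U
     \<and> A = U ** real_diag x ** cmat_adjoint U
     \<and> B = U ** real_diag (\<lambda>i. \<phi> (x i)) ** cmat_adjoint U)"

definition real_eigenvalues :: "complex^'n^'n \<Rightarrow> real set" where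
  "real_eigenvalues A = {l. \<exists>x :: complex^'n. x \<noteq> 0 \<and> A *v x = complex_of_real l *s x}"

definition lambda_max :: "complex^'n^'n \<Rightarrow> real" where
  "lambda_max A = Max (real_eigenvalues A)"

definition lambda_min :: "complex^'n^'n \<Rightarrow> real" where
  "lambda_min A = Min (real_eigenvalues A)"

text \<open>The norm of \<^typ>\<open>complex^'n\<close> is the Euclidean one, so this is the l2 operator norm.\<close>

definition cmat_opnorm :: "complex^'n^'n \<Rightarrow> real" where
  "cmat_opnorm A = onorm (\<lambda>x :: complex^'n. A *v x)"

text \<open>The trace of a Hermitian matrix is real; taking the real part only changes the type.\<close>

definition ntrace :: "complex^'n^'n \<Rightarrow> real" where
  "ntrace A = Re (trace A) / real CARD('n)"

definition history :: "'w measure \<Rightarrow> (real \<Rightarrow> 'w \<Rightarrow> 'a::topological_space) \<Rightarrow> real \<Rightarrow> 'w measure" where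
  "history W Z s = sigma (space W) {Z u -` A \<inter> space W | u A. 0 \<le> u \<and> u \<le> s \<and> A \<in> sets borel}"

text \<open>
  A time-homogeneous Markov process: \<open>Pr z\<close> is the law of the process started at \<open>z\<close>, so that
  conditioning on the initial state \<open>z\<close> means working under \<open>Pr z\<close>.
\<close>

locale markov_process =
  fixes W :: "'w measure"
    and Pr :: "'a::polish_space \<Rightarrow> 'w measure"
    and Z :: "real \<Rightarrow> 'w \<Rightarrow> 'a"
  assumes law: "Pr \<in> borel \<rightarrow>\<^sub>M prob_algebra W"
    and state: "\<And>t. 0 \<le> t \<Longrightarrow> Z t \<in> W \<rightarrow>\<^sub>M borel"
    and start: "\<And>z. AE w in Pr z. Z 0 w = z"
    and markov: "\<And>z s t A. 0 \<le> s \<Longrightarrow> 0 \<le> t \<Longrightarrow> A \<in> sets borel \<Longrightarrow>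
      AE w in Pr z. real_cond_exp (Pr z) (history W Z s) (\<lambda>w'. indicator A (Z (s + t) w')) w
        = measure (Pr (Z s w)) {w' \<in> space W. Z t w' \<in> A}"

definition transition_kernel ::
  "('a::topological_space \<Rightarrow> 'w measure) \<Rightarrow> (real \<Rightarrow> 'w \<Rightarrow> 'a) \<Rightarrow> real \<Rightarrow> 'a \<Rightarrow> 'a measure" where
  "transition_kernel Pr Z t z = distr (Pr z) borel (Z t)"

text \<open>
  The operators below are polymorphic in the codomain, so that they apply to real-valued and to
  matrix-valued functions alike. In \<^typ>\<open>complex^'n^'n\<close> integrals and limits are entrywise.
\<close>

definition semigroup_op ::
  "(real \<Rightarrow> 'a \<Rightarrow> 'a measure) \<Rightarrow> real \<Rightarrow> ('a \<Rightarrow> 'b) \<Rightarrow> 'a \<Rightarrow> 'b::{banach, second_countable_topology}" where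
  "semigroup_op \<kappa> t f z = (\<integral>y. f y \<partial>\<kappa> t z)"

definition difference_quotient ::
  "(real \<Rightarrow> 'a \<Rightarrow> 'a measure) \<Rightarrow> real \<Rightarrow> ('a \<Rightarrow> 'b) \<Rightarrow> 'a \<Rightarrow> 'b::{banach, second_countable_topology}" where
  "difference_quotient \<kappa> t f z = (1 / t) *\<^sub>R (semigroup_op \<kappa> t f z - f z)"

definition generator ::
  "(real \<Rightarrow> 'a \<Rightarrow> 'a measure) \<Rightarrow> ('a \<Rightarrow> 'b) \<Rightarrow> 'a \<Rightarrow> 'b::{banach, second_countable_topology}" where
  "generator \<kappa> f z = Lim (at_right 0) (\<lambda>t. difference_quotient \<kappa> t f z)"

definition stationary :: "(real \<Rightarrow> 'a \<Rightarrow> 'a measure) \<Rightarrow> 'a measure \<Rightarrow> bool" where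
  "stationary \<kappa> \<mu> \<longleftrightarrow> (\<forall>t\<ge>0. bind \<mu> (\<kappa> t) = \<mu>)"

definition square_integrable :: "'a measure \<Rightarrow> ('a \<Rightarrow> real) \<Rightarrow> bool" where
  "square_integrable \<mu> f \<longleftrightarrow> f \<in> borel_measurable \<mu> \<and> integrable \<mu> (\<lambda>z. (f z)\<^sup>2)"

definition reversible :: "(real \<Rightarrow> 'a \<Rightarrow> 'a measure) \<Rightarrow> 'a measure \<Rightarrow> bool" where
  "reversible \<kappa> \<mu> \<longleftrightarrow> (\<forall>t\<ge>0. \<forall>f g :: 'a \<Rightarrow> real. square_integrable \<mu> f \<longrightarrow> square_integrable \<mu> g \<longrightarrow>
     (\<integral>z. semigroup_op \<kappa> t f z * g z \<partial>\<mu>) = (\<integral>z. f z * semigroup_op \<kappa> t g z \<partial>\<mu>))"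

definition ergodic :: "(real \<Rightarrow> 'a \<Rightarrow> 'a measure) \<Rightarrow> 'a measure \<Rightarrow> bool" where
  "ergodic \<kappa> \<mu> \<longleftrightarrow> (\<forall>f :: 'a \<Rightarrow> real. square_integrable \<mu> f \<longrightarrow>
     ((\<lambda>t. \<integral>z. (semigroup_op \<kappa> t f z - (\<integral>y. f y \<partial>\<mu>))\<^sup>2 \<partial>\<mu>) \<longlongrightarrow> 0) at_top)"

definition carre_du_champ ::
  "(real \<Rightarrow> 'a \<Rightarrow> 'a measure) \<Rightarrow> ('a \<Rightarrow> complex^'n^'n) \<Rightarrow> ('a \<Rightarrow> complex^'n^'n) \<Rightarrow> 'a \<Rightarrow> complex^'n^'n" where
  "carre_du_champ \<kappa> F G z = (1/2) *\<^sub>R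
     (generator \<kappa> (\<lambda>y. F y ** G y) z - F z ** generator \<kappa> G z - generator \<kappa> F z ** G z)"

definition carre_du_champ2 ::
  "(real \<Rightarrow> 'a \<Rightarrow> 'a measure) \<Rightarrow> ('a \<Rightarrow> complex^'n^'n) \<Rightarrow> ('a \<Rightarrow> complex^'n^'n) \<Rightarrow> 'a \<Rightarrow> complex^'n^'n" where
  "carre_du_champ2 \<kappa> F G z = (1/2) *\<^sub>R
     (generator \<kappa> (carre_du_champ \<kappa> F G) z
      - carre_du_champ \<kappa> F (generator \<kappa> G) z - carre_du_champ \<kappa> (generator \<kappa> F) G z)"

text \<open>
  \<open>S\<close> is the set of suitable scalar functions; a matrix-valued function is suitable iff the real
  and imaginary parts of its entries are.
\<close>

definition suitable :: "('a \<Rightarrow> real) set \<Rightarrow> ('a \<Rightarrow> complex^'n^'n) \<Rightarrow> bool" where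
  "suitable S F \<longleftrightarrow> (\<forall>i j. (\<lambda>z. Re (F z $ i $ j)) \<in> S \<and> (\<lambda>z. Im (F z $ i $ j)) \<in> S)"

definition suitable_hermitian :: "('a \<Rightarrow> real) set \<Rightarrow> ('a \<Rightarrow> complex^'n^'n) \<Rightarrow> bool" where
  "suitable_hermitian S F \<longleftrightarrow> suitable S F \<and> (\<forall>z. cmat_hermitian (F z))"

text \<open>
  The standing requirements on the class of suitable functions. It is an algebra containing the
  constants and closed under the semigroup and the generator, and its members are integrable (hence
  have all moments). The generator exists as a pointwise limit, and the limit is also one in
  \<open>L\<^sup>2(\<mu>)\<close>: this expresses that it may be interchanged with expectations. In particular
  \<open>d/dt P\<^sub>t = L P\<^sub>t = P\<^sub>t L\<close> (in \<open>L\<^sup>2(\<mu>)\<close>) and \<open>E\<^sub>\<mu>(L f) = 0\<close> are consequences. Members may be unbounded.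
  Of the standard matrix functions only the exponential is required to preserve suitability; the
  type argument is the index type of the matrices, as this is the only clause that depends on it.
\<close>

definition suitable_class ::
  "(real \<Rightarrow> 'a \<Rightarrow> 'a measure) \<Rightarrow> 'a measure \<Rightarrow> ('a \<Rightarrow> real) set \<Rightarrow> 'n::finite itself \<Rightarrow> bool" where
  "suitable_class \<kappa> \<mu> S (_ :: 'n itself) \<longleftrightarrow>
     (\<forall>a. (\<lambda>_. a) \<in> S) \<and>
     (\<forall>f\<in>S. \<forall>g\<in>S. (\<lambda>z. f z + g z) \<in> S \<and> (\<lambda>z. f z * g z) \<in> S) \<and>
     (\<forall>F :: 'a \<Rightarrow> complex^'n^'n. suitable_hermitian S F \<longrightarrow> suitable S (\<lambda>z. spectral_fun exp (F z))) \<and>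
     (\<forall>f\<in>S. integrable \<mu> f) \<and>
     (\<forall>f\<in>S. \<forall>t\<ge>0. (\<forall>z. integrable (\<kappa> t z) f) \<and> semigroup_op \<kappa> t f \<in> S) \<and>
     (\<forall>f\<in>S. \<forall>z. \<exists>l. ((\<lambda>t. difference_quotient \<kappa> t f z) \<longlongrightarrow> l) (at_right 0)) \<and>
     (\<forall>f\<in>S. generator \<kappa> f \<in> S) \<and>
     (\<forall>f\<in>S. ((\<lambda>t. \<integral>z. (difference_quotient \<kappa> t f z - generator \<kappa> f z)\<^sup>2 \<partial>\<mu>) \<longlongrightarrow> 0) (at_right 0))"

definition bakry_emery ::
  "(real \<Rightarrow> 'a \<Rightarrow> 'a measure) \<Rightarrow> 'a measure \<Rightarrow> ('a \<Rightarrow> real) set \<Rightarrow> real \<Rightarrow> 'n::finite itself \<Rightarrow> bool" where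
  "bakry_emery \<kappa> \<mu> S c (_ :: 'n itself) \<longleftrightarrow>
     (\<forall>F :: 'a \<Rightarrow> complex^'n^'n. suitable_hermitian S F \<longrightarrow>
        (AE z in \<mu>. loewner_le (carre_du_champ \<kappa> F F z) (c *\<^sub>R carre_du_champ2 \<kappa> F F z)))"

definition centered :: "'a measure \<Rightarrow> ('a \<Rightarrow> complex^'n^'n) \<Rightarrow> 'a \<Rightarrow> complex^'n^'n" where
  "centered \<mu> F z = F z - (\<integral>y. F y \<partial>\<mu>)"

text \<open>
  For suitable Hermitian \<open>F\<close> the function \<open>exp(\<beta> \<Gamma>(F))\<close> is suitable, so the expectation below
  is finite (and at least 1).
\<close>

definition r_carre ::
  "(real \<Rightarrow> 'a \<Rightarrow> 'a measure) \<Rightarrow> 'a measure \<Rightarrow> ('a \<Rightarrow> complex^'n^'n) \<Rightarrow> real \<Rightarrow> real" where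
  "r_carre \<kappa> \<mu> F \<beta> =
     1 / \<beta> * ln (\<integral>z. ntrace (spectral_fun exp (\<beta> *\<^sub>R carre_du_champ \<kappa> F F z)) \<partial>\<mu>)"

definition variance_proxy ::
  "(real \<Rightarrow> 'a \<Rightarrow> 'a measure) \<Rightarrow> 'a measure \<Rightarrow> ('a \<Rightarrow> complex^'n^'n) \<Rightarrow> ereal" where
  "variance_proxy \<kappa> \<mu> F = esssup \<mu> (\<lambda>z. ereal (cmat_opnorm (carre_du_champ \<kappa> F F z)))"

text \<open>
  \<open>exp(-a/b)\<close> for \<open>a, b \<ge> 0\<close>, with the limiting value \<open>exp(-\<infinity>) = 0\<close> when \<open>b = 0 < a\<close>, where
  HOL's \<open>a / 0 = 0\<close> would give 1. The case \<open>a = b = 0\<close> is read as 1.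
\<close>

definition exp_neg_quot :: "real \<Rightarrow> real \<Rightarrow> real" where
  "exp_neg_quot a b = (if b = 0 \<and> 0 < a then 0 else exp (- a / b))"

end

theory Submission
  imports Defs
begin

text \<open>
  Let \<open>f\<close> be centred and put \<open>m(\<theta>) = E tr exp(\<theta> f)\<close>. Everything follows from a bound on \<open>m\<close> by the
  Laplace transform method, and \<open>m\<close> is controlled through its derivative \<open>E tr (f exp(\<theta> f))\<close>
  (\<open>mgf_has_derivative\<close>). The semigroup interpolates between \<open>f\<close>, at time \<open>0\<close>, and \<open>E f = 0\<close>, at time
  \<open>\<infinity>\<close> by ergodicity, so that
  \<open>m'(\<theta>) = - \<integral>\<^sub>0\<^sup>\<infinity> E tr (L P_t f exp(\<theta> f)) dt\<close>.
  Three estimates bound \<open>- E tr (L P_t f exp(\<theta> f))\<close> by \<open>\<theta> exp(- t / c)\<close> times an entropy.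

  \<^item> \<open>exponential_chain_rule\<close>: noncommutativity and jumps rule out a chain rule, but for reversible
    processes an inequality survives. It comes from a mean value inequality for traces
    (\<open>trace_mean_value_inequality\<close>) applied to the values of the process at two times, and it
    bounds this quantity by a combination of \<open>E tr (\<Gamma>(f) exp(\<theta> f))\<close> and \<open>E tr (\<Gamma>(P_t f) exp(\<theta> f))\<close>.
  \<^item> \<open>carre_decay\<close>: the Bakry--Emery criterion says that \<open>s \<mapsto> E tr (\<Gamma>(P_s f) P_{t-s} G)\<close> decays at
    rate \<open>2 / c\<close> for positive semidefinite \<open>G\<close>, so \<open>\<Gamma>(P_t f)\<close> may be replaced by
    \<open>exp(- 2 t / c) P_t \<Gamma>(f)\<close>.
  \<^item> \<open>entropy_inequality\<close> and \<open>exp_moment_PM_le\<close>: by the Gibbs variational principle the weight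
    \<open>exp(\<theta> f)\<close> is decoupled from \<open>\<Gamma>(f)\<close> and \<open>P_t \<Gamma>(f)\<close>, at the price of the exponential moment that defines
    \<open>r(\<beta>)\<close> and of the entropy of \<open>exp(\<theta> f)\<close>. The latter is again expressed by \<open>m\<close> and \<open>m'\<close>.

  The result is the differential inequality \<open>mgf_derivative_le\<close>, which integrates to \<open>mgf_le\<close>. If \<open>\<Gamma>(f)\<close>
  is bounded by \<open>v\<close> then \<open>r(\<beta>) \<le> v\<close> for all \<open>\<beta>\<close>, and \<open>\<beta> \<rightarrow> \<infinity>\<close> gives the subgaussian case. The bounds
  for the minimum eigenvalue are those for the maximum eigenvalue of \<open>- f\<close>.

  All trace inequalities are finite-dimensional and are proved by expanding in two eigenbases. On the
  side of the semigroup, one-sided \<open>L\<^sup>2\<close> differentiability has to be upgraded to differentiability of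
  expectations of products of three unbounded factors (\<open>triple_diagonal_has_derivative\<close>); here
  reversibility and the contractivity of \<open>P_t\<close> in \<open>L\<^sup>2\<close> and \<open>L\<^sup>4\<close> suffice.
\<close>

section \<open>Hermitian matrices and their spectral decomposition\<close>

definition cinner :: "complex^'n \<Rightarrow> complex^'n \<Rightarrow> complex" where
  "cinner x y = (\<Sum>i\<in>UNIV. cnj (x $ i) * y $ i)"

lemma cinner_add_right: "cinner x (y + z) = cinner x y + cinner x z"
  by (simp add: cinner_def algebra_simps sum.distrib)

lemma cinner_smult_right: "cinner x (a *s y) = a * cinner x y"
  by (simp add: cinner_def algebra_simps sum_distrib_left)

lemma cinner_scaleR_right: "cinner x (a *\<^sub>R y) = a *\<^sub>R cinner x y"
  by (simp add: cinner_def scaleR_sum_right)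

lemma cinner_commute: "cinner y x = cnj (cinner x y)"
  by (simp add: cinner_def cnj_sum mult.commute)

lemma inner_eq_Re_cinner: "x \<bullet> y = Re (cinner x y)"
  by (simp add: cinner_def inner_vec_def inner_complex_def)

lemma cinner_self: "cinner x x = of_real ((norm x)\<^sup>2)"
proof -
  have "Im (cinner x x) = 0" by (simp add: cinner_def mult.commute)
  moreover have "Re (cinner x x) = (norm x)\<^sup>2"
    by (simp add: inner_eq_Re_cinner[symmetric] power2_norm_eq_inner)
  ultimately show ?thesis by (simp add: complex_eq_iff)
qed

lemma cinner_matrix_vector: "cinner x (A *v y) = cinner (cmat_adjoint A *v x) y"
  unfolding cinner_def cmat_adjoint_def matrix_vector_mult_def
  by (simp add: sum_distrib_left sum_distrib_right cnj_sum)
     (subst sum.swap, simp add: mult_ac)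

lemma cinner_hermitian:
  "cmat_hermitian A \<Longrightarrow> cinner x (A *v y) = cinner (A *v x) y"
  by (simp add: cinner_matrix_vector cmat_hermitian_def)

text \<open>These are fewer than \<open>n\<close> homogeneous linear equations: the coefficient matrix, padded with zero rows,
  is singular.\<close>

lemma exists_orthogonal_vector:
  fixes u :: "'n::finite \<Rightarrow> complex^'n"
  assumes "I \<noteq> UNIV"
  obtains w where "w \<noteq> 0" "\<And>i. i \<in> I \<Longrightarrow> cinner (u i) w = 0"
proof -
  define M :: "complex^'n^'n" where "M = (\<chi> i j. if i \<in> I then cnj (u i $ j) else 0)"
  obtain k where k: "k \<notin> I" using assms by auto
  have "\<not> (\<exists>B. M ** B = mat 1)"
  proof
    assume "\<exists>B. M ** B = mat 1"
    then obtain B where "M ** B = mat 1" by auto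
    then have "(M ** B) $ k $ k = 1" by (simp add: mat_def)
    then show False using k by (simp add: M_def matrix_matrix_mult_def)
  qed
  then have "\<not> (\<exists>B. B ** M = mat 1)"
    using matrix_left_right_inverse[of M] by blast
  then obtain w where w: "M *v w = 0" "w \<noteq> 0"
    unfolding matrix_left_invertible_ker by blast
  have "cinner (u i) w = 0" if "i \<in> I" for i
  proof -
    have "cinner (u i) w = (M *v w) $ i"
      using that by (simp add: cinner_def M_def matrix_vector_mult_def)
    then show ?thesis using w by simp
  qed
  with w show ?thesis using that by blast
qed

lemma linear_le_quadratic_imp_zero:
  fixes p q :: real
  assumes "\<And>t. t * p \<le> t\<^sup>2 * q"
  shows "p = 0"
proof (rule ccontr)
  assume p: "p \<noteq> 0"
  define K where "K = \<bar>q\<bar> + 1"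
  have K: "K > 0" by (simp add: K_def)
  (* a step in the direction of p that is too short for the quadratic term to compensate *)
  define t where "t = p / (2 * K)"
  have "t * p = p\<^sup>2 / (2 * K)" by (simp add: t_def power2_eq_square)
  moreover have "t\<^sup>2 * q \<le> t\<^sup>2 * K" by (intro mult_left_mono) (auto simp: K_def)
  moreover have "t\<^sup>2 * K = p\<^sup>2 / (4 * K)"
    using K by (simp add: t_def power2_eq_square field_simps)
  ultimately have "p\<^sup>2 / (2 * K) \<le> p\<^sup>2 / (4 * K)"
    using assms[of t] by linarith
  moreover have "p\<^sup>2 > 0" using p by auto
  moreover note K
  ultimately show False by (simp add: field_simps)
qed

text \<open>The maximiser of the Rayleigh quotient on an invariant subspace is an eigenvector.\<close>

lemma exists_orthogonal_eigenvector:
  fixes A :: "complex^'n^'n" and u :: "'n \<Rightarrow> complex^'n"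
  assumes A: "cmat_hermitian A" and I: "I \<noteq> UNIV"
    and eig: "\<And>i. i \<in> I \<Longrightarrow> A *v u i = complex_of_real (x i) *s u i"
  obtains w l where "norm w = 1" "A *v w = complex_of_real l *s w"
    "\<And>i. i \<in> I \<Longrightarrow> cinner (u i) w = 0"
proof -
  define V where "V = {y. \<forall>i\<in>I. cinner (u i) y = 0}"
  have V_add: "y + t *\<^sub>R z \<in> V" if "y \<in> V" "z \<in> V" for y z t
    using that by (simp add: V_def cinner_add_right cinner_scaleR_right)
  have V_scale: "t *\<^sub>R z \<in> V" if "z \<in> V" for z t
    using that by (simp add: V_def cinner_scaleR_right)
  have V_A: "A *v y \<in> V" if "y \<in> V" for y
  proof -
    have "cinner (u i) (A *v y) = 0" if "i \<in> I" for i
    proof -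
      have "cinner (u i) (A *v y) = cnj (cinner y (A *v u i))"
        using A by (simp add: cinner_hermitian cinner_commute[of "A *v u i" y])
      also have "\<dots> = 0"
        using eig[OF that] \<open>y \<in> V\<close> that
        by (simp add: cinner_smult_right V_def cinner_commute[of y])
      finally show ?thesis .
    qed
    then show ?thesis by (simp add: V_def)
  qed
  have contc: "continuous_on UNIV (\<lambda>y. cinner z y)" for z :: "complex^'n"
    unfolding cinner_def by (intro continuous_intros)
  have contA: "continuous_on UNIV (\<lambda>y. A *v y)"
    unfolding matrix_vector_mult_def by (intro continuous_intros)
  have "closed V"
  proof -
    have "V = (\<Inter>i\<in>I. (\<lambda>y. cinner (u i) y) -` {0})" by (auto simp: V_def)
    moreover have "closed ((\<lambda>y. cinner (u i) y) -` {0})" for i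
      using contc[of "u i"] by (simp add: continuous_closed_vimage continuous_on_eq_continuous_at)
    ultimately show ?thesis by auto
  qed
  then have "compact (sphere 0 1 \<inter> V)"
    by (simp add: compact_Int_closed)
  moreover obtain w0 where w0: "w0 \<noteq> 0" "\<And>i. i \<in> I \<Longrightarrow> cinner (u i) w0 = 0"
    using exists_orthogonal_vector[OF I] by blast
  then have "(1 / norm w0) *\<^sub>R w0 \<in> sphere 0 1 \<inter> V"
    by (auto simp: V_def cinner_scaleR_right)
  then have "sphere 0 1 \<inter> V \<noteq> {}" by blast
  moreover have "continuous_on (sphere 0 1 \<inter> V) (\<lambda>y. y \<bullet> (A *v y))"
    by (intro continuous_intros continuous_on_subset[OF contA]) auto
  ultimately obtain w where w: "w \<in> sphere 0 1 \<inter> V"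
    and wmax: "\<And>y. y \<in> sphere 0 1 \<inter> V \<Longrightarrow> y \<bullet> (A *v y) \<le> w \<bullet> (A *v w)"
    using continuous_attains_sup[of "sphere 0 1 \<inter> V" "\<lambda>y. y \<bullet> (A *v y)"] by blast
  define l where "l = w \<bullet> (A *v w)"
  have Ascale: "A *v (t *\<^sub>R y) = t *\<^sub>R (A *v y)" for t y
    by (simp add: vec_eq_iff matrix_vector_mult_def scaleR_sum_right)
  have ray: "y \<bullet> (A *v y) \<le> l * (norm y)\<^sup>2" if "y \<in> V" for y
  proof (cases "y = 0")
    case False
    have "(1 / norm y) *\<^sub>R y \<in> sphere 0 1 \<inter> V" using False V_scale[OF that] by auto
    from wmax[OF this] have "(1 / norm y)\<^sup>2 * (y \<bullet> (A *v y)) \<le> l"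
      by (simp add: Ascale l_def power2_eq_square)
    then show ?thesis using False by (simp add: field_simps)
  qed auto
  have sym: "x \<bullet> (A *v y) = (A *v x) \<bullet> y" for x y
    by (simp add: inner_eq_Re_cinner cinner_hermitian[OF A])
  (* the residual e stays in V; optimality of w along w + t e forces e = 0 *)
  define e where "e = A *v w - l *\<^sub>R w"
  have wV: "w \<in> V" and wn: "norm w = 1" using w by auto
  have eV: "e \<in> V" using V_add[OF V_A[OF wV] wV, of "-l"] by (simp add: e_def)
  have "2 * (e \<bullet> e) = 0"
  proof (rule linear_le_quadratic_imp_zero)
    fix t
    have "(w + t *\<^sub>R e) \<bullet> (A *v (w + t *\<^sub>R e)) \<le> l * (norm (w + t *\<^sub>R e))\<^sup>2"
      by (rule ray[OF V_add[OF wV eV]])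
    moreover have "(w + t *\<^sub>R e) \<bullet> (A *v (w + t *\<^sub>R e))
        = l + 2 * t * (e \<bullet> (A *v w)) + t\<^sup>2 * (e \<bullet> (A *v e))"
      using sym[of w e]
      by (simp add: l_def matrix_vector_right_distrib Ascale inner_add_left inner_add_right
          power2_eq_square inner_commute algebra_simps)
    moreover have "(norm (w + t *\<^sub>R e))\<^sup>2 = 1 + 2 * t * (e \<bullet> w) + t\<^sup>2 * (e \<bullet> e)"
      using wn unfolding power2_norm_eq_inner norm_eq_1
      by (simp add: inner_add_left inner_add_right power2_eq_square inner_commute algebra_simps)
    moreover have "e \<bullet> (A *v w) = e \<bullet> e + l * (e \<bullet> w)"
      by (simp add: e_def inner_diff_left inner_diff_right algebra_simps)
    ultimately show "t * (2 * (e \<bullet> e)) \<le> t\<^sup>2 * (l * (e \<bullet> e) - e \<bullet> (A *v e))"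
      by (simp add: algebra_simps)
  qed
  then have "A *v w = l *\<^sub>R w" by (simp add: e_def)
  also have "l *\<^sub>R w = complex_of_real l *s w"
    by (simp add: vec_eq_iff complex_eq_iff)
  finally show ?thesis using that wn wV by (auto simp: V_def)
qed

text \<open>The induction runs over the number of eigenvectors found so far, since the size of the matrix is a
  type and cannot be varied.\<close>

lemma exists_orthonormal_eigenfamily:
  fixes A :: "complex^'n^'n"
  assumes A: "cmat_hermitian A" and "k \<le> CARD('n)"
  shows "\<exists>I u x. card (I :: 'n set) = k \<and>
    (\<forall>i\<in>I. A *v u i = complex_of_real (x i) *s u i) \<and>
    (\<forall>i\<in>I. \<forall>j\<in>I. cinner (u i) (u j) = (if i = j then 1 else 0))"
  using assms(2)
proof (induction k)
  case 0
  show ?case by (rule exI[of _ "{}"]) auto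
next
  case (Suc k)
  then obtain I :: "'n set" and u x where I: "card I = k"
    and eig: "\<And>i. i \<in> I \<Longrightarrow> A *v u i = complex_of_real (x i) *s u i"
    and orth: "\<And>i j. i \<in> I \<Longrightarrow> j \<in> I \<Longrightarrow> cinner (u i) (u j) = (if i = j then 1 else 0)"
    using Suc_leD[of k] by (metis (no_types, lifting))
  have "I \<noteq> UNIV" using I Suc.prems by auto
  then obtain m where m: "m \<notin> I" by auto
  obtain w l where w: "norm w = 1" "A *v w = complex_of_real l *s w"
    "\<And>i. i \<in> I \<Longrightarrow> cinner (u i) w = 0"
    using exists_orthogonal_eigenvector[of A I u x, OF A \<open>I \<noteq> UNIV\<close> eig] by blast
  have w': "cinner w (u i) = 0" if "i \<in> I" for i
    using w(3)[OF that] by (simp add: cinner_commute[of w])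
  have ww: "cinner w w = 1" using w(1) by (simp add: cinner_self)
  show ?case
  proof (intro exI conjI)
    show "card (insert m I) = Suc k" using m I by simp
    show "\<forall>i\<in>insert m I. A *v (u(m := w)) i = complex_of_real ((x(m := l)) i) *s (u(m := w)) i"
      using m eig w by auto
    show "\<forall>i\<in>insert m I. \<forall>j\<in>insert m I.
        cinner ((u(m := w)) i) ((u(m := w)) j) = (if i = j then 1 else 0)"
      using m orth w(3) w' ww by auto
  qed
qed

lemma cmat_adjoint_mult: "cmat_adjoint (A ** B) = cmat_adjoint B ** cmat_adjoint A"
  by (simp add: vec_eq_iff cmat_adjoint_def matrix_matrix_mult_def cnj_sum mult.commute)

lemma cmat_adjoint_adjoint [simp]: "cmat_adjoint (cmat_adjoint A) = A"
  by (simp add: vec_eq_iff cmat_adjoint_def)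

lemma cmat_adjoint_real_diag [simp]: "cmat_adjoint (real_diag x) = real_diag x"
  by (auto simp: vec_eq_iff cmat_adjoint_def real_diag_def)

lemma real_diag_mult_left: "(real_diag x ** B) $ i $ j = of_real (x i) * B $ i $ j"
  by (simp add: real_diag_def matrix_matrix_mult_def if_distrib[of "\<lambda>t. t * _"] cong: if_cong)

lemma real_diag_mult_right: "(B ** real_diag x) $ i $ j = B $ i $ j * of_real (x j)"
  by (simp add: real_diag_def matrix_matrix_mult_def if_distrib[of "\<lambda>t. _ * t"] cong: if_cong)

abbreviation spectral_form :: "complex^'n^'n \<Rightarrow> ('n \<Rightarrow> real) \<Rightarrow> complex^'n^'n" where
  "spectral_form U x \<equiv> U ** real_diag x ** cmat_adjoint U"

lemma hermitian_spectral_form: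
  "cmat_hermitian (spectral_form U x)"
  by (simp add: cmat_hermitian_def cmat_adjoint_mult matrix_mul_assoc)

lemma hermitian_diagonalization:
  fixes A :: "complex^'n^'n"
  assumes A: "cmat_hermitian A"
  obtains U x where "cmat_unitary U" "A = spectral_form U x"
proof -
  obtain I :: "'n set" and u x where I: "card I = CARD('n)"
    and eig: "\<And>i. i \<in> I \<Longrightarrow> A *v u i = complex_of_real (x i) *s u i"
    and orth: "\<And>i j. i \<in> I \<Longrightarrow> j \<in> I \<Longrightarrow> cinner (u i) (u j) = (if i = j then 1 else 0)"
    using exists_orthonormal_eigenfamily[OF A order.refl] by blast
  have IU: "i \<in> I" for i using I card_subset_eq[of "UNIV :: 'n set" I] by auto
  define U :: "complex^'n^'n" where "U = (\<chi> i j. u j $ i)"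
  have "cmat_adjoint U ** U = mat 1"
    using orth IU
    by (simp add: vec_eq_iff cmat_adjoint_def U_def matrix_matrix_mult_def mat_def cinner_def)
  then have U: "cmat_unitary U"
    using matrix_left_right_inverse[of U] by (simp add: cmat_unitary_def)
  have "A ** U = U ** real_diag x"
  proof -
    have "(A ** U) $ i $ j = (A *v u j) $ i" for i j
      by (simp add: U_def matrix_matrix_mult_def matrix_vector_mult_def)
    then show ?thesis
      using eig IU by (simp add: vec_eq_iff real_diag_mult_right U_def mult.commute)
  qed
  then have "A = spectral_form U x"
    using U by (metis cmat_unitary_def matrix_mul_assoc matrix_mul_rid)
  with U show ?thesis using that by blast
qed

text \<open>If two unitary diagonalizations yield the same matrix, the transition matrix \<open>V\<^sup>* U\<close> only
  connects equal eigenvalues, so any function of the eigenvalues gives the same matrix.\<close>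

lemma spectral_fun_eq:
  fixes U :: "complex^'n^'n"
  assumes U: "cmat_unitary U"
  shows "spectral_fun \<phi> (spectral_form U x)
    = spectral_form U (\<lambda>i. \<phi> (x i))"
  unfolding spectral_fun_def
proof (rule the_equality)
  show "\<exists>V y. cmat_unitary V \<and> spectral_form U x = spectral_form V y
     \<and> spectral_form U (\<lambda>i. \<phi> (x i)) = spectral_form V (\<lambda>i. \<phi> (y i))"
    using U by blast
next
  fix B
  assume "\<exists>V y. cmat_unitary V \<and> spectral_form U x = spectral_form V y
     \<and> B = spectral_form V (\<lambda>i. \<phi> (y i))"
  then obtain V y where V: "cmat_unitary V"
    and eq: "spectral_form U x = spectral_form V y"
    and B: "B = spectral_form V (\<lambda>i. \<phi> (y i))" by blast
  have UU: "cmat_adjoint U ** U = mat 1" "U ** cmat_adjoint U = mat 1"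
    and VV: "cmat_adjoint V ** V = mat 1" "V ** cmat_adjoint V = mat 1"
    using U V by (auto simp: cmat_unitary_def)
  define T where "T = cmat_adjoint V ** U"
  have "cmat_adjoint V ** (spectral_form U x) ** U = T ** real_diag x"
    using UU by (simp add: T_def matrix_mul_assoc[symmetric])
  moreover have "cmat_adjoint V ** (spectral_form V y) ** U = real_diag y ** T"
    using VV(1) by (simp add: T_def matrix_mul_assoc)
  ultimately have "T ** real_diag x = real_diag y ** T" using eq by simp
  then have "(T ** real_diag x) $ i $ j = (real_diag y ** T) $ i $ j" for i j by simp
  then have *: "T $ i $ j * of_real (x j) = of_real (y i) * T $ i $ j" for i j
    by (simp add: real_diag_mult_left real_diag_mult_right)
  have "T $ i $ j = 0 \<or> x j = y i" for i j using *[of i j] by auto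
  then have "T $ i $ j * of_real (\<phi> (x j)) = of_real (\<phi> (y i)) * T $ i $ j" for i j
    by (metis mult.commute mult_zero_left)
  then have T: "T ** real_diag (\<lambda>i. \<phi> (x i)) = real_diag (\<lambda>i. \<phi> (y i)) ** T"
    by (simp add: vec_eq_iff real_diag_mult_left real_diag_mult_right)
  have "V ** T = U" using VV by (simp add: T_def matrix_mul_assoc)
  then have "spectral_form U (\<lambda>i. \<phi> (x i))
      = V ** (T ** real_diag (\<lambda>i. \<phi> (x i))) ** cmat_adjoint U" by (simp add: matrix_mul_assoc)
  also have "\<dots> = V ** real_diag (\<lambda>i. \<phi> (y i)) ** (T ** cmat_adjoint U)"
    by (simp add: T matrix_mul_assoc)
  also have "T ** cmat_adjoint U = cmat_adjoint V"
    using UU by (simp add: T_def matrix_mul_assoc[symmetric])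
  finally show "B = spectral_form U (\<lambda>i. \<phi> (x i))" using B by simp
qed

section \<open>Trace inequalities\<close>

lemma matrix_diff_ldistrib: "A ** (B - C) = A ** B - A ** (C :: complex^'k^'m)" for A :: "complex^'m^'n"
  by (simp add: vec_eq_iff matrix_matrix_mult_def sum_subtractf algebra_simps)

lemma matrix_diff_rdistrib: "(A - B) ** C = A ** C - B ** (C :: complex^'k^'m)" for A :: "complex^'m^'n"
  by (simp add: vec_eq_iff matrix_matrix_mult_def sum_subtractf algebra_simps)

lemma matrix_add_rdistrib: "(A + B) ** C = A ** C + B ** (C :: complex^'k^'m)" for A :: "complex^'m^'n"
  by (simp add: vec_eq_iff matrix_matrix_mult_def sum.distrib algebra_simps)

lemma matrix_scaleR_left: "(r *\<^sub>R A) ** C = r *\<^sub>R (A ** (C :: complex^'k^'m))" for A :: "complex^'m^'n"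
  by (simp add: vec_eq_iff matrix_matrix_mult_def scaleR_sum_right)

lemma matrix_scaleR_right: "A ** (r *\<^sub>R C) = r *\<^sub>R (A ** (C :: complex^'k^'m))" for A :: "complex^'m^'n"
  by (simp add: vec_eq_iff matrix_matrix_mult_def scaleR_sum_right)

lemmas matrix_distribs = matrix_add_ldistrib matrix_add_rdistrib matrix_diff_ldistrib
  matrix_diff_rdistrib matrix_scaleR_left matrix_scaleR_right

lemma cmat_adjoint_add: "cmat_adjoint (A + B) = cmat_adjoint A + cmat_adjoint B"
  by (simp add: vec_eq_iff cmat_adjoint_def)

lemma cmat_adjoint_diff: "cmat_adjoint (A - B) = cmat_adjoint A - cmat_adjoint B"
  by (simp add: vec_eq_iff cmat_adjoint_def)

lemma cmat_adjoint_scaleR: "cmat_adjoint (r *\<^sub>R A) = r *\<^sub>R cmat_adjoint A"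
  by (simp add: vec_eq_iff cmat_adjoint_def)

lemma bounded_linear_cmat_adjoint: "bounded_linear (cmat_adjoint :: complex^'n^'m \<Rightarrow> _)"
  by (intro linear_conv_bounded_linear[THEN iffD1] linearI cmat_adjoint_add cmat_adjoint_scaleR)

lemma hermitian_diff: "cmat_hermitian A \<Longrightarrow> cmat_hermitian B \<Longrightarrow> cmat_hermitian (A - B)"
  and hermitian_scaleR: "cmat_hermitian A \<Longrightarrow> cmat_hermitian (r *\<^sub>R A)"
  by (simp_all add: cmat_hermitian_def cmat_adjoint_add cmat_adjoint_diff cmat_adjoint_scaleR)

definition retr :: "complex^'n^'n \<Rightarrow> real" where
  "retr A = Re (trace A)"

lemma retr_add: "retr (A + B) = retr A + retr B"
  and retr_diff: "retr (A - B) = retr A - retr B"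
  and retr_scaleR: "retr (r *\<^sub>R A) = r * retr A"
  by (simp_all add: retr_def trace_def sum.distrib sum_subtractf sum_distrib_left)

lemma retr_zero [simp]: "retr 0 = 0"
  by (simp add: retr_def trace_def)

lemma bounded_linear_retr: "bounded_linear (retr :: complex^'n^'n \<Rightarrow> real)"
  by (intro linear_conv_bounded_linear[THEN iffD1] linearI) (simp_all add: retr_add retr_scaleR)

lemma retr_mult_commute: "retr (A ** B) = retr (B ** A)" for A :: "complex^'m^'n"
  by (simp add: retr_def trace_def matrix_matrix_mult_def mult.commute) (subst sum.swap, simp)

lemma retr_cycle: "retr (A ** B ** C) = retr (C ** A ** B)"
  by (subst retr_mult_commute) (simp add: matrix_mul_assoc)

lemma retr_mult_adjoint:
  "retr (A ** cmat_adjoint B) = (\<Sum>i\<in>UNIV. \<Sum>j\<in>UNIV. Re (A $ i $ j * cnj (B $ i $ j)))"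
  by (simp add: retr_def trace_def matrix_matrix_mult_def cmat_adjoint_def)

lemma mult_adjoint_diagonal:
  "(K ** cmat_adjoint K) $ i $ i = of_real (\<Sum>j\<in>UNIV. (cmod (K $ i $ j))\<^sup>2)"
  by (simp add: matrix_matrix_mult_def cmat_adjoint_def complex_norm_square del: of_real_power)

lemma Re_mult_cnj_self: "Re (z * cnj z) = (cmod z)\<^sup>2"
  by (simp add: cmod_power2) (simp add: power2_eq_square)

lemma Re_of_real_mult: "Re (complex_of_real r * z) = r * Re z"
  by simp

lemma ntrace_eq_retr: "ntrace (A :: complex^'n^'n) = retr A / real CARD('n)"
  by (simp add: ntrace_def retr_def)

lemma unitary_cancel:
  assumes "cmat_unitary U"
  shows "B ** U ** cmat_adjoint U = B" "B ** cmat_adjoint U ** U = B"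
    "U ** cmat_adjoint U = mat 1" "cmat_adjoint U ** U = mat 1"
  using assms by (simp_all add: cmat_unitary_def matrix_mul_assoc[symmetric])

lemma unitary_overlap:
  assumes "cmat_unitary U" "cmat_unitary V"
  shows "cmat_unitary (cmat_adjoint U ** V)"
  unfolding cmat_unitary_def
  by (simp add: cmat_adjoint_mult matrix_mul_assoc unitary_cancel[OF assms(1)] unitary_cancel[OF assms(2)])

lemma unitary_row_sum:
  assumes "cmat_unitary W" shows "(\<Sum>j\<in>UNIV. (cmod (W $ i $ j))\<^sup>2) = 1"
proof -
  have "(W ** cmat_adjoint W) $ i $ i = 1" using assms by (simp add: cmat_unitary_def mat_def)
  then have "complex_of_real (\<Sum>j\<in>UNIV. (cmod (W $ i $ j))\<^sup>2) = 1"
    by (simp only: mult_adjoint_diagonal)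
  then show ?thesis using of_real_eq_1_iff by blast
qed

lemma unitary_column_sum:
  assumes "cmat_unitary W" shows "(\<Sum>i\<in>UNIV. (cmod (W $ i $ j))\<^sup>2) = 1"
proof -
  have "cmat_unitary (cmat_adjoint W)" using assms by (simp add: cmat_unitary_def)
  from unitary_row_sum[OF this, of j] show ?thesis by (simp add: cmat_adjoint_def)
qed

lemma spectral_form_mult:
  assumes "cmat_unitary U"
  shows "(spectral_form U x) ** (spectral_form U y)
    = spectral_form U (\<lambda>i. x i * y i)"
proof -
  have "real_diag x ** real_diag y = real_diag (\<lambda>i. x i * y i)"
    by (simp add: vec_eq_iff real_diag_mult_left) (simp add: real_diag_def)
  moreover have "(spectral_form U x) ** (spectral_form U y)
      = U ** (real_diag x ** real_diag y) ** cmat_adjoint U"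
    by (simp add: matrix_mul_assoc unitary_cancel[OF assms])
  ultimately show ?thesis by simp
qed

lemma spectral_form_scaleR:
  "r *\<^sub>R (spectral_form U x) = spectral_form U (\<lambda>i. r * x i)"
proof -
  have "r *\<^sub>R real_diag x = real_diag (\<lambda>i. r * x i)"
    by (auto simp: vec_eq_iff real_diag_def complex_eq_iff)
  moreover have "r *\<^sub>R (spectral_form U x) = U ** (r *\<^sub>R real_diag x) ** cmat_adjoint U"
    by (simp only: matrix_scaleR_left matrix_scaleR_right)
  ultimately show ?thesis by simp
qed

lemma retr_spectral_form:
  assumes "cmat_unitary U"
  shows "retr (spectral_form U x) = (\<Sum>i\<in>UNIV. x i)"
proof -
  have "retr (spectral_form U x) = retr (real_diag x)"
    using assms by (subst retr_cycle) (simp add: cmat_unitary_def)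
  then show ?thesis by (simp add: retr_def trace_def real_diag_def)
qed

text \<open>Trace inequalities for two matrices reduce to scalar ones by expanding in the eigenbasis of one
  matrix on the left and of the other on the right: the functions of the two matrices become
  functions of the two eigenvalues, and the coefficients are the same for every function.\<close>

lemma retr_left_eigenbasis:
  assumes U: "cmat_unitary U" and V: "cmat_unitary V"
  shows "retr (C ** (spectral_form U x)) =
    (\<Sum>i\<in>UNIV. \<Sum>j\<in>UNIV. x i *
      Re ((cmat_adjoint U ** C ** V) $ i $ j * cnj ((cmat_adjoint U ** V) $ i $ j)))"
proof -
  have VV: "V ** cmat_adjoint V = mat 1" using V by (simp add: cmat_unitary_def)
  have "retr (C ** (spectral_form U x)) = retr (cmat_adjoint U ** C ** U ** real_diag x)"
    using retr_cycle[of "C ** U" "real_diag x" "cmat_adjoint U"] by (simp add: matrix_mul_assoc)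
  also have "cmat_adjoint U ** C ** U = (cmat_adjoint U ** C ** V) ** cmat_adjoint (cmat_adjoint U ** V)"
    by (simp add: cmat_adjoint_mult matrix_mul_assoc unitary_cancel[OF V])
  also have "retr (cmat_adjoint U ** C ** V ** cmat_adjoint (cmat_adjoint U ** V) ** real_diag x)
      = retr (real_diag x ** (cmat_adjoint U ** C ** V) ** cmat_adjoint (cmat_adjoint U ** V))"
    by (rule retr_cycle)
  finally show ?thesis
    by (simp only: retr_mult_adjoint real_diag_mult_left mult.assoc Re_of_real_mult)
qed

lemma retr_right_eigenbasis:
  assumes U: "cmat_unitary U" and V: "cmat_unitary V"
  shows "retr (C ** (spectral_form V y)) =
    (\<Sum>i\<in>UNIV. \<Sum>j\<in>UNIV. y j *
      Re ((cmat_adjoint U ** C ** V) $ i $ j * cnj ((cmat_adjoint U ** V) $ i $ j)))"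
proof -
  have UU: "U ** cmat_adjoint U = mat 1" using U by (simp add: cmat_unitary_def)
  have "retr (C ** (spectral_form V y))
      = retr ((U ** cmat_adjoint U) ** C ** spectral_form V y)"
    using UU by (simp add: matrix_mul_assoc)
  also have "\<dots> = retr ((cmat_adjoint U ** C ** V ** real_diag y) ** cmat_adjoint (cmat_adjoint U ** V))"
    using retr_mult_commute[of U "cmat_adjoint U ** C ** spectral_form V y"]
    by (simp add: matrix_mul_assoc cmat_adjoint_mult)
  finally show ?thesis
    by (simp only: retr_mult_adjoint real_diag_mult_right mult.assoc mult.left_commute[of _ "complex_of_real _"]
        Re_of_real_mult)
qed

lemma retr_spectral_product:
  assumes U: "cmat_unitary U" and V: "cmat_unitary V"
  shows "retr ((spectral_form U x) ** (spectral_form V y)) =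
    (\<Sum>i\<in>UNIV. \<Sum>j\<in>UNIV. x i * y j * (cmod ((cmat_adjoint U ** V) $ i $ j))\<^sup>2)"
proof -
  have UU: "cmat_adjoint U ** U = mat 1" using U by (simp add: cmat_unitary_def)
  have "cmat_adjoint U ** (spectral_form U x) ** V
      = real_diag x ** (cmat_adjoint U ** V)"
    using UU by (simp add: matrix_mul_assoc)
  then show ?thesis
    by (simp only: retr_right_eigenbasis[OF U V] real_diag_mult_left mult.assoc Re_of_real_mult Re_mult_cnj_self
        mult.left_commute[of _ "x _"])
qed

lemma retr_square_left:
  assumes U: "cmat_unitary U" and V: "cmat_unitary V" and X: "cmat_hermitian X"
  shows "retr (X ** X ** (spectral_form U x)) =
    (\<Sum>i\<in>UNIV. \<Sum>j\<in>UNIV. x i * (cmod ((cmat_adjoint U ** X ** V) $ i $ j))\<^sup>2)"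
proof -
  have VV: "V ** cmat_adjoint V = mat 1" using V by (simp add: cmat_unitary_def)
  have X': "cmat_adjoint X = X" using X by (simp add: cmat_hermitian_def)
  have "retr (X ** X ** (spectral_form U x))
      = retr (cmat_adjoint U ** X ** X ** U ** real_diag x)"
    using retr_cycle[of "X ** X ** U" "real_diag x" "cmat_adjoint U"] by (simp add: matrix_mul_assoc)
  also have "cmat_adjoint U ** X ** X ** U
      = (cmat_adjoint U ** X ** V) ** cmat_adjoint (cmat_adjoint U ** X ** V)"
    by (simp add: cmat_adjoint_mult matrix_mul_assoc X' unitary_cancel[OF V])
  also have "((cmat_adjoint U ** X ** V) ** cmat_adjoint (cmat_adjoint U ** X ** V)) $ i $ i
      = of_real (\<Sum>j\<in>UNIV. (cmod ((cmat_adjoint U ** X ** V) $ i $ j))\<^sup>2)" for i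
    by (rule mult_adjoint_diagonal)
  then have "retr ((cmat_adjoint U ** X ** V) ** cmat_adjoint (cmat_adjoint U ** X ** V) ** real_diag x)
      = (\<Sum>i\<in>UNIV. (\<Sum>j\<in>UNIV. (cmod ((cmat_adjoint U ** X ** V) $ i $ j))\<^sup>2) * x i)"
    by (simp add: retr_def trace_def real_diag_mult_right flip: of_real_mult)
  finally show ?thesis by (simp add: sum_distrib_left mult.commute)
qed

lemma retr_square_right:
  assumes U: "cmat_unitary U" and V: "cmat_unitary V" and X: "cmat_hermitian X"
  shows "retr (X ** X ** (spectral_form V y)) =
    (\<Sum>i\<in>UNIV. \<Sum>j\<in>UNIV. y j * (cmod ((cmat_adjoint U ** X ** V) $ i $ j))\<^sup>2)"
proof -
  have X': "cmat_adjoint X = X" using X by (simp add: cmat_hermitian_def)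
  have *: "(cmat_adjoint V ** X ** U) $ j $ i = cnj ((cmat_adjoint U ** X ** V) $ i $ j)" for i j
  proof -
    have "cmat_adjoint V ** X ** U = cmat_adjoint (cmat_adjoint U ** X ** V)"
      by (simp add: cmat_adjoint_mult X' matrix_mul_assoc)
    then show ?thesis by (simp add: cmat_adjoint_def)
  qed
  show ?thesis by (subst sum.swap) (simp add: retr_square_left[OF V U X] *)
qed

text \<open>With the eigenvalues \<open>a\<close> of \<open>A\<close> and \<open>b\<close> of \<open>B\<close>, this is the nonnegative combination, with the squared
  overlaps of the eigenbases as weights, of the scalar tangent inequality
  \<open>l exp b \<ge> exp a (1 + ln l + b - a)\<close>. The factor \<open>l\<close> amounts to adding \<open>ln l\<close> times the identity to \<open>B\<close>.\<close>

lemma klein_inequality: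
  fixes A B :: "complex^'n^'n"
  assumes A: "cmat_hermitian A" and B: "cmat_hermitian B" and l: "l > 0"
  shows "retr (A ** spectral_fun exp A) - retr (B ** spectral_fun exp A) - ln l * retr (spectral_fun exp A)
    \<ge> retr (spectral_fun exp A) - l * retr (spectral_fun exp B)"
proof -
  obtain U x where U: "cmat_unitary U" and AU: "A = spectral_form U x"
    using hermitian_diagonalization[OF A] .
  obtain V y where V: "cmat_unitary V" and BV: "B = spectral_form V y"
    using hermitian_diagonalization[OF B] .
  define w where "w i j = (cmod ((cmat_adjoint U ** V) $ i $ j))\<^sup>2" for i j
  have w0: "w i j \<ge> 0" for i j by (simp add: w_def)
  note W = unitary_overlap[OF U V]
  have rows: "(\<Sum>j\<in>UNIV. w i j) = 1" for i unfolding w_def by (rule unitary_row_sum[OF W])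
  have cols: "(\<Sum>i\<in>UNIV. w i j) = 1" for j unfolding w_def by (rule unitary_column_sum[OF W])
  have single: "(\<Sum>i\<in>UNIV. f i) = (\<Sum>i\<in>UNIV. \<Sum>j\<in>UNIV. f i * w i j)" for f :: "'n \<Rightarrow> real"
    by (simp add: sum_distrib_left[symmetric] rows)
  have single': "(\<Sum>j\<in>UNIV. f j) = (\<Sum>i\<in>UNIV. \<Sum>j\<in>UNIV. f j * w i j)" for f :: "'n \<Rightarrow> real"
    by (subst sum.swap) (simp add: sum_distrib_left[symmetric] cols)
  have eA: "spectral_fun exp A = spectral_form U (\<lambda>i. exp (x i))"
    by (simp add: AU spectral_fun_eq[OF U])
  have eB: "spectral_fun exp B = spectral_form V (\<lambda>i. exp (y i))"
    by (simp add: BV spectral_fun_eq[OF V])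
  have t1: "retr (A ** spectral_fun exp A) = (\<Sum>i\<in>UNIV. \<Sum>j\<in>UNIV. x i * exp (x i) * w i j)"
    unfolding eA unfolding AU by (simp only: spectral_form_mult[OF U] retr_spectral_form[OF U]) (rule single)
  have t2: "retr (B ** spectral_fun exp A) = (\<Sum>i\<in>UNIV. \<Sum>j\<in>UNIV. exp (x i) * y j * w i j)"
    unfolding eA unfolding BV by (subst retr_mult_commute) (simp add: retr_spectral_product[OF U V] w_def)
  have t3: "retr (spectral_fun exp A) = (\<Sum>i\<in>UNIV. \<Sum>j\<in>UNIV. exp (x i) * w i j)"
    unfolding eA by (simp only: retr_spectral_form[OF U]) (rule single)
  have t4: "retr (spectral_fun exp B) = (\<Sum>i\<in>UNIV. \<Sum>j\<in>UNIV. exp (y j) * w i j)"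
    unfolding eB by (simp only: retr_spectral_form[OF V]) (rule single')
  have scalar: "a * exp a - exp a * b - ln l * exp a - (exp a - l * exp b) \<ge> 0" for a b :: real
  proof -
    have "l * exp b = exp a * exp (ln l + b - a)" using l by (simp add: exp_add exp_diff)
    moreover have "exp a * exp (ln l + b - a) \<ge> exp a * (1 + (ln l + b - a))"
      by (intro mult_left_mono exp_ge_add_one_self) auto
    ultimately show ?thesis by (simp add: algebra_simps)
  qed
  have "0 \<le> (\<Sum>i\<in>UNIV. \<Sum>j\<in>UNIV.
      (x i * exp (x i) - exp (x i) * y j - ln l * exp (x i) - (exp (x i) - l * exp (y j))) * w i j)"
    by (intro sum_nonneg mult_nonneg_nonneg scalar w0)
  also have "\<dots> = retr (A ** spectral_fun exp A) - retr (B ** spectral_fun exp A)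
      - ln l * retr (spectral_fun exp A) - (retr (spectral_fun exp A) - l * retr (spectral_fun exp B))"
    unfolding t1 t2 t3 t4 by (simp add: algebra_simps sum.distrib sum_subtractf sum_distrib_left)
  finally show ?thesis by linarith
qed

text \<open>By convexity, the integral of \<open>exp\<close> over an interval is at most its trapezoidal approximation.\<close>

lemma exp_diff_le_trapezoid:
  fixes a b :: real
  shows "\<bar>exp a - exp b\<bar> \<le> \<bar>a - b\<bar> * (exp a + exp b) / 2"
proof -
  have *: "exp d - 1 \<le> d * (exp d + 1) / 2" if "d \<ge> 0" for d :: real
  proof -
    let ?g = "\<lambda>d::real. d * (exp d + 1) / 2 - exp d + 1"
    have "?g 0 \<le> ?g d"
    proof (rule DERIV_nonneg_imp_nondecreasing[OF that])
      fix u :: real assume "0 \<le> u"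
      have "(?g has_real_derivative (1 - exp u + u * exp u) / 2) (at u)"
        by (auto intro!: derivative_eq_intros simp: field_simps)
      moreover have "exp u * (1 - u) \<le> exp u * exp (-u)"
        using exp_ge_add_one_self[of "-u"] by (intro mult_left_mono) auto
      then have "0 \<le> (1 - exp u + u * exp u) / 2" by (simp add: exp_minus field_simps)
      ultimately show "\<exists>y. (?g has_real_derivative y) (at u) \<and> 0 \<le> y" by blast
    qed
    then show ?thesis by simp
  qed
  have **: "\<bar>exp a - exp b\<bar> \<le> \<bar>a - b\<bar> * (exp a + exp b) / 2" if "b \<le> a" for a b :: real
  proof -
    have "exp b * (exp (a - b) - 1) \<le> exp b * ((a - b) * (exp (a - b) + 1) / 2)"
      using that by (intro mult_left_mono *) auto
    moreover have "exp b * (exp (a - b) - 1) = exp a - exp b"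
      by (simp add: right_diff_distrib exp_add[symmetric])
    moreover have "exp b * (exp (a - b) + 1) = exp a + exp b"
      by (simp add: distrib_left exp_add[symmetric])
    then have "exp b * ((a - b) * (exp (a - b) + 1) / 2) = (a - b) * (exp a + exp b) / 2"
      by (metis mult.left_commute times_divide_eq_right)
    ultimately have "exp a - exp b \<le> (a - b) * (exp a + exp b) / 2"
      by linarith
    then show ?thesis using that by simp
  qed
  show ?thesis using **[of a b] **[of b a] by (cases "b \<le> a") (auto simp: abs_minus_commute add.commute)
qed

text \<open>For commuting matrices this would follow from the mean value theorem and Young's inequality with
  parameter \<open>s\<close>. In the two eigenbases the entries of \<open>exp A - exp B\<close> and of \<open>A - B\<close> are \<open>exp a - exp b\<close> and
  \<open>a - b\<close> times the same overlap, so the scalar argument applies entry by entry.\<close>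

lemma trace_mean_value_inequality:
  fixes A B C :: "complex^'n^'n"
  assumes A: "cmat_hermitian A" and B: "cmat_hermitian B" and C: "cmat_hermitian C" and s: "s > 0"
  shows "4 * retr (C ** (spectral_fun exp A - spectral_fun exp B))
    \<le> s * retr ((A - B) ** (A - B) ** (spectral_fun exp A + spectral_fun exp B))
      + 1 / s * retr (C ** C ** (spectral_fun exp A + spectral_fun exp B))"
proof -
  obtain U x where U: "cmat_unitary U" and AU: "A = spectral_form U x"
    using hermitian_diagonalization[OF A] .
  obtain V y where V: "cmat_unitary V" and BV: "B = spectral_form V y"
    using hermitian_diagonalization[OF B] .
  have UU: "cmat_adjoint U ** U = mat 1" "cmat_adjoint V ** V = mat 1"
    using U V by (simp_all add: cmat_unitary_def)
  have eA: "spectral_fun exp A = spectral_form U (\<lambda>i. exp (x i))"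
    by (simp add: AU spectral_fun_eq[OF U])
  have eB: "spectral_fun exp B = spectral_form V (\<lambda>i. exp (y i))"
    by (simp add: BV spectral_fun_eq[OF V])
  define W where "W = cmat_adjoint U ** V"
  define K where "K = cmat_adjoint U ** C ** V"
  have D: "(cmat_adjoint U ** (A - B) ** V) $ i $ j = of_real (x i - y j) * W $ i $ j" for i j
  proof -
    have "cmat_adjoint U ** A ** V = real_diag x ** W"
      using UU by (simp add: AU W_def matrix_mul_assoc)
    moreover have "cmat_adjoint U ** B ** V = W ** (real_diag y)"
      using UU by (simp add: BV W_def matrix_mul_assoc[symmetric])
    ultimately show ?thesis
      by (simp add: matrix_distribs real_diag_mult_left real_diag_mult_right algebra_simps)
  qed
  have AB: "cmat_hermitian (A - B)" using A B by (rule hermitian_diff)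
  have lhs: "retr (C ** (spectral_fun exp A - spectral_fun exp B))
      = (\<Sum>i\<in>UNIV. \<Sum>j\<in>UNIV. (exp (x i) - exp (y j)) * Re (K $ i $ j * cnj (W $ i $ j)))"
    unfolding eA eB by (simp only: matrix_distribs retr_diff retr_left_eigenbasis[OF U V]
        retr_right_eigenbasis[OF U V] K_def W_def sum_subtractf[symmetric] left_diff_distrib)
  have sq: "retr (X ** X ** (spectral_fun exp A + spectral_fun exp B))
      = (\<Sum>i\<in>UNIV. \<Sum>j\<in>UNIV. (exp (x i) + exp (y j)) * (cmod ((cmat_adjoint U ** X ** V) $ i $ j))\<^sup>2)"
    if "cmat_hermitian X" for X
    unfolding eA eB by (simp only: matrix_add_ldistrib retr_add retr_square_left[OF U V that]
        retr_square_right[OF U V that] sum.distrib[symmetric] distrib_right)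
  have scalar: "4 * ((exp a - exp b) * Re (k * cnj w))
      \<le> s * ((exp a + exp b) * (cmod (of_real (a - b) * w))\<^sup>2) + 1 / s * ((exp a + exp b) * (cmod k)\<^sup>2)"
    for a b :: real and k w :: complex
  proof -
    let ?p = "\<bar>a - b\<bar> * cmod w"
    have "(exp a - exp b) * Re (k * cnj w) \<le> \<bar>exp a - exp b\<bar> * \<bar>Re (k * cnj w)\<bar>"
      by (metis abs_ge_self abs_mult)
    also have "\<dots> \<le> (\<bar>a - b\<bar> * (exp a + exp b) / 2) * (cmod k * cmod w)"
      by (intro mult_mono exp_diff_le_trapezoid)
         (metis abs_Re_le_cmod complex_mod_cnj norm_mult, auto)
    finally have 1: "4 * ((exp a - exp b) * Re (k * cnj w)) \<le> (exp a + exp b) * (2 * ?p * cmod k)"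
      by (simp add: mult_ac)
    have "0 \<le> (s * ?p - cmod k)\<^sup>2 / s" using s by simp
    also have "\<dots> = s * ?p\<^sup>2 + 1 / s * (cmod k)\<^sup>2 - 2 * ?p * cmod k"
      using s by (simp add: power2_eq_square field_simps)
    finally have "(exp a + exp b) * (2 * ?p * cmod k) \<le> (exp a + exp b) * (s * ?p\<^sup>2 + 1 / s * (cmod k)\<^sup>2)"
      by (intro mult_left_mono) (auto intro: add_nonneg_nonneg)
    with 1 have "4 * ((exp a - exp b) * Re (k * cnj w))
       \<le> (exp a + exp b) * (s * ?p\<^sup>2 + 1 / s * (cmod k)\<^sup>2)" by linarith
    moreover have "cmod (of_real (a - b) * w) = ?p" by (simp only: norm_mult norm_of_real)
    ultimately show ?thesis by (simp only: distrib_left mult_ac)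
  qed
  have "4 * retr (C ** (spectral_fun exp A - spectral_fun exp B))
      = (\<Sum>i\<in>UNIV. \<Sum>j\<in>UNIV. 4 * ((exp (x i) - exp (y j)) * Re (K $ i $ j * cnj (W $ i $ j))))"
    unfolding lhs by (simp only: sum_distrib_left)
  also have "\<dots> \<le> (\<Sum>i\<in>UNIV. \<Sum>j\<in>UNIV. s * ((exp (x i) + exp (y j)) * (cmod (of_real (x i - y j) * W $ i $ j))\<^sup>2)
      + 1 / s * ((exp (x i) + exp (y j)) * (cmod (K $ i $ j))\<^sup>2))"
    by (intro sum_mono scalar)
  also have "\<dots> = s * retr ((A - B) ** (A - B) ** (spectral_fun exp A + spectral_fun exp B))
      + 1 / s * retr (C ** C ** (spectral_fun exp A + spectral_fun exp B))"
    unfolding sq[OF AB] sq[OF C] D K_def by (simp only: sum.distrib sum_distrib_left)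
  finally show ?thesis .
qed

text \<open>The eigenvalues are values of the quadratic form at the columns of the unitary matrix.\<close>

lemma psd_diagonalization:
  assumes "cmat_psd A"
  obtains U x where "cmat_unitary U" "A = spectral_form U x" "\<And>i. 0 \<le> x i"
proof -
  obtain U x where U: "cmat_unitary U" and AU: "A = spectral_form U x"
    using hermitian_diagonalization assms unfolding cmat_psd_def by blast
  have "0 \<le> x i" for i
  proof -
    have UU: "cmat_adjoint U ** U = mat 1" using U by (simp add: cmat_unitary_def)
    have "cmat_adjoint U ** A ** U = real_diag x ** (cmat_adjoint U ** U)"
      by (simp add: AU matrix_mul_assoc unitary_cancel[OF U])
    then have "(cmat_adjoint U ** (A ** U)) $ i $ i = of_real (x i)"
      by (simp add: UU matrix_mul_assoc) (simp add: real_diag_def)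
    then have "(\<Sum>k\<in>UNIV. cnj (column i U $ k) * (A *v column i U) $ k) = of_real (x i)"
      by (simp add: matrix_matrix_mult_def matrix_vector_mult_def cmat_adjoint_def column_def)
    then show ?thesis using assms unfolding cmat_psd_def by (metis Re_complex_of_real)
  qed
  with U AU show ?thesis using that by blast
qed

lemma retr_mult_psd_nonneg:
  assumes "cmat_psd A" "cmat_psd B" shows "0 \<le> retr (A ** B)"
proof -
  obtain U x where U: "cmat_unitary U" and AU: "A = spectral_form U x" and x: "\<And>i. 0 \<le> x i"
    using psd_diagonalization[OF assms(1)] by metis
  obtain V y where V: "cmat_unitary V" and BV: "B = spectral_form V y" and y: "\<And>i. 0 \<le> y i"
    using psd_diagonalization[OF assms(2)] by metis
  show ?thesis unfolding AU BV retr_spectral_product[OF U V]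
    by (intro sum_nonneg mult_nonneg_nonneg x y) auto
qed

lemma psd_spectral_form:
  fixes U :: "complex^'n^'n"
  assumes "\<And>i. 0 \<le> x i" shows "cmat_psd (spectral_form U x)"
  unfolding cmat_psd_def
proof (intro conjI allI hermitian_spectral_form)
  fix v :: "complex^'n"
  define u where "u = cmat_adjoint U *v v"
  have D: "(real_diag x *v u) $ i = of_real (x i) * u $ i" for i
    by (simp add: real_diag_def matrix_vector_mult_def if_distrib[of "\<lambda>t. t * _"] cong: if_cong)
  have "(\<Sum>i\<in>UNIV. cnj (v $ i) * ((spectral_form U x) *v v) $ i)
      = cinner v (U *v (real_diag x *v u))"
    by (simp add: cinner_def u_def matrix_vector_mul_assoc matrix_mul_assoc)
  also have "\<dots> = cinner u (real_diag x *v u)"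
    by (simp add: cinner_matrix_vector u_def)
  also have "\<dots> = (\<Sum>i\<in>UNIV. of_real (x i) * (u $ i * cnj (u $ i)))"
    by (simp add: cinner_def D mult_ac)
  also have "Re \<dots> = (\<Sum>i\<in>UNIV. x i * (cmod (u $ i))\<^sup>2)"
    by (simp only: Re_sum Re_of_real_mult Re_mult_cnj_self)
  also have "\<dots> \<ge> 0" using assms by (intro sum_nonneg) auto
  finally show "0 \<le> Re (\<Sum>i\<in>UNIV. cnj (v $ i) * ((spectral_form U x) *v v) $ i)" .
qed

lemma psd_exp:
  assumes "cmat_hermitian A" shows "cmat_psd (spectral_fun exp A)"
proof -
  obtain U x where U: "cmat_unitary U" and AU: "A = spectral_form U x"
    using hermitian_diagonalization[OF assms] .
  show ?thesis unfolding AU spectral_fun_eq[OF U] by (rule psd_spectral_form) simp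
qed

lemma real_eigenvalues_spectral_form:
  fixes U :: "complex^'n^'n"
  assumes U: "cmat_unitary U"
  shows "real_eigenvalues (spectral_form U x) = range x"
proof (intro equalityI subsetI)
  have UU: "cmat_adjoint U ** U = mat 1" "U ** cmat_adjoint U = mat 1"
    using U by (simp_all add: cmat_unitary_def)
  have D: "(real_diag x *v u) $ i = of_real (x i) * u $ i" for i u
    by (simp add: real_diag_def matrix_vector_mult_def if_distrib[of "\<lambda>t. t * _"] cong: if_cong)
  {
    fix l assume "l \<in> real_eigenvalues (spectral_form U x)"
    then obtain v where v: "v \<noteq> 0" and e: "(spectral_form U x) *v v = complex_of_real l *s v"
      by (auto simp: real_eigenvalues_def)
    define u where "u = cmat_adjoint U *v v"
    have "v = U *v u" using UU by (simp add: u_def matrix_vector_mul_assoc)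
    then have "u \<noteq> 0" using v by auto
    then obtain i where i: "u $ i \<noteq> 0" by (auto simp: vec_eq_iff)
    have "real_diag x *v u = cmat_adjoint U *v ((spectral_form U x) *v v)"
      using UU by (simp add: u_def matrix_vector_mul_assoc matrix_mul_assoc)
    also have "\<dots> = complex_of_real l *s u"
      by (simp add: e u_def vector_scalar_commute)
    finally have "(real_diag x *v u) $ i = of_real l * u $ i" by simp
    then have "x i = l" using i by (simp add: D)
    then show "l \<in> range x" by blast
  }
  fix l assume "l \<in> range x"
  then obtain i where i: "l = x i" by auto
  define u :: "complex^'n" where "u = axis i 1"
  define v where "v = U *v u"
  have "cmat_adjoint U *v v = u" using UU by (simp add: v_def matrix_vector_mul_assoc)
  moreover have "u \<noteq> 0" by (simp add: u_def axis_eq_0_iff)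
  moreover have "real_diag x *v u = complex_of_real l *s u"
    by (auto simp: vec_eq_iff D u_def axis_def i)
  ultimately show "l \<in> real_eigenvalues (spectral_form U x)"
    by (auto simp: real_eigenvalues_def matrix_vector_mul_assoc[symmetric] v_def vector_scalar_commute
        intro!: exI[of _ v])
qed

lemma lambda_max_spectral_form:
  "cmat_unitary U \<Longrightarrow> lambda_max (spectral_form U x) = Max (range x)"
  by (simp add: lambda_max_def real_eigenvalues_spectral_form)

lemma lambda_min_eq_uminus_lambda_max:
  assumes "cmat_hermitian A" shows "lambda_min A = - lambda_max (- A)"
proof -
  obtain U x where U: "cmat_unitary U" and AU: "A = spectral_form U x"
    using hermitian_diagonalization[OF assms] .
  have "- A = spectral_form U (\<lambda>i. - x i)"
    using spectral_form_scaleR[of "-1" U x] by (simp add: AU)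
  then have "lambda_max (- A) = Max (range (\<lambda>i. - x i))" by (simp add: lambda_max_spectral_form[OF U])
  moreover have "lambda_min A = Min (range x)"
    by (simp add: AU lambda_min_def real_eigenvalues_spectral_form[OF U])
  moreover have "Max (range (\<lambda>i. - x i)) = - Min (range x)"
  proof (rule Max_eqI)
    have "Min (range x) \<in> range x" by (intro Min_in) auto
    then obtain i where "Min (range x) = x i" by blast
    then show "- Min (range x) \<in> range (\<lambda>i. - x i)" by (simp only:) (rule rangeI)
  qed (auto intro: Min_le)
  ultimately show ?thesis by (simp only: minus_minus)
qed

lemma exp_lambda_max_le_retr_exp:
  assumes "cmat_hermitian A" "0 \<le> r"
  shows "exp (r * lambda_max A) \<le> retr (spectral_fun exp (r *\<^sub>R A))"
proof -
  obtain U x where U: "cmat_unitary U" and AU: "A = spectral_form U x"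
    using hermitian_diagonalization[OF assms(1)] .
  have "Max (range x) \<in> range x" by (intro Max_in) auto
  then obtain i where "Max (range x) = x i" by blast
  then have i: "lambda_max A = x i" by (simp add: AU lambda_max_spectral_form[OF U])
  have "exp (r * x i) \<le> (\<Sum>i\<in>UNIV. exp (r * x i))"
    by (rule member_le_sum) auto
  then show ?thesis
    by (simp add: i) (simp add: AU spectral_form_scaleR spectral_fun_eq[OF U] retr_spectral_form[OF U])
qed

lemma retr_exp_pos:
  assumes "cmat_hermitian A" shows "0 < retr (spectral_fun exp A)"
proof -
  obtain U x where U: "cmat_unitary U" and AU: "A = spectral_form U x"
    using hermitian_diagonalization[OF assms] .
  show ?thesis unfolding AU spectral_fun_eq[OF U] retr_spectral_form[OF U] by (intro sum_pos) auto
qed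

text \<open>The second-order remainder is dominated by exponentials, which have finite expectation; this
  is what allows differentiation of exponential moments under the integral.\<close>

lemma retr_exp_taylor:
  fixes A :: "complex^'n^'n"
  assumes "cmat_hermitian A" "\<bar>h\<bar> \<le> 1"
  defines "E \<equiv> \<lambda>r. retr (spectral_fun exp (r *\<^sub>R A))"
  shows "\<bar>E (r + h) - E r - h * retr (A ** spectral_fun exp (r *\<^sub>R A))\<bar>
    \<le> h\<^sup>2 * (E (r + 2) + 2 * E r + E (r - 2))"
proof -
  obtain U x where U: "cmat_unitary U" and AU: "A = spectral_form U x"
    using hermitian_diagonalization[OF assms(1)] .
  have E: "E r = (\<Sum>i\<in>UNIV. exp (r * x i))" for r
    by (simp add: E_def AU spectral_form_scaleR spectral_fun_eq[OF U] retr_spectral_form[OF U])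
  have M: "retr (A ** spectral_fun exp (r *\<^sub>R A)) = (\<Sum>i\<in>UNIV. x i * exp (r * x i))"
    by (simp add: AU spectral_form_scaleR spectral_fun_eq[OF U] spectral_form_mult[OF U] retr_spectral_form[OF U])
  have scalar: "\<bar>exp ((r + h) * a) - exp (r * a) - h * (a * exp (r * a))\<bar>
      \<le> h\<^sup>2 * (exp ((r + 2) * a) + 2 * exp (r * a) + exp ((r - 2) * a))" for a :: real
  proof -
    let ?u = "h * a"
    have "\<bar>exp ?u - 1 - ?u\<bar> \<le> ?u\<^sup>2 * (exp a + exp (- a)) / 2"
    proof (cases "?u = 0")
      case False
      obtain t where t: "\<bar>t\<bar> \<le> \<bar>?u\<bar>" and e: "exp ?u = (\<Sum>m<2. ?u ^ m / fact m) + exp t / fact 2 * ?u ^ 2"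
        using Maclaurin_exp_le[of ?u 2] by blast
      have "\<bar>?u\<bar> \<le> \<bar>a\<bar>" using assms(2) by (simp add: abs_mult mult_left_le_one_le)
      then have "exp t \<le> exp \<bar>a\<bar>" using t by simp
      also have "\<dots> \<le> exp a + exp (- a)" by (cases "a \<ge> 0") auto
      finally have "?u\<^sup>2 * exp t \<le> ?u\<^sup>2 * (exp a + exp (-a))" by (intro mult_left_mono) auto
      moreover have "exp ?u - 1 - ?u = ?u\<^sup>2 * exp t / 2"
        using e by (simp add: numeral_2_eq_2)
      moreover have "0 \<le> ?u\<^sup>2 * exp t" by simp
      ultimately show ?thesis by linarith
    qed auto
    also have "?u\<^sup>2 * (exp a + exp (- a)) / 2 = h\<^sup>2 * (a\<^sup>2 / 2) * (exp a + exp (- a))"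
      by (simp add: power_mult_distrib)
    also have "\<dots> \<le> h\<^sup>2 * (exp a + exp (- a)) * (exp a + exp (- a))"
    proof -
      have "a\<^sup>2 / 2 \<le> exp \<bar>a\<bar>" using exp_lower_Taylor_quadratic[of "\<bar>a\<bar>"] by simp
      also have "\<dots> \<le> exp a + exp (- a)" by (cases "a \<ge> 0") auto
      finally show ?thesis by (intro mult_right_mono mult_left_mono) (auto intro: add_nonneg_nonneg)
    qed
    finally have "exp (r * a) * \<bar>exp ?u - 1 - ?u\<bar>
        \<le> exp (r * a) * (h\<^sup>2 * (exp a + exp (- a)) * (exp a + exp (- a)))"
      by (intro mult_left_mono) auto
    moreover have "exp (r * a) * (h\<^sup>2 * (exp a + exp (- a)) * (exp a + exp (- a)))
        = h\<^sup>2 * (exp ((r + 2) * a) + 2 * exp (r * a) + exp ((r - 2) * a))"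
    proof -
      have "exp ((r + 2) * a) = exp (r * a) * (exp a * exp a)" "exp ((r - 2) * a) = exp (r * a) * (exp (-a) * exp (-a))"
        by (simp_all add: exp_add[symmetric] algebra_simps)
      moreover have "exp a * exp (-a) = 1" by (simp add: exp_minus)
      ultimately show ?thesis by (simp add: algebra_simps)
    qed
    moreover have "exp (r * a) * \<bar>exp ?u - 1 - ?u\<bar> = \<bar>exp ((r + h) * a) - exp (r * a) - h * (a * exp (r * a))\<bar>"
    proof -
      have "exp (r * a) * \<bar>exp ?u - 1 - ?u\<bar> = \<bar>exp (r * a) * (exp ?u - 1 - ?u)\<bar>" by (simp add: abs_mult)
      also have "exp (r * a) * (exp ?u - 1 - ?u) = exp ((r + h) * a) - exp (r * a) - h * (a * exp (r * a))"
        by (simp add: exp_add algebra_simps)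
      finally show ?thesis .
    qed
    ultimately show ?thesis by linarith
  qed
  have "\<bar>E (r + h) - E r - h * retr (A ** spectral_fun exp (r *\<^sub>R A))\<bar>
      = \<bar>\<Sum>i\<in>UNIV. exp ((r + h) * x i) - exp (r * x i) - h * (x i * exp (r * x i))\<bar>"
    by (simp add: E M sum_subtractf sum_distrib_left)
  also have "\<dots> \<le> (\<Sum>i\<in>UNIV. \<bar>exp ((r + h) * x i) - exp (r * x i) - h * (x i * exp (r * x i))\<bar>)"
    by (rule sum_abs)
  also have "\<dots> \<le> (\<Sum>i\<in>UNIV. h\<^sup>2 * (exp ((r + 2) * x i) + 2 * exp (r * x i) + exp ((r - 2) * x i)))"
    by (intro sum_mono scalar)
  also have "\<dots> = h\<^sup>2 * (E (r + 2) + 2 * E r + E (r - 2))"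
    by (simp add: E sum.distrib sum_distrib_left algebra_simps)
  finally show ?thesis .
qed

lemma retr_exp_ge:
  fixes A :: "complex^'n^'n"
  assumes "cmat_hermitian A"
  shows "real CARD('n) + retr A \<le> retr (spectral_fun exp A)"
proof -
  obtain U x where U: "cmat_unitary U" and AU: "A = spectral_form U x"
    using hermitian_diagonalization[OF assms(1)] .
  have "(\<Sum>i\<in>UNIV. 1 + x i) \<le> (\<Sum>i\<in>UNIV. exp (x i))" by (intro sum_mono exp_ge_add_one_self)
  then show ?thesis by (simp add: AU spectral_fun_eq[OF U] retr_spectral_form[OF U] sum.distrib)
qed

lemma bounded_linear_matrix_vector: "bounded_linear (\<lambda>x. (A :: complex^'n^'m) *v x)"
  by (intro linear_conv_bounded_linear[THEN iffD1] linearI)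
     (simp_all add: vec_eq_iff matrix_vector_mult_def scaleR_sum_right sum.distrib distrib_left)

lemma retr_exp_le_opnorm:
  fixes A :: "complex^'n^'n"
  assumes "cmat_hermitian A" "0 \<le> r" "cmat_opnorm A \<le> v"
  shows "retr (spectral_fun exp (r *\<^sub>R A)) \<le> real CARD('n) * exp (r * v)"
proof -
  obtain U x where U: "cmat_unitary U" and AU: "A = spectral_form U x"
    using hermitian_diagonalization[OF assms(1)] .
  have x: "x i \<le> v" for i
  proof -
    have "x i \<in> real_eigenvalues A" by (simp add: AU real_eigenvalues_spectral_form[OF U])
    then obtain u :: "complex^'n" where u: "u \<noteq> 0" "A *v u = complex_of_real (x i) *s u"
      by (auto simp: real_eigenvalues_def)
    have "complex_of_real (x i) *s u = x i *\<^sub>R u" by (simp add: vec_eq_iff complex_eq_iff)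
    then have "\<bar>x i\<bar> * norm u = norm (A *v u)" using u by simp
    also have "\<dots> \<le> cmat_opnorm A * norm u"
      unfolding cmat_opnorm_def by (rule onorm[OF bounded_linear_matrix_vector])
    finally have "\<bar>x i\<bar> \<le> cmat_opnorm A" using u(1) by simp
    then show ?thesis using assms(3) by linarith
  qed
  have "(\<Sum>i\<in>UNIV. exp (r * x i)) \<le> (\<Sum>i\<in>(UNIV::'n set). exp (r * v))"
    using x assms(2) by (intro sum_mono) (simp add: mult_left_mono)
  then show ?thesis
    by (simp add: AU spectral_form_scaleR spectral_fun_eq[OF U] retr_spectral_form[OF U])
qed

section \<open>Facts from calculus and integration\<close>

text \<open>This yields the Cauchy--Schwarz inequality, with \<open>p\<close>, \<open>q\<close> and \<open>r\<close> as the entries of a positive form.\<close>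

lemma discriminant_le:
  fixes p q r :: real
  assumes "\<And>t. 0 \<le> p + 2 * t * r + t\<^sup>2 * q" and q: "0 \<le> q"
  shows "r\<^sup>2 \<le> p * q"
proof (cases "q = 0")
  case True
  have "r = 0"
  proof (rule ccontr)
    assume "r \<noteq> 0"
    with assms(1)[of "- (p + 1) / (2 * r)"] True show False by (simp add: field_simps)
  qed
  then show ?thesis using True by simp
next
  case False
  then have "q > 0" using q by simp
  have "0 \<le> p + 2 * (- r / q) * r + (- r / q)\<^sup>2 * q" by (rule assms)
  also have "\<dots> = p - r\<^sup>2 / q" using \<open>q > 0\<close> by (simp add: power2_eq_square)
  finally show ?thesis using \<open>q > 0\<close> by (simp add: field_simps)
qed

lemma has_real_derivative_quadratic:
  fixes f :: "real \<Rightarrow> real"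
  assumes "\<And>y. y \<in> A \<Longrightarrow> \<bar>y - x\<bar> \<le> e \<Longrightarrow> \<bar>f y - f x - (y - x) * d\<bar> \<le> K * (y - x)\<^sup>2" "e > 0"
  shows "(f has_real_derivative d) (at x within A)"
  unfolding has_field_derivative_iff
proof (rule LIM_zero_cancel, rule tendsto_0_le[where K=1])
  have "((\<lambda>y. K * \<bar>y - x\<bar>) \<longlongrightarrow> K * \<bar>x - x\<bar>) (at x within A)" by (intro tendsto_intros)
  then show "((\<lambda>y. K * \<bar>y - x\<bar>) \<longlongrightarrow> 0) (at x within A)" by simp
  show "\<forall>\<^sub>F y in at x within A. norm ((f y - f x) / (y - x) - d) \<le> norm (K * \<bar>y - x\<bar>) * 1"
    unfolding eventually_at
  proof (intro exI[of _ e] conjI ballI impI assms(2))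
    fix y assume y: "y \<in> A" "y \<noteq> x \<and> dist y x < e"
    then have "\<bar>f y - f x - (y - x) * d\<bar> \<le> K * (y - x)\<^sup>2" by (intro assms) (auto simp: dist_real_def)
    moreover have "f y - f x - (y - x) * d = (y - x) * ((f y - f x) / (y - x) - d)" using y by (simp add: field_simps)
    ultimately have "\<bar>y - x\<bar> * \<bar>(f y - f x) / (y - x) - d\<bar> \<le> \<bar>y - x\<bar> * (K * \<bar>y - x\<bar>)"
      by (simp add: abs_mult power2_eq_square mult_ac)
    then have "\<bar>(f y - f x) / (y - x) - d\<bar> \<le> K * \<bar>y - x\<bar>"
      using y by (simp add: mult_le_cancel_left)
    then show "norm ((f y - f x) / (y - x) - d) \<le> norm (K * \<bar>y - x\<bar>) * 1" by simp
  qed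
qed

lemma nonincreasing_from_derivative_within:
  fixes h :: "real \<Rightarrow> real"
  assumes "a \<le> b" and d: "\<And>x. x \<in> {a..b} \<Longrightarrow> (h has_real_derivative h' x) (at x within {a..b})"
    and "\<And>x. x \<in> {a..b} \<Longrightarrow> h' x \<le> 0"
  shows "h b \<le> h a"
proof (rule DERIV_nonpos_imp_decreasing_open[OF assms(1)])
  show "\<exists>y. DERIV h x :> y \<and> y \<le> 0" if "a < x" "x < b" for x
    using d[of x] assms(3)[of x] that by (auto simp: at_within_Icc_at)
  show "continuous_on {a..b} h"
    by (rule DERIV_continuous_on) (rule d)
qed

lemma derivative_nonneg_at_minimum:
  fixes h :: "real \<Rightarrow> real"
  assumes "(h has_real_derivative d) (at 0 within {0..})" "\<And>x. 0 \<le> x \<Longrightarrow> h 0 \<le> h x"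
  shows "0 \<le> d"
proof -
  have "((\<lambda>x. (h x - h 0) / (x - 0)) \<longlongrightarrow> d) (at_right 0)"
    using assms(1) unfolding has_field_derivative_iff
    by (rule tendsto_mono[rotated]) (rule at_le, auto)
  moreover have "\<forall>\<^sub>F x in at_right 0. 0 \<le> (h x - h 0) / (x - 0)"
    using eventually_at_right_less[of "0::real"] by eventually_elim (use assms(2) in simp)
  ultimately show ?thesis by (rule tendsto_lowerbound) simp
qed

text \<open>For \<open>w > 0\<close> the hypothesis is used at \<open>r = m / w\<close>; for \<open>w = 0\<close> a large \<open>r\<close> makes \<open>D\<close> negligible.\<close>

lemma le_sqrt_if_linear_le_quadratic:
  fixes m w D :: real
  assumes "\<And>r. 0 < r \<Longrightarrow> r * m \<le> D + r\<^sup>2 * w / 2" and w: "0 \<le> w" and D: "0 \<le> D"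
  shows "m \<le> sqrt (2 * w * D)"
proof (cases "m \<le> 0")
  case True
  also have "0 \<le> sqrt (2 * w * D)" using w D by simp
  finally show ?thesis .
next
  case False
  show ?thesis
  proof (cases "w = 0")
    case True
    have "(D + 1) / m * m \<le> D" using assms(1)[of "(D + 1) / m"] False D True by simp
    then show ?thesis using False by simp
  next
    case w0: False
    then have "0 < w" using w by simp
    have "m / w * m \<le> D + (m / w)\<^sup>2 * w / 2" using False \<open>0 < w\<close> by (intro assms) simp
    then have "m\<^sup>2 \<le> 2 * w * D" using \<open>0 < w\<close> by (simp add: power2_eq_square field_simps)
    then show ?thesis by (rule real_le_rsqrt)
  qed
qed

text \<open>The functions of interest are unbounded. Nonnegative functions are covered by Tonelli's theorem, and
  the general case follows by splitting into positive and negative parts.\<close>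

lemma integral_bind_kernel:
  fixes f :: "'b \<Rightarrow> real"
  assumes N: "N \<in> M \<rightarrow>\<^sub>M subprob_algebra B"
    and f: "integrable (M \<bind> N) f" and fB: "f \<in> borel_measurable B"
    and fN: "\<And>x. x \<in> space M \<Longrightarrow> integrable (N x) f"
    and fM: "integrable M (\<lambda>x. \<integral>y. f y \<partial>N x)" and M: "space M \<noteq> {}"
  shows "(\<integral>y. f y \<partial>(M \<bind> N)) = (\<integral>x. (\<integral>y. f y \<partial>N x) \<partial>M)"
proof -
  have sets: "sets (N x) = sets B" if "x \<in> space M" for x using sets_kernel[OF N that] .
  define p where "p = (\<lambda>y. max 0 (f y))"
  define q where "q = (\<lambda>y. max 0 (- f y))"
  have fpq: "f y = p y - q y" for y by (simp add: p_def q_def max_def)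
  have pos: "(\<integral>y. g y \<partial>(M \<bind> N)) = (\<integral>x. (\<integral>y. g y \<partial>N x) \<partial>M) \<and> integrable M (\<lambda>x. \<integral>y. g y \<partial>N x)"
    if g: "integrable (M \<bind> N) g" and gB: "g \<in> borel_measurable B" and g0: "\<And>y. 0 \<le> g y"
      and gN: "\<And>x. x \<in> space M \<Longrightarrow> integrable (N x) g" for g :: "'b \<Rightarrow> real"
  proof -
    have meas: "(\<lambda>x. \<integral>y. g y \<partial>N x) \<in> borel_measurable M"
      by (rule measurable_compose[OF N integral_measurable_subprob_algebra[OF gB]])
    have "ennreal (\<integral>y. g y \<partial>(M \<bind> N)) = (\<integral>\<^sup>+y. ennreal (g y) \<partial>(M \<bind> N))"
      by (rule nn_integral_eq_integral[symmetric, OF g]) (simp add: g0)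
    also have "\<dots> = (\<integral>\<^sup>+x. \<integral>\<^sup>+y. ennreal (g y) \<partial>N x \<partial>M)"
      using gB by (intro nn_integral_bind[OF _ N]) measurable
    also have "\<dots> = (\<integral>\<^sup>+x. ennreal (\<integral>y. g y \<partial>N x) \<partial>M)"
      by (intro nn_integral_cong nn_integral_eq_integral gN) (simp_all add: g0)
    finally have eq: "(\<integral>\<^sup>+x. ennreal (\<integral>y. g y \<partial>N x) \<partial>M) = ennreal (\<integral>y. g y \<partial>(M \<bind> N))" by simp
    have int: "integrable M (\<lambda>x. \<integral>y. g y \<partial>N x)"
      by (rule integrableI_nonneg[OF meas]) (auto simp: eq g0)
    have "ennreal (\<integral>x. (\<integral>y. g y \<partial>N x) \<partial>M) = ennreal (\<integral>y. g y \<partial>(M \<bind> N))"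
      using nn_integral_eq_integral[OF int] eq by (simp add: g0)
    then show ?thesis using int g0 by simp
  qed
  have p: "integrable (M \<bind> N) p" "p \<in> borel_measurable B" "\<And>y. 0 \<le> p y"
    "\<And>x. x \<in> space M \<Longrightarrow> integrable (N x) p"
    using f fB fN by (auto simp: p_def)
  have q: "integrable (M \<bind> N) q" "q \<in> borel_measurable B" "\<And>y. 0 \<le> q y"
    "\<And>x. x \<in> space M \<Longrightarrow> integrable (N x) q"
    using f fB fN by (auto simp: q_def)
  have "(\<integral>y. f y \<partial>(M \<bind> N)) = (\<integral>y. p y \<partial>(M \<bind> N)) - (\<integral>y. q y \<partial>(M \<bind> N))"
    unfolding fpq using p(1) q(1) by (rule Bochner_Integration.integral_diff)
  also have "\<dots> = (\<integral>x. (\<integral>y. p y \<partial>N x) - (\<integral>y. q y \<partial>N x) \<partial>M)"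
    using pos[OF p] pos[OF q] by (simp add: Bochner_Integration.integral_diff)
  also have "\<dots> = (\<integral>x. (\<integral>y. f y \<partial>N x) \<partial>M)"
  proof (rule Bochner_Integration.integral_cong[OF refl])
    fix x assume x: "x \<in> space M"
    show "(\<integral>y. p y \<partial>N x) - (\<integral>y. q y \<partial>N x) = (\<integral>y. f y \<partial>N x)"
      unfolding fpq using p(4)[OF x] q(4)[OF x] by (rule Bochner_Integration.integral_diff[symmetric])
  qed
  finally show ?thesis .
qed

section \<open>Reversible semigroups on a class of suitable functions\<close>

text \<open>The analytic part of the argument sees the Markov process only through its transition kernels.\<close>

locale symmetric_semigroup =
  fixes \<kappa> :: "real \<Rightarrow> 'a::polish_space \<Rightarrow> 'a measure" and \<mu> :: "'a measure" and S :: "('a \<Rightarrow> real) set"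
  assumes prob_mu: "prob_space \<mu>" and sets_mu [measurable_cong]: "sets \<mu> = sets borel"
    and kernel: "\<And>t. 0 \<le> t \<Longrightarrow> \<kappa> t \<in> borel \<rightarrow>\<^sub>M prob_algebra borel"
    and kernel_0: "\<And>z. \<kappa> 0 z = return borel z"
    and chapman_kolmogorov: "\<And>s t z. 0 \<le> s \<Longrightarrow> 0 \<le> t \<Longrightarrow> \<kappa> (s + t) z = \<kappa> s z \<bind> \<kappa> t"
    and stationary: "stationary \<kappa> \<mu>" and reversible: "reversible \<kappa> \<mu>" and ergodic: "ergodic \<kappa> \<mu>"
    and S_const [simp]: "\<And>r. (\<lambda>_. r) \<in> S"
    and S_add [simp]: "\<And>a b. a \<in> S \<Longrightarrow> b \<in> S \<Longrightarrow> (\<lambda>z. a z + b z) \<in> S"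
    and S_mult [simp]: "\<And>a b. a \<in> S \<Longrightarrow> b \<in> S \<Longrightarrow> (\<lambda>z. a z * b z) \<in> S"
    and S_integrable: "\<And>a. a \<in> S \<Longrightarrow> integrable \<mu> a"
    and S_kernel_integrable: "\<And>a t z. a \<in> S \<Longrightarrow> 0 \<le> t \<Longrightarrow> integrable (\<kappa> t z) a"
    and S_semigroup [simp]: "\<And>a t. a \<in> S \<Longrightarrow> 0 \<le> t \<Longrightarrow> semigroup_op \<kappa> t a \<in> S"
    and S_generator_ex: "\<And>a z. a \<in> S \<Longrightarrow> \<exists>l. ((\<lambda>t. difference_quotient \<kappa> t a z) \<longlongrightarrow> l) (at_right 0)"
    and S_generator [simp]: "\<And>a. a \<in> S \<Longrightarrow> generator \<kappa> a \<in> S"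
    and S_generator_L2: "\<And>a. a \<in> S \<Longrightarrow>
      ((\<lambda>t. \<integral>z. (difference_quotient \<kappa> t a z - generator \<kappa> a z)\<^sup>2 \<partial>\<mu>) \<longlongrightarrow> 0) (at_right 0)"
begin

sublocale mu: prob_space \<mu> by (rule prob_mu)

lemma space_mu: "space \<mu> = UNIV"
  using sets_eq_imp_space_eq[OF sets_mu] by simp

abbreviation "E \<equiv> integral\<^sup>L \<mu>"
abbreviation "P \<equiv> (semigroup_op \<kappa> :: real \<Rightarrow> ('a \<Rightarrow> real) \<Rightarrow> 'a \<Rightarrow> real)"
abbreviation "L \<equiv> (generator \<kappa> :: ('a \<Rightarrow> real) \<Rightarrow> 'a \<Rightarrow> real)"
abbreviation "DQ \<equiv> (difference_quotient \<kappa> :: real \<Rightarrow> ('a \<Rightarrow> real) \<Rightarrow> 'a \<Rightarrow> real)"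

lemma S_cmult [simp]: "a \<in> S \<Longrightarrow> (\<lambda>z. r * a z) \<in> S"
  by (rule S_mult[OF S_const])

lemma S_uminus [simp]: "a \<in> S \<Longrightarrow> (\<lambda>z. - a z) \<in> S"
  using S_cmult[of a "-1"] by simp

lemma S_diff [simp]: "a \<in> S \<Longrightarrow> b \<in> S \<Longrightarrow> (\<lambda>z. a z - b z) \<in> S"
  using S_add[OF _ S_uminus, of a b] by simp

lemma S_sum [simp]: "(\<And>i. i \<in> I \<Longrightarrow> a i \<in> S) \<Longrightarrow> (\<lambda>z. \<Sum>i\<in>I. a i z) \<in> S"
  by (induction I rule: infinite_finite_induct) auto

lemma S_power [simp]: "a \<in> S \<Longrightarrow> (\<lambda>z. a z ^ n) \<in> S"
  by (induction n) auto

lemma S_measurable: "a \<in> S \<Longrightarrow> a \<in> borel_measurable borel"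
  using borel_measurable_integrable[OF S_integrable] measurable_cong_sets[OF sets_mu refl] by blast

lemma S_square_integrable: "a \<in> S \<Longrightarrow> square_integrable \<mu> a"
  by (auto simp: square_integrable_def intro!: S_integrable borel_measurable_integrable)

lemma prob_kernel: "0 \<le> t \<Longrightarrow> prob_space (\<kappa> t z)"
  using measurable_space[OF kernel, of t z] by (simp add: space_prob_algebra)

lemma sets_kernel_eq: "0 \<le> t \<Longrightarrow> sets (\<kappa> t z) = sets borel"
  using measurable_space[OF kernel, of t z] by (simp add: space_prob_algebra)

lemma space_kernel_eq: "0 \<le> t \<Longrightarrow> space (\<kappa> t z) = UNIV"
  using sets_eq_imp_space_eq[OF sets_kernel_eq] by simp

lemma kernel_subprob: "0 \<le> t \<Longrightarrow> \<kappa> t \<in> borel \<rightarrow>\<^sub>M subprob_algebra borel"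
  by (rule measurable_prob_algebraD[OF kernel])

lemma P_add: "a \<in> S \<Longrightarrow> b \<in> S \<Longrightarrow> 0 \<le> t \<Longrightarrow> P t (\<lambda>z. a z + b z) z = P t a z + P t b z"
  unfolding semigroup_op_def by (intro Bochner_Integration.integral_add S_kernel_integrable)

lemma P_diff: "a \<in> S \<Longrightarrow> b \<in> S \<Longrightarrow> 0 \<le> t \<Longrightarrow> P t (\<lambda>z. a z - b z) z = P t a z - P t b z"
  unfolding semigroup_op_def by (intro Bochner_Integration.integral_diff S_kernel_integrable)

lemma P_cmult: "P t (\<lambda>z. r * a z) z = r * P t a z"
  unfolding semigroup_op_def by simp

lemma P_const: "0 \<le> t \<Longrightarrow> P t (\<lambda>z. r) z = r"
  unfolding semigroup_op_def using prob_space.prob_space[OF prob_kernel, of t z] by simp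

lemma P_0: "a \<in> S \<Longrightarrow> P 0 a = a"
  by (simp add: semigroup_op_def kernel_0 integral_return S_measurable fun_eq_iff)

lemma P_mono: "a \<in> S \<Longrightarrow> b \<in> S \<Longrightarrow> 0 \<le> t \<Longrightarrow> (\<And>y. a y \<le> b y) \<Longrightarrow> P t a z \<le> P t b z"
  unfolding semigroup_op_def by (intro integral_mono S_kernel_integrable)

lemma P_semigroup:
  assumes a: "a \<in> S" and s: "0 \<le> s" and t: "0 \<le> t"
  shows "P (s + t) a = P s (P t a)"
proof
  fix z
  have ck: "\<kappa> (s + t) z = \<kappa> s z \<bind> \<kappa> t" by (rule chapman_kolmogorov[OF s t])
  show "P (s + t) a z = P s (P t a) z"
    unfolding semigroup_op_def ck
  proof (rule integral_bind_kernel)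
    show "\<kappa> t \<in> \<kappa> s z \<rightarrow>\<^sub>M subprob_algebra borel"
      using kernel_subprob[OF t] measurable_cong_sets[OF sets_kernel_eq[OF s] refl] by blast
    show "integrable (\<kappa> s z \<bind> \<kappa> t) a"
      unfolding ck[symmetric] using s t by (intro S_kernel_integrable a) simp
    show "integrable (\<kappa> s z) (\<lambda>x. \<integral>y. a y \<partial>\<kappa> t x)"
      using S_kernel_integrable[OF S_semigroup[OF a t] s] by (simp add: semigroup_op_def[abs_def])
  qed (auto simp: S_measurable a S_kernel_integrable t space_kernel_eq s)
qed

lemma E_P: assumes a: "a \<in> S" and t: "0 \<le> t" shows "E (P t a) = E a"
proof -
  have st: "\<mu> \<bind> \<kappa> t = \<mu>" using stationary t by (simp add: stationary_def)
  have "E a = integral\<^sup>L (\<mu> \<bind> \<kappa> t) a" by (simp add: st)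
  also have "\<dots> = E (\<lambda>x. \<integral>y. a y \<partial>\<kappa> t x)"
  proof (rule integral_bind_kernel)
    show "\<kappa> t \<in> \<mu> \<rightarrow>\<^sub>M subprob_algebra borel"
      using kernel_subprob[OF t] measurable_cong_sets[OF sets_mu refl] by blast
    show "integrable \<mu> (\<lambda>x. \<integral>y. a y \<partial>\<kappa> t x)"
      using S_integrable[OF S_semigroup[OF a t]] by (simp add: semigroup_op_def[abs_def])
  qed (auto simp: S_measurable a S_kernel_integrable t st S_integrable space_mu)
  finally show ?thesis by (simp add: semigroup_op_def[abs_def])
qed

lemma E_P_symmetric:
  "a \<in> S \<Longrightarrow> b \<in> S \<Longrightarrow> 0 \<le> t \<Longrightarrow> E (\<lambda>z. P t a z * b z) = E (\<lambda>z. a z * P t b z)"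
  using reversible S_square_integrable unfolding reversible_def by blast

lemma E_add: "a \<in> S \<Longrightarrow> b \<in> S \<Longrightarrow> E (\<lambda>z. a z + b z) = E a + E b"
  and E_diff: "a \<in> S \<Longrightarrow> b \<in> S \<Longrightarrow> E (\<lambda>z. a z - b z) = E a - E b"
  by (simp_all add: S_integrable)

lemma E_sum: "(\<And>i. i \<in> I \<Longrightarrow> a i \<in> S) \<Longrightarrow> E (\<lambda>z. \<Sum>i\<in>I. a i z) = (\<Sum>i\<in>I. E (a i))"
  by (rule Bochner_Integration.integral_sum) (auto intro: S_integrable)

lemma E_mono: "a \<in> S \<Longrightarrow> b \<in> S \<Longrightarrow> (\<And>z. a z \<le> b z) \<Longrightarrow> E a \<le> E b"
  by (intro integral_mono S_integrable)

definition L2norm :: "('a \<Rightarrow> real) \<Rightarrow> real" where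
  "L2norm a = sqrt (E (\<lambda>z. (a z)\<^sup>2))"

lemma L2norm_nonneg [simp]: "0 \<le> L2norm a"
  by (simp add: L2norm_def)

lemma L2norm_square: "(L2norm a)\<^sup>2 = E (\<lambda>z. (a z)\<^sup>2)"
  by (simp add: L2norm_def)

lemma cauchy_schwarz:
  assumes a: "a \<in> S" and b: "b \<in> S"
  shows "\<bar>E (\<lambda>z. a z * b z)\<bar> \<le> L2norm a * L2norm b"
proof -
  have "(E (\<lambda>z. a z * b z))\<^sup>2 \<le> E (\<lambda>z. (a z)\<^sup>2) * E (\<lambda>z. (b z)\<^sup>2)"
  proof (rule discriminant_le)
    fix t :: real
    have "0 \<le> E (\<lambda>z. (a z + t * b z)\<^sup>2)" by simp
    also have "(\<lambda>z. (a z + t * b z)\<^sup>2) = (\<lambda>z. (a z)\<^sup>2 + (2 * t) * (a z * b z) + t\<^sup>2 * (b z)\<^sup>2)"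
      by (auto simp: power2_eq_square algebra_simps)
    also have "E \<dots> = E (\<lambda>z. (a z)\<^sup>2) + 2 * t * E (\<lambda>z. a z * b z) + t\<^sup>2 * E (\<lambda>z. (b z)\<^sup>2)"
      using a b by (simp add: E_add mult.assoc)
    finally show "0 \<le> E (\<lambda>z. (a z)\<^sup>2) + 2 * t * E (\<lambda>z. a z * b z) + t\<^sup>2 * E (\<lambda>z. (b z)\<^sup>2)" .
  qed simp
  then have "(E (\<lambda>z. a z * b z))\<^sup>2 \<le> (L2norm a * L2norm b)\<^sup>2"
    by (simp add: power_mult_distrib L2norm_square)
  then have "\<bar>E (\<lambda>z. a z * b z)\<bar>\<^sup>2 \<le> (L2norm a * L2norm b)\<^sup>2" by simp
  then show ?thesis by (rule power2_le_imp_le) simp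
qed

lemma L2norm_triangle:
  assumes a: "a \<in> S" and b: "b \<in> S"
  shows "L2norm (\<lambda>z. a z + b z) \<le> L2norm a + L2norm b"
proof (rule power2_le_imp_le)
  have "(L2norm (\<lambda>z. a z + b z))\<^sup>2 = E (\<lambda>z. (a z)\<^sup>2 + 2 * (a z * b z) + (b z)\<^sup>2)"
    unfolding L2norm_square by (intro arg_cong[where f=E]) (auto simp: power2_eq_square algebra_simps)
  also have "\<dots> = E (\<lambda>z. (a z)\<^sup>2) + 2 * E (\<lambda>z. a z * b z) + E (\<lambda>z. (b z)\<^sup>2)"
    using a b by (simp add: E_add)
  also have "\<dots> \<le> (L2norm a)\<^sup>2 + 2 * (L2norm a * L2norm b) + (L2norm b)\<^sup>2"
    using cauchy_schwarz[OF a b] by (simp add: L2norm_square)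
  also have "\<dots> = (L2norm a + L2norm b)\<^sup>2" by (simp add: power2_eq_square algebra_simps)
  finally show "(L2norm (\<lambda>z. a z + b z))\<^sup>2 \<le> (L2norm a + L2norm b)\<^sup>2" .
qed simp

text \<open>The variance of \<open>a\<close> under the kernel is nonnegative.\<close>

lemma P_square_le:
  assumes a: "a \<in> S" and t: "0 \<le> t"
  shows "(P t a z)\<^sup>2 \<le> P t (\<lambda>y. (a y)\<^sup>2) z"
proof -
  let ?m = "P t a z"
  have "0 \<le> P t (\<lambda>y. (a y - ?m)\<^sup>2) z" unfolding semigroup_op_def by simp
  also have "(\<lambda>y. (a y - ?m)\<^sup>2) = (\<lambda>y. (a y)\<^sup>2 - ((2 * ?m) * a y - ?m\<^sup>2))"
    by (auto simp: power2_eq_square algebra_simps)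
  also have "P t \<dots> z = P t (\<lambda>y. (a y)\<^sup>2) z - (2 * ?m * ?m - ?m\<^sup>2)"
    using a t by (simp add: P_diff P_cmult P_const)
  finally show ?thesis by (simp add: power2_eq_square)
qed

lemma L2norm_P: assumes a: "a \<in> S" and t: "0 \<le> t" shows "L2norm (P t a) \<le> L2norm a"
proof -
  have "E (\<lambda>z. (P t a z)\<^sup>2) \<le> E (P t (\<lambda>y. (a y)\<^sup>2))"
    using a t by (intro E_mono P_square_le) auto
  also have "\<dots> = E (\<lambda>y. (a y)\<^sup>2)" using a t by (intro E_P) auto
  finally show ?thesis by (simp add: L2norm_def)
qed

text \<open>Together with the contraction in \<open>L\<^sup>2\<close> this bounds products of three factors uniformly in time.\<close>

lemma E_P_power4: assumes a: "a \<in> S" and t: "0 \<le> t" shows "E (\<lambda>z. (P t a z) ^ 4) \<le> E (\<lambda>z. (a z) ^ 4)"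
proof -
  have "(P t a z) ^ 4 \<le> (P t (\<lambda>y. (a y)\<^sup>2) z)\<^sup>2" for z
    using power_mono[OF P_square_le[OF a t, of z], of 2] by (simp add: power_mult[symmetric])
  then have "E (\<lambda>z. (P t a z) ^ 4) \<le> (L2norm (P t (\<lambda>y. (a y)\<^sup>2)))\<^sup>2"
    unfolding L2norm_square using a t by (intro E_mono) auto
  also have "\<dots> \<le> (L2norm (\<lambda>y. (a y)\<^sup>2))\<^sup>2"
    using a t by (intro power_mono L2norm_P) auto
  finally show ?thesis by (simp add: L2norm_square power_mult[symmetric])
qed

lemma DQ_eq: "DQ t a z = (P t a z - a z) / t"
  by (simp add: difference_quotient_def)

lemma S_DQ [simp]: "a \<in> S \<Longrightarrow> 0 \<le> t \<Longrightarrow> DQ t a \<in> S"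
proof -
  assume "a \<in> S" "0 \<le> t"
  then have "(\<lambda>z. 1 / t * (P t a z - a z)) \<in> S" by (intro S_cmult S_diff S_semigroup)
  then show "DQ t a \<in> S" by (simp add: difference_quotient_def[abs_def])
qed

lemma L2norm_DQ_tendsto: "a \<in> S \<Longrightarrow> ((\<lambda>t. L2norm (\<lambda>z. DQ t a z - L a z)) \<longlongrightarrow> 0) (at_right 0)"
  using tendsto_real_sqrt[OF S_generator_L2] by (simp add: L2norm_def)

lemma E_mult_tendsto_zero:
  assumes "((\<lambda>t. L2norm (a t)) \<longlongrightarrow> 0) F" "\<forall>\<^sub>F t in F. a t \<in> S" "b \<in> S"
  shows "((\<lambda>t. E (\<lambda>z. a t z * b z)) \<longlongrightarrow> 0) F"
proof (rule tendsto_0_le[where K="L2norm b"])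
  show "((\<lambda>t. L2norm (a t)) \<longlongrightarrow> 0) F" by fact
  show "\<forall>\<^sub>F t in F. norm (E (\<lambda>z. a t z * b z)) \<le> norm (L2norm (a t)) * L2norm b"
    using assms(2) by eventually_elim (use cauchy_schwarz assms(3) in auto)
qed

lemma at_right_0_nonneg: "\<forall>\<^sub>F t in at_right (0::real). 0 \<le> t"
  using eventually_at_right_less[of "0::real"] by eventually_elim simp

lemma E_DQ_tendsto:
  assumes a: "a \<in> S" and b: "b \<in> S"
  shows "((\<lambda>t. E (\<lambda>z. DQ t a z * b z)) \<longlongrightarrow> E (\<lambda>z. L a z * b z)) (at_right 0)"
proof (rule LIM_zero_cancel, rule Lim_transform_eventually)
  show "((\<lambda>t. E (\<lambda>z. (DQ t a z - L a z) * b z)) \<longlongrightarrow> 0) (at_right 0)"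
    using a b by (intro E_mult_tendsto_zero L2norm_DQ_tendsto eventually_mono[OF at_right_0_nonneg]) auto
  show "\<forall>\<^sub>F t in at_right 0. E (\<lambda>z. (DQ t a z - L a z) * b z) = E (\<lambda>z. DQ t a z * b z) - E (\<lambda>z. L a z * b z)"
    using at_right_0_nonneg
  proof eventually_elim
    case (elim t)
    then show ?case using a b by (simp add: left_diff_distrib E_diff)
  qed
qed

lemma L_tendsto: "a \<in> S \<Longrightarrow> ((\<lambda>t. DQ t a z) \<longlongrightarrow> L a z) (at_right 0)"
  using S_generator_ex[of a z] unfolding generator_def
  by (metis tendsto_Lim trivial_limit_at_right_real)

lemma E_L_symmetric:
  assumes a: "a \<in> S" and b: "b \<in> S"
  shows "E (\<lambda>z. L a z * b z) = E (\<lambda>z. a z * L b z)"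
proof (rule tendsto_unique[OF _ E_DQ_tendsto[OF a b]])
  have "((\<lambda>t. E (\<lambda>z. DQ t b z * a z)) \<longlongrightarrow> E (\<lambda>z. L b z * a z)) (at_right 0)"
    by (rule E_DQ_tendsto[OF b a])
  moreover have "\<forall>\<^sub>F t in at_right 0. E (\<lambda>z. DQ t b z * a z) = E (\<lambda>z. DQ t a z * b z)"
    using at_right_0_nonneg
  proof eventually_elim
    case (elim t)
    then show ?case using a b E_P_symmetric[OF a b elim]
      by (simp add: DQ_eq right_diff_distrib E_diff mult.commute)
  qed
  ultimately show "((\<lambda>t. E (\<lambda>z. DQ t a z * b z)) \<longlongrightarrow> E (\<lambda>z. a z * L b z)) (at_right 0)"
    by (subst (asm) tendsto_cong) (simp_all add: mult.commute)
qed simp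

lemma L2norm_P_diff_tendsto:
  assumes a: "a \<in> S"
  shows "((\<lambda>t. L2norm (\<lambda>z. P t a z - a z)) \<longlongrightarrow> 0) (at_right 0)"
proof (rule tendsto_0_le[where K=1])
  have "((\<lambda>t. t * (L2norm (\<lambda>z. DQ t a z - L a z) + L2norm (L a))) \<longlongrightarrow> 0 * (0 + L2norm (L a))) (at_right 0)"
    by (intro tendsto_intros L2norm_DQ_tendsto[OF a])
  then show "((\<lambda>t. t * (L2norm (\<lambda>z. DQ t a z - L a z) + L2norm (L a))) \<longlongrightarrow> 0) (at_right 0)" by simp
  show "\<forall>\<^sub>F t in at_right 0. norm (L2norm (\<lambda>z. P t a z - a z))
      \<le> norm (t * (L2norm (\<lambda>z. DQ t a z - L a z) + L2norm (L a))) * 1"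
    using eventually_at_right_less[of "0::real"]
  proof eventually_elim
    case (elim t)
    have "L2norm (\<lambda>z. P t a z - a z) = t * L2norm (\<lambda>z. (DQ t a z - L a z) + L a z)"
      using elim by (simp add: L2norm_def DQ_eq power_divide real_sqrt_divide)
    also have "\<dots> \<le> t * (L2norm (\<lambda>z. DQ t a z - L a z) + L2norm (L a))"
      using elim a by (intro mult_left_mono L2norm_triangle) auto
    finally show ?case using elim by simp
  qed
qed

lemma E_L_P:
  assumes a: "a \<in> S" and b: "b \<in> S" and t: "0 \<le> t"
  shows "E (\<lambda>z. L (P t a) z * b z) = E (\<lambda>z. P t (L a) z * b z)"
proof -
  have "E (\<lambda>z. P t (L a) z * b z) = E (\<lambda>z. L a z * P t b z)" using assms by (intro E_P_symmetric) auto
  moreover have "E (\<lambda>z. L (P t a) z * b z) = E (\<lambda>z. L a z * P t b z)"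
  proof (rule tendsto_unique)
    show "((\<lambda>s. E (\<lambda>z. DQ s (P t a) z * b z)) \<longlongrightarrow> E (\<lambda>z. L (P t a) z * b z)) (at_right 0)"
      using assms by (intro E_DQ_tendsto) auto
    have lim: "((\<lambda>s. E (\<lambda>z. DQ s a z * P t b z)) \<longlongrightarrow> E (\<lambda>z. L a z * P t b z)) (at_right 0)"
      using assms by (intro E_DQ_tendsto) auto
    have ev: "\<forall>\<^sub>F s in at_right 0. E (\<lambda>z. DQ s a z * P t b z) = E (\<lambda>z. DQ s (P t a) z * b z)"
      using at_right_0_nonneg
    proof eventually_elim
      case (elim s)
      have "P s (P t a) = P t (P s a)"
        using P_semigroup[OF a elim t] P_semigroup[OF a t elim] by (simp add: add.commute)
      moreover have "E (\<lambda>z. P t (P s a) z * b z) = E (\<lambda>z. P s a z * P t b z)"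
        "E (\<lambda>z. P t a z * b z) = E (\<lambda>z. a z * P t b z)"
        using assms elim by (auto intro!: E_P_symmetric)
      ultimately show ?case
        using assms elim by (simp add: DQ_eq left_diff_distrib E_diff)
    qed
    show "((\<lambda>s. E (\<lambda>z. DQ s (P t a) z * b z)) \<longlongrightarrow> E (\<lambda>z. L a z * P t b z)) (at_right 0)"
      using lim ev by (rule Lim_transform_eventually)
  qed simp
  ultimately show ?thesis by simp
qed

text \<open>Weakly, both sides are the derivative of the semigroup at time \<open>t\<close>; testing the difference against
  itself shows that they agree almost everywhere. A pointwise identity would require interchanging the
  limit that defines \<open>L a\<close> with \<open>P t\<close>.\<close>

lemma L_P_commute_AE:
  assumes a: "a \<in> S" and t: "0 \<le> t"
  shows "AE z in \<mu>. L (P t a) z = P t (L a) z"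
proof -
  let ?d = "\<lambda>z. L (P t a) z - P t (L a) z"
  have d: "?d \<in> S" using a t by simp
  have "E (\<lambda>z. ?d z * ?d z) = 0"
    using E_L_P[OF a d t] a t d by (subst left_diff_distrib) (simp add: E_diff)
  then have "AE z in \<mu>. ?d z * ?d z = 0"
    using d by (subst (asm) integral_nonneg_eq_0_iff_AE) (auto intro!: S_integrable)
  then show ?thesis by eventually_elim simp
qed

text \<open>Only the right-hand difference quotients are controlled by hypothesis. Two-sided
  differentiability follows because, by reversibility, the difference quotient over an interval can be
  written with the semigroup at its left end point moved to the other factor.\<close>

lemma E_P_has_derivative:
  assumes a: "a \<in> S" and b: "b \<in> S" and r: "0 \<le> r"
  shows "((\<lambda>t. E (\<lambda>z. P t a z * b z)) has_real_derivative E (\<lambda>z. P r (L a) z * b z)) (at r within {0..})"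
  unfolding has_field_derivative_iff
proof (rule LIM_zero_cancel, rule tendsto_0_le[where K=1])
  define g where "g e = L2norm (\<lambda>z. DQ e a z - L a z) * L2norm b
    + L2norm (L a) * L2norm (\<lambda>z. P e b z - b z)" for e
  have "((\<lambda>e. g e) \<longlongrightarrow> 0 * L2norm b + L2norm (L a) * 0) (at_right 0)"
    unfolding g_def by (intro tendsto_intros L2norm_DQ_tendsto[OF a] L2norm_P_diff_tendsto[OF b])
  then have g: "(g \<longlongrightarrow> 0) (at_right 0)" by simp
  have "filterlim (\<lambda>t. \<bar>t - r\<bar>) (at_right 0) (at r within {0..})"
    unfolding filterlim_at
  proof
    show "\<forall>\<^sub>F t in at r within {0..}. \<bar>t - r\<bar> \<in> {0<..} \<and> \<bar>t - r\<bar> \<noteq> 0"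
      by (auto simp: eventually_at_filter)
    have "((\<lambda>t. \<bar>t - r\<bar>) \<longlongrightarrow> \<bar>r - r\<bar>) (at r within {0..})" by (intro tendsto_intros)
    then show "((\<lambda>t. \<bar>t - r\<bar>) \<longlongrightarrow> 0) (at r within {0..})" by simp
  qed
  then show "((\<lambda>t. g \<bar>t - r\<bar>) \<longlongrightarrow> 0) (at r within {0..})"
    by (rule filterlim_compose[OF g])
  show "\<forall>\<^sub>F t in at r within {0..}. norm ((E (\<lambda>z. P t a z * b z) - E (\<lambda>z. P r a z * b z)) / (t - r)
      - E (\<lambda>z. P r (L a) z * b z)) \<le> norm (g \<bar>t - r\<bar>) * 1"
    unfolding eventually_at_filter
  proof (intro always_eventually allI impI)
    fix t assume t: "t \<noteq> r" "t \<in> {0..}"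
    (* in either order of t and r, m is the left end point and e the length of the interval *)
    define m where "m = min t r"
    define e where "e = \<bar>t - r\<bar>"
    have m: "0 \<le> m" and e: "0 < e" using t r by (auto simp: m_def e_def)
    have quot: "(E (\<lambda>z. P t a z * b z) - E (\<lambda>z. P r a z * b z)) / (t - r) = E (\<lambda>z. DQ e a z * P m b z)"
    proof -
      have "(E (\<lambda>z. P t a z * b z) - E (\<lambda>z. P r a z * b z)) / (t - r)
          = (E (\<lambda>z. P (m + e) a z * b z) - E (\<lambda>z. P m a z * b z)) / e"
      proof (cases "t \<le> r")
        case True
        then have "m = t" "m + e = r" "e = - (t - r)" by (auto simp: m_def e_def)
        moreover have "(u - v) / (t - r) = (v - u) / - (t - r)" for u v :: real
          using minus_divide_divide[of "u - v" "t - r"] by simp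
        ultimately show ?thesis by simp
      next
        case False
        then have "m = r" "m + e = t" "e = t - r" by (auto simp: m_def e_def)
        then show ?thesis by simp
      qed
      also have "E (\<lambda>z. P (m + e) a z * b z) = E (\<lambda>z. P e a z * P m b z)"
      proof -
        have "P (m + e) a = P m (P e a)" using a m e by (intro P_semigroup) auto
        then show ?thesis using E_P_symmetric[of "P e a" b m] a b m e by simp
      qed
      also have "E (\<lambda>z. P m a z * b z) = E (\<lambda>z. a z * P m b z)"
        using a b m by (intro E_P_symmetric)
      also have "(E (\<lambda>z. P e a z * P m b z) - E (\<lambda>z. a z * P m b z)) / e = E (\<lambda>z. DQ e a z * P m b z)"
        using a b m e by (simp add: DQ_eq left_diff_distrib E_diff)
      finally show ?thesis .
    qed
    have rm: "E (\<lambda>z. P r (L a) z * b z) = E (\<lambda>z. L a z * P m (P (r - m) b) z)"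
    proof -
      have "0 \<le> r - m" by (simp add: m_def)
      then have "P m (P (r - m) b) = P r b" using P_semigroup[OF b m, of "r - m"] by simp
      then show ?thesis using E_P_symmetric[OF S_generator[OF a] b r] by simp
    qed
    have 1: "\<bar>E (\<lambda>z. (DQ e a z - L a z) * P m b z)\<bar> \<le> L2norm (\<lambda>z. DQ e a z - L a z) * L2norm b"
      using cauchy_schwarz[of "\<lambda>z. DQ e a z - L a z" "P m b"] a b m e
        mult_left_mono[OF L2norm_P[OF b m], of "L2norm (\<lambda>z. DQ e a z - L a z)"] by simp
    have 2: "\<bar>E (\<lambda>z. L a z * P m (\<lambda>z. P (r - m) b z - b z) z)\<bar> \<le> L2norm (L a) * L2norm (\<lambda>z. P e b z - b z)"
    proof (cases "m = r")
      case True
      then show ?thesis using b m by (simp add: P_0 P_const)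
    next
      case False
      then have "r - m = e" unfolding m_def e_def min_def by (cases "t \<le> r") auto
      moreover have "\<bar>E (\<lambda>z. L a z * P m (\<lambda>z. P e b z - b z) z)\<bar> \<le> L2norm (L a) * L2norm (P m (\<lambda>z. P e b z - b z))"
        using a b m e by (intro cauchy_schwarz) auto
      moreover have "\<dots> \<le> L2norm (L a) * L2norm (\<lambda>z. P e b z - b z)"
        using b e m by (intro mult_left_mono L2norm_P) auto
      ultimately show ?thesis by simp
    qed
    have "0 \<le> r - m" by (simp add: m_def)
    then have "E (\<lambda>z. DQ e a z * P m b z) - E (\<lambda>z. P r (L a) z * b z)
        = E (\<lambda>z. (DQ e a z - L a z) * P m b z) - E (\<lambda>z. L a z * P m (\<lambda>z. P (r - m) b z - b z) z)"
      using a b m e by (simp add: rm P_diff left_diff_distrib right_diff_distrib E_diff)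
    then show "norm ((E (\<lambda>z. P t a z * b z) - E (\<lambda>z. P r a z * b z)) / (t - r)
      - E (\<lambda>z. P r (L a) z * b z)) \<le> norm (g \<bar>t - r\<bar>) * 1"
      using 1 2 unfolding quot g_def e_def[symmetric] by simp
  qed
qed

lemma E_P_tendsto_at_top:
  assumes a: "a \<in> S" and b: "b \<in> S"
  shows "((\<lambda>t. E (\<lambda>z. P t a z * b z)) \<longlongrightarrow> E a * E b) at_top"
proof (rule LIM_zero_cancel, rule Lim_transform_eventually)
  have "((\<lambda>t. L2norm (\<lambda>z. P t a z - E a)) \<longlongrightarrow> 0) at_top"
    using tendsto_real_sqrt[OF ergodic[unfolded ergodic_def, rule_format, OF S_square_integrable[OF a]]]
    by (simp add: L2norm_def)
  moreover have ev: "\<forall>\<^sub>F t in at_top. (0::real) \<le> t" by (rule eventually_ge_at_top)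
  ultimately show "((\<lambda>t. E (\<lambda>z. (P t a z - E a) * b z)) \<longlongrightarrow> 0) at_top"
    using a b by (intro E_mult_tendsto_zero eventually_mono[OF ev]) auto
  show "\<forall>\<^sub>F t in at_top. E (\<lambda>z. (P t a z - E a) * b z) = E (\<lambda>z. P t a z * b z) - E a * E b"
    using ev by eventually_elim (use a b in \<open>simp add: left_diff_distrib E_diff\<close>)
qed

section \<open>Differentiating products along the semigroup\<close>

text \<open>The iterated carre du champ, tested against a third function, consists of expectations of products of
  three factors. Independent times for the factors reduce the derivative along the semigroup to partial
  derivatives, each of which moves a single factor against a fixed suitable function.\<close>

definition triple :: "('a \<Rightarrow> real) \<Rightarrow> ('a \<Rightarrow> real) \<Rightarrow> ('a \<Rightarrow> real) \<Rightarrow> real \<Rightarrow> real \<Rightarrow> real \<Rightarrow> real" where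
  "triple a b c x y z = E (\<lambda>w. P x a w * (P y b w * P z c w))"

definition triple_bound :: "('a \<Rightarrow> real) \<Rightarrow> ('a \<Rightarrow> real) \<Rightarrow> ('a \<Rightarrow> real) \<Rightarrow> real" where
  "triple_bound a b c = L2norm a * sqrt (E (\<lambda>w. b w ^ 4) + E (\<lambda>w. c w ^ 4))"

lemma triple_perm:
  "triple a b c x y z = triple b a c y x z" "triple a b c x y z = triple c a b z x y"
  by (simp_all add: triple_def mult_ac)

text \<open>One factor is estimated in \<open>L\<^sup>2\<close> and the other two in \<open>L\<^sup>4\<close>. Since \<open>P\<close> contracts both norms, the bound
  does not depend on the times.\<close>

lemma triple_bounded:
  assumes "a \<in> S" "b \<in> S" "c \<in> S" "0 \<le> x" "0 \<le> y" "0 \<le> z"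
  shows "\<bar>triple a b c x y z\<bar> \<le> triple_bound a b c"
proof -
  have "\<bar>triple a b c x y z\<bar> \<le> L2norm (P x a) * L2norm (\<lambda>w. P y b w * P z c w)"
    unfolding triple_def using assms by (intro cauchy_schwarz) auto
  also have "\<dots> \<le> L2norm a * sqrt (E (\<lambda>w. b w ^ 4) + E (\<lambda>w. c w ^ 4))"
  proof (intro mult_mono L2norm_P)
    have "E (\<lambda>w. (P y b w * P z c w)\<^sup>2) \<le> E (\<lambda>w. P y b w ^ 4 + P z c w ^ 4)"
    proof (intro E_mono)
      show "(P y b w * P z c w)\<^sup>2 \<le> P y b w ^ 4 + P z c w ^ 4" for w
      proof -
        have "2 * (P y b w * P z c w)\<^sup>2 \<le> P y b w ^ 4 + P z c w ^ 4"
          using sum_squares_bound[of "(P y b w)\<^sup>2" "(P z c w)\<^sup>2"]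
          by (simp add: power_mult_distrib power_mult[symmetric])
        then show ?thesis using zero_le_power2[of "P y b w * P z c w"] by linarith
      qed
    qed (use assms in auto)
    also have "\<dots> = E (\<lambda>w. P y b w ^ 4) + E (\<lambda>w. P z c w ^ 4)" using assms by (simp add: E_add)
    also have "\<dots> \<le> E (\<lambda>w. b w ^ 4) + E (\<lambda>w. c w ^ 4)" using assms by (intro add_mono E_P_power4)
    finally show "L2norm (\<lambda>w. P y b w * P z c w) \<le> sqrt (E (\<lambda>w. b w ^ 4) + E (\<lambda>w. c w ^ 4))"
      unfolding L2norm_def by simp
  qed (use assms in auto)
  finally show ?thesis by (simp add: triple_bound_def)
qed

lemma triple_has_derivative:
  assumes "a \<in> S" "b \<in> S" "c \<in> S" "0 \<le> x" "0 \<le> y" "0 \<le> z"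
  shows "((\<lambda>x. triple a b c x y z) has_real_derivative triple (L a) b c x y z) (at x within {0..})"
  unfolding triple_def using assms by (intro E_P_has_derivative) auto

lemma triple_lipschitz:
  assumes "a \<in> S" "b \<in> S" "c \<in> S" "0 \<le> x" "0 \<le> x'" "0 \<le> y" "0 \<le> z"
  shows "\<bar>triple a b c x' y z - triple a b c x y z\<bar> \<le> triple_bound (L a) b c * \<bar>x' - x\<bar>"
proof -
  have "norm (triple a b c x' y z - triple a b c x y z) \<le> triple_bound (L a) b c * norm (x' - x)"
  proof (rule field_differentiable_bound[of "{0..}"])
    fix u :: real assume "u \<in> {0..}"
    then have "0 \<le> u" by simp
    with assms show "((\<lambda>x. triple a b c x y z) has_real_derivative triple (L a) b c u y z) (at u within {0..})"
      by (intro triple_has_derivative) auto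
    show "norm (triple (L a) b c u y z) \<le> triple_bound (L a) b c"
      using assms \<open>0 \<le> u\<close> by (simp add: triple_bounded)
  qed (use assms in auto)
  then show ?thesis by simp
qed

text \<open>The derivative of the derivative is again an expectation of the same kind, hence bounded.\<close>

lemma triple_taylor:
  assumes "a \<in> S" "b \<in> S" "c \<in> S" "0 \<le> x" "0 \<le> x'" "0 \<le> y" "0 \<le> z"
  shows "\<bar>triple a b c x' y z - triple a b c x y z - (x' - x) * triple (L a) b c x y z\<bar>
    \<le> triple_bound (L (L a)) b c * (x' - x)\<^sup>2"
proof -
  let ?d = "triple (L a) b c x y z"
  let ?K = "triple_bound (L (L a)) b c"
  have "norm ((triple a b c x' y z - x' * ?d) - (triple a b c x y z - x * ?d)) \<le> (?K * \<bar>x' - x\<bar>) * norm (x' - x)"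
  proof (rule field_differentiable_bound[of "closed_segment x x'"])
    fix u assume u: "u \<in> closed_segment x x'"
    then have u0: "0 \<le> u" and ux: "\<bar>u - x\<bar> \<le> \<bar>x' - x\<bar>"
      using assms(4,5) by (auto simp: closed_segment_eq_real_ivl split: if_splits)
    have sub: "closed_segment x x' \<subseteq> {0..}"
      using assms(4,5) by (auto simp: closed_segment_eq_real_ivl split: if_splits)
    show "((\<lambda>u. triple a b c u y z - u * ?d) has_real_derivative triple (L a) b c u y z - ?d)
        (at u within closed_segment x x')"
      using assms u0
      by (auto intro!: derivative_eq_intros has_field_derivative_subset[OF triple_has_derivative sub])
    have "\<bar>triple (L a) b c u y z - ?d\<bar> \<le> ?K * \<bar>u - x\<bar>"
      using assms u0 by (intro triple_lipschitz) auto
    also have "\<dots> \<le> ?K * \<bar>x' - x\<bar>"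
      using ux triple_bounded[of "L (L a)" b c 0 0 0] assms by (intro mult_left_mono) auto
    finally show "norm (triple (L a) b c u y z - ?d) \<le> ?K * \<bar>x' - x\<bar>" by simp
  qed auto
  moreover have "(triple a b c x' y z - x' * ?d) - (triple a b c x y z - x * ?d)
      = triple a b c x' y z - triple a b c x y z - (x' - x) * ?d" by (simp add: algebra_simps)
  moreover have "(?K * \<bar>x' - x\<bar>) * norm (x' - x) = ?K * (x' - x)\<^sup>2"
    by (simp only: real_norm_def power2_eq_square mult.assoc abs_mult_self_eq)
  ultimately show ?thesis by (simp only: real_norm_def)
qed

text \<open>All three factors move simultaneously; the error of replacing the joint increment by the sum of
  the three partial ones is quadratic since the mixed increments are Lipschitz.\<close>

lemma triple_diagonal_has_derivative:
  assumes a: "a \<in> S" and b: "b \<in> S" and c: "c \<in> S" and s: "s \<in> {0..t}"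
  shows "((\<lambda>s. triple a b c s s (t - s)) has_real_derivative
    triple (L a) b c s s (t - s) + triple a (L b) c s s (t - s) - triple a b (L c) s s (t - s)) (at s within {0..t})"
proof -
  define K where "K = triple_bound (L (L a)) b c + triple_bound (L (L b)) a c + triple_bound (L (L c)) a b
    + triple_bound (L b) (L a) c + triple_bound (L c) (L a) b + triple_bound (L c) a (L b)"
  show ?thesis
  proof (rule has_real_derivative_quadratic[where e=1 and K=K])
    fix r assume r: "r \<in> {0..t}"
    define h where "h = r - s"
    have nn: "0 \<le> r" "0 \<le> s" "0 \<le> t - r" "0 \<le> t - s" using r s by auto
    note S = a b c S_generator[OF a] S_generator[OF b] S_generator[OF c]
    have h2: "\<bar>(t - r) - (t - s)\<bar> = \<bar>h\<bar>" "((t - r) - (t - s))\<^sup>2 = h\<^sup>2" "(t - r) - (t - s) = - h"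
      by (auto simp: h_def power2_eq_square algebra_simps)
    have 1: "\<bar>triple a b c r r (t - r) - triple a b c s r (t - r) - h * triple (L a) b c s r (t - r)\<bar>
        \<le> triple_bound (L (L a)) b c * h\<^sup>2"
      unfolding h_def by (rule triple_taylor) (use S nn in auto)
    have 2: "\<bar>triple a b c s r (t - r) - triple a b c s s (t - r) - h * triple a (L b) c s s (t - r)\<bar>
        \<le> triple_bound (L (L b)) a c * h\<^sup>2"
      unfolding h_def triple_perm(1)[of a b] triple_perm(1)[of a "L b"]
      by (rule triple_taylor) (use S nn in auto)
    have 3: "\<bar>triple a b c s s (t - r) - triple a b c s s (t - s) - - h * triple a b (L c) s s (t - s)\<bar>
        \<le> triple_bound (L (L c)) a b * h\<^sup>2"
      unfolding h2(2,3)[symmetric] triple_perm(2)[of a b c] triple_perm(2)[of a b "L c"]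
      by (rule triple_taylor) (use S nn in auto)
    have lip: "\<bar>h * u - h * v\<bar> \<le> k * h\<^sup>2" if "\<bar>u - v\<bar> \<le> k * \<bar>h\<bar>" for u v k
      using mult_left_mono[OF that, of "\<bar>h\<bar>"]
      by (simp add: abs_mult[symmetric] right_diff_distrib power2_eq_square mult_ac)
    have 4: "\<bar>h * triple (L a) b c s r (t - r) - h * triple (L a) b c s s (t - r)\<bar>
        \<le> triple_bound (L b) (L a) c * h\<^sup>2"
      unfolding triple_perm(1)[of "L a" b]
      by (rule lip, unfold h_def, rule triple_lipschitz) (use S nn in auto)
    have 5: "\<bar>h * triple (L a) b c s s (t - r) - h * triple (L a) b c s s (t - s)\<bar>
        \<le> triple_bound (L c) (L a) b * h\<^sup>2"
      unfolding triple_perm(2)[of "L a" b]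
      by (rule lip, unfold h2(1)[symmetric], rule triple_lipschitz) (use S nn in auto)
    have 6: "\<bar>h * triple a (L b) c s s (t - r) - h * triple a (L b) c s s (t - s)\<bar>
        \<le> triple_bound (L c) a (L b) * h\<^sup>2"
      unfolding triple_perm(2)[of a "L b"]
      by (rule lip, unfold h2(1)[symmetric], rule triple_lipschitz) (use S nn in auto)
    have K: "K * h\<^sup>2 = triple_bound (L (L a)) b c * h\<^sup>2 + triple_bound (L (L b)) a c * h\<^sup>2
      + triple_bound (L (L c)) a b * h\<^sup>2 + triple_bound (L b) (L a) c * h\<^sup>2
      + triple_bound (L c) (L a) b * h\<^sup>2 + triple_bound (L c) a (L b) * h\<^sup>2"
      by (simp add: K_def distrib_right)
    have D: "h * (triple (L a) b c s s (t - s) + triple a (L b) c s s (t - s) - triple a b (L c) s s (t - s))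
      = h * triple (L a) b c s s (t - s) + h * triple a (L b) c s s (t - s) - h * triple a b (L c) s s (t - s)"
      by (simp add: algebra_simps)
    have "\<bar>triple a b c r r (t - r) - triple a b c s s (t - s)
        - h * (triple (L a) b c s s (t - s) + triple a (L b) c s s (t - s) - triple a b (L c) s s (t - s))\<bar> \<le> K * h\<^sup>2"
      unfolding K D
      using abs_le_D1[OF 1] abs_le_D2[OF 1] abs_le_D1[OF 2] abs_le_D2[OF 2] abs_le_D1[OF 3] abs_le_D2[OF 3]
        abs_le_D1[OF 4] abs_le_D2[OF 4] abs_le_D1[OF 5] abs_le_D2[OF 5] abs_le_D1[OF 6] abs_le_D2[OF 6]
      by (intro abs_leI) linarith+
    then show "\<bar>triple a b c r r (t - r) - triple a b c s s (t - s) - (r - s) *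
        (triple (L a) b c s s (t - s) + triple a (L b) c s s (t - s) - triple a b (L c) s s (t - s))\<bar> \<le> K * (r - s)\<^sup>2"
      by (simp only: h_def)
  qed simp
qed

end

section \<open>The semigroup of a Markov process\<close>

context markov_process
begin

lemma prob_law: "prob_space (Pr z)" and sets_law: "sets (Pr z) = sets W"
  using measurable_space[OF law, of z] by (auto simp: space_prob_algebra)

lemma space_law: "space (Pr z) = space W"
  using sets_law by (rule sets_eq_imp_space_eq)

lemma state_law: "0 \<le> t \<Longrightarrow> Z t \<in> Pr z \<rightarrow>\<^sub>M borel"
  using state measurable_cong_sets[OF sets_law refl] by blast

lemma transition_kernel_measurable:
  "0 \<le> t \<Longrightarrow> transition_kernel Pr Z t \<in> borel \<rightarrow>\<^sub>M prob_algebra borel"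
  unfolding transition_kernel_def[abs_def]
  by (rule measurable_compose[OF law measurable_distr_prob_space[OF state]])

lemma transition_kernel_0: "transition_kernel Pr Z 0 z = return borel z"
proof -
  interpret prob_space "Pr z" by (rule prob_law)
  have "transition_kernel Pr Z 0 z = distr (Pr z) borel (\<lambda>_. z)"
    unfolding transition_kernel_def
    by (rule distr_cong_AE) (use start state_law[of 0 z] in auto)
  then show ?thesis by (simp add: distr_const)
qed

lemma subalgebra_history: "subalgebra (Pr z) (history W Z s)"
proof -
  have "{Z u -` A \<inter> space W | u A. 0 \<le> u \<and> u \<le> s \<and> A \<in> sets borel} \<subseteq> sets W"
    using measurable_sets[OF state] by auto
  then show ?thesis
    unfolding subalgebra_def history_def space_law sets_law
    by (auto simp: space_measure_of_conv dest: sets.sigma_sets_subset)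
       (metis (no_types, lifting) sets.sigma_sets_subset sets.space_closed sets_measure_of subset_iff subset_trans)
qed

text \<open>The Chapman--Kolmogorov equation: integrating the conditional probability in the Markov property
  yields the unconditional one.\<close>

lemma transition_kernel_add:
  assumes s: "0 \<le> s" and t: "0 \<le> t"
  shows "transition_kernel Pr Z (s + t) z = transition_kernel Pr Z s z \<bind> transition_kernel Pr Z t"
proof (rule measure_eqI)
  interpret prob_space "Pr z" by (rule prob_law)
  interpret finite_measure_subalgebra "Pr z" "history W Z s"
    by unfold_locales (rule subalgebra_history)
  let ?k = "transition_kernel Pr Z"
  have kt: "?k t \<in> ?k s z \<rightarrow>\<^sub>M subprob_algebra borel"
    using measurable_prob_algebraD[OF transition_kernel_measurable[OF t]]
    by (simp add: transition_kernel_def[of Pr Z s])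
  have "space (?k s z) \<noteq> {}" by (simp add: transition_kernel_def)
  then have sb: "sets (?k s z \<bind> ?k t) = sets borel"
    by (intro sets_bind) (simp_all add: transition_kernel_def)
  then show "sets (?k (s + t) z) = sets (?k s z \<bind> ?k t)"
    by (simp add: transition_kernel_def)
  fix A assume "A \<in> sets (?k (s + t) z)"
  then have A[measurable]: "A \<in> sets borel" by (simp add: transition_kernel_def)
  have st: "0 \<le> s + t" using s t by simp
  note [measurable] = state_law[OF st] state_law[OF s]
  have int: "integrable (Pr z) (\<lambda>w. indicator A (Z (s + t) w) :: real)"
    by (rule integrable_const_bound[where B=1]) auto
  have km: "(\<lambda>y. emeasure (?k t y) A) \<in> borel_measurable borel"
    by (rule measurable_compose[OF measurable_prob_algebraD[OF transition_kernel_measurable[OF t]]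
          measurable_emeasure_subprob_algebra[OF A]])
  have kA: "emeasure (?k t y) A = ennreal (measure (Pr y) {w' \<in> space W. Z t w' \<in> A})" for y
  proof -
    interpret y: prob_space "Pr y" by (rule prob_law)
    have "emeasure (?k t y) A = emeasure (Pr y) (Z t -` A \<inter> space (Pr y))"
      unfolding transition_kernel_def by (rule emeasure_distr[OF state_law[OF t] A])
    also have "Z t -` A \<inter> space (Pr y) = {w' \<in> space W. Z t w' \<in> A}" by (auto simp: space_law)
    finally show ?thesis by (simp add: y.emeasure_eq_measure)
  qed
  let ?g = "real_cond_exp (Pr z) (history W Z s) (\<lambda>w'. indicator A (Z (s + t) w'))"
  have mk: "AE w in Pr z. ?g w = measure (Pr (Z s w)) {w' \<in> space W. Z t w' \<in> A}"
    by (rule markov[OF s t A])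
  have g0: "AE w in Pr z. 0 \<le> ?g w" using mk by eventually_elim simp
  have "emeasure (?k (s + t) z) A = emeasure (Pr z) (Z (s + t) -` A \<inter> space (Pr z))"
    unfolding transition_kernel_def by (rule emeasure_distr) measurable
  also have "\<dots> = (\<integral>\<^sup>+w. ennreal (indicator A (Z (s + t) w)) \<partial>Pr z)"
  proof -
    have "(\<integral>\<^sup>+w. ennreal (indicator A (Z (s + t) w)) \<partial>Pr z)
        = (\<integral>\<^sup>+w. indicator (Z (s + t) -` A \<inter> space (Pr z)) w \<partial>Pr z)"
      by (intro nn_integral_cong) (auto simp: indicator_def)
    then show ?thesis by simp
  qed
  also have "\<dots> = ennreal (\<integral>w. indicator A (Z (s + t) w) \<partial>Pr z)"
    by (rule nn_integral_eq_integral[OF int]) auto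
  also have "\<dots> = ennreal (\<integral>w. ?g w \<partial>Pr z)" by (simp add: real_cond_exp_int(2)[OF int])
  also have "\<dots> = (\<integral>\<^sup>+w. ennreal (?g w) \<partial>Pr z)"
    by (rule nn_integral_eq_integral[symmetric, OF real_cond_exp_int(1)[OF int] g0])
  also have "\<dots> = (\<integral>\<^sup>+w. emeasure (?k t (Z s w)) A \<partial>Pr z)"
    by (rule nn_integral_cong_AE) (use mk in \<open>eventually_elim, simp add: kA\<close>)
  also have "\<dots> = (\<integral>\<^sup>+y. emeasure (?k t y) A \<partial>?k s z)"
    unfolding transition_kernel_def[of Pr Z s]
    by (rule nn_integral_distr[symmetric, OF state_law[OF s]]) (use km in simp)
  also have "\<dots> = emeasure (?k s z \<bind> ?k t) A"
    by (rule emeasure_bind[symmetric, OF _ kt A]) (simp add: transition_kernel_def)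
  finally show "emeasure (?k (s + t) z) A = emeasure (?k s z \<bind> ?k t) A" .
qed

end

section \<open>Matrix-valued functions\<close>

lemma matrix_basis_expansion:
  fixes A :: "complex^'n^'n"
  shows "A = (\<Sum>i\<in>UNIV. \<Sum>j\<in>UNIV. Re (A $ i $ j) *\<^sub>R axis i (axis j 1) + Im (A $ i $ j) *\<^sub>R axis i (axis j \<i>))"
proof -
  have "(\<Sum>i\<in>UNIV. \<Sum>j\<in>UNIV. Re (A $ i $ j) *\<^sub>R axis i (axis j 1) + Im (A $ i $ j) *\<^sub>R axis i (axis j \<i>)) $ k $ l
    = (\<Sum>i\<in>UNIV. \<Sum>j\<in>UNIV. if k = i \<and> l = j then A $ i $ j else 0)" for k l
    by (simp only: sum_component vector_add_component vector_scaleR_component)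
       (intro sum.cong refl, auto simp: axis_def complex_eq_iff)
  also have "(\<Sum>i\<in>UNIV. \<Sum>j\<in>UNIV. if k = i \<and> l = j then A $ i $ j else 0) = A $ k $ l" for k l
  proof -
    have "(\<Sum>i\<in>UNIV. \<Sum>j\<in>UNIV. if k = i \<and> l = j then A $ i $ j else 0)
        = (\<Sum>i\<in>UNIV. if k = i then A $ i $ l else 0)"
      by (intro sum.cong refl) (simp add: if_distrib if_bool_eq_conj)
    then show ?thesis by simp
  qed
  finally show ?thesis by (simp add: vec_eq_iff)
qed

lemma bounded_linear_entry:
  "bounded_linear (\<lambda>A :: complex^'n^'n. Re (A $ i $ j))" "bounded_linear (\<lambda>A :: complex^'n^'n. Im (A $ i $ j))"
  by (auto intro!: linear_conv_bounded_linear[THEN iffD1] linearI)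

lemma bounded_linear_mult_left: "bounded_linear (\<lambda>B :: complex^'n^'n. A ** B)" for A :: "complex^'n^'n"
  by (auto intro!: linear_conv_bounded_linear[THEN iffD1] linearI simp: matrix_distribs)

lemma bounded_linear_mult_right: "bounded_linear (\<lambda>B :: complex^'n^'n. B ** A)" for A :: "complex^'n^'n"
  by (auto intro!: linear_conv_bounded_linear[THEN iffD1] linearI simp: matrix_distribs)

lemma bounded_linear_quadratic_form:
  "bounded_linear (\<lambda>A :: complex^'n^'n. Re (\<Sum>i\<in>UNIV. cnj (x $ i) * (A *v x) $ i))"
  by (auto intro!: linear_conv_bounded_linear[THEN iffD1] linearI
      simp: matrix_vector_mult_def sum_distrib_left scaleR_sum_right sum.distrib[symmetric] algebra_simps)

text \<open>This transfers results from entries to matrices: a linear functional of a matrix-valued function is a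
  fixed linear combination of real-valued functions.\<close>

lemma bounded_linear_basis_expansion:
  fixes T :: "complex^'n^'n \<Rightarrow> 'b::real_normed_vector"
  assumes "bounded_linear T"
  shows "T A = (\<Sum>i\<in>UNIV. \<Sum>j\<in>UNIV. Re (A $ i $ j) *\<^sub>R T (axis i (axis j 1)) + Im (A $ i $ j) *\<^sub>R T (axis i (axis j \<i>)))"
proof -
  interpret bounded_linear T by fact
  show ?thesis by (subst matrix_basis_expansion) (simp only: sum add scaleR)
qed

lemma retr_mult_entries:
  "retr (A ** B) = (\<Sum>i\<in>UNIV. \<Sum>j\<in>UNIV. Re (A $ i $ j) * Re (B $ j $ i) - Im (A $ i $ j) * Im (B $ j $ i))"
  by (simp add: retr_def trace_def matrix_matrix_mult_def)

lemma retr_mult3_entries: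
  "retr (A ** B ** C) = (\<Sum>i\<in>UNIV. \<Sum>j\<in>UNIV. \<Sum>k\<in>UNIV.
      Re (A $ i $ k) * (Re (B $ k $ j) * Re (C $ j $ i)) - Re (A $ i $ k) * (Im (B $ k $ j) * Im (C $ j $ i))
    - Im (A $ i $ k) * (Re (B $ k $ j) * Im (C $ j $ i)) - Im (A $ i $ k) * (Im (B $ k $ j) * Re (C $ j $ i)))"
proof -
  have "trace (A ** B ** C) = (\<Sum>i\<in>UNIV. \<Sum>j\<in>UNIV. \<Sum>k\<in>UNIV. A $ i $ k * (B $ k $ j * C $ j $ i))"
    by (simp add: trace_def matrix_matrix_mult_def sum_distrib_right mult.assoc)
  then show ?thesis by (simp add: retr_def algebra_simps)
qed

context symmetric_semigroup
begin

abbreviation "PM \<equiv> (semigroup_op \<kappa> :: real \<Rightarrow> ('a \<Rightarrow> complex^'n^'n) \<Rightarrow> 'a \<Rightarrow> complex^'n^'n)"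
abbreviation "LM \<equiv> (generator \<kappa> :: ('a \<Rightarrow> complex^'n^'n) \<Rightarrow> 'a \<Rightarrow> complex^'n^'n)"
abbreviation "\<Gamma> \<equiv> carre_du_champ \<kappa>"
abbreviation "\<Gamma>2 \<equiv> carre_du_champ2 \<kappa>"

lemma suitable_entry:
  "suitable S F \<Longrightarrow> (\<lambda>z. Re (F z $ i $ j)) \<in> S" "suitable S F \<Longrightarrow> (\<lambda>z. Im (F z $ i $ j)) \<in> S"
  by (simp_all add: suitable_def)

lemma suitable_linear_real:
  assumes "suitable S F" "bounded_linear T"
  shows "(\<lambda>z. T (F z) :: real) \<in> S"
  by (subst bounded_linear_basis_expansion[OF assms(2)])
     (use suitable_entry[OF assms(1)] in \<open>auto intro!: S_sum S_add simp: mult.commute[of "Re _"] mult.commute[of "Im _"]\<close>)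

lemma suitable_const: "suitable S (\<lambda>z. A)"
  by (simp add: suitable_def)

lemma suitable_add: "suitable S F \<Longrightarrow> suitable S G \<Longrightarrow> suitable S (\<lambda>z. F z + G z)"
  and suitable_diff: "suitable S F \<Longrightarrow> suitable S G \<Longrightarrow> suitable S (\<lambda>z. F z - G z)"
  and suitable_scaleR: "suitable S F \<Longrightarrow> suitable S (\<lambda>z. r *\<^sub>R F z)"
  and suitable_mult: "suitable S F \<Longrightarrow> suitable S G \<Longrightarrow> suitable S (\<lambda>z. F z ** G z)"
  by (auto simp: suitable_def matrix_matrix_mult_def)

lemma suitable_integrable:
  assumes F: "suitable S F" and M: "\<And>a. a \<in> S \<Longrightarrow> integrable M a"
  shows "integrable M F"
proof -
  have "integrable M (\<lambda>z. \<Sum>i\<in>UNIV. \<Sum>j\<in>UNIV. Re (F z $ i $ j) *\<^sub>R axis i (axis j 1) + Im (F z $ i $ j) *\<^sub>R axis i (axis j \<i>))"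
    using suitable_entry[OF F]
    by (intro Bochner_Integration.integrable_sum Bochner_Integration.integrable_add integrable_scaleR_left M)
  then show ?thesis by (simp only: matrix_basis_expansion[symmetric])
qed

lemma PM_linear:
  fixes T :: "complex^'n^'n \<Rightarrow> 'b::{banach, second_countable_topology}"
  assumes "suitable S F" "0 \<le> t" "bounded_linear T"
  shows "semigroup_op \<kappa> t (\<lambda>y. T (F y)) z = T (PM t F z)"
  unfolding semigroup_op_def
  by (rule integral_bounded_linear[OF assms(3) suitable_integrable[OF assms(1)]])
     (rule S_kernel_integrable[OF _ assms(2)])

lemma PM_entry:
  assumes "suitable S F" "0 \<le> t"
  shows "Re (PM t F z $ i $ j) = P t (\<lambda>y. Re (F y $ i $ j)) z" "Im (PM t F z $ i $ j) = P t (\<lambda>y. Im (F y $ i $ j)) z"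
  using PM_linear[OF assms bounded_linear_entry(1)] PM_linear[OF assms bounded_linear_entry(2)] by simp_all

lemma suitable_PM: "suitable S F \<Longrightarrow> 0 \<le> t \<Longrightarrow> suitable S (PM t F)"
  unfolding suitable_def by (simp add: PM_entry suitable_def)

lemma LM_tendsto:
  fixes F :: "'a \<Rightarrow> complex^'n^'n"
  assumes F: "suitable S F"
  shows "((\<lambda>t. difference_quotient \<kappa> t F z) \<longlongrightarrow> LM F z) (at_right 0)"
proof -
  let ?s = "\<lambda>t. \<Sum>i\<in>UNIV. \<Sum>j\<in>UNIV. DQ t (\<lambda>y. Re (F y $ i $ j)) z *\<^sub>R (axis i (axis j 1) :: complex^'n^'n)
      + DQ t (\<lambda>y. Im (F y $ i $ j)) z *\<^sub>R axis i (axis j \<i>)"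
  define l where "l = (\<Sum>i\<in>UNIV. \<Sum>j\<in>UNIV. L (\<lambda>y. Re (F y $ i $ j)) z *\<^sub>R (axis i (axis j 1) :: complex^'n^'n)
      + L (\<lambda>y. Im (F y $ i $ j)) z *\<^sub>R axis i (axis j \<i>))"
  have l: "(?s \<longlongrightarrow> l) (at_right 0)"
    unfolding l_def using suitable_entry[OF F]
    by (intro tendsto_sum tendsto_add tendsto_scaleR tendsto_const L_tendsto)
  have "\<forall>\<^sub>F t in at_right 0. ?s t = difference_quotient \<kappa> t F z"
    using at_right_0_nonneg
  proof eventually_elim
    case (elim t)
    have "Re (difference_quotient \<kappa> t F z $ i $ j) = DQ t (\<lambda>y. Re (F y $ i $ j)) z"
      "Im (difference_quotient \<kappa> t F z $ i $ j) = DQ t (\<lambda>y. Im (F y $ i $ j)) z" for i j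
      by (simp_all add: difference_quotient_def PM_entry[OF F elim])
    then show ?case by (subst (2) matrix_basis_expansion) (simp only:)
  qed
  from Lim_transform_eventually[OF l this]
  have "((\<lambda>t. difference_quotient \<kappa> t F z) \<longlongrightarrow> l) (at_right 0)" .
  then show ?thesis unfolding generator_def by (metis tendsto_Lim trivial_limit_at_right_real)
qed

lemma LM_linear:
  fixes T :: "complex^'n^'n \<Rightarrow> 'b::{banach, second_countable_topology}"
  assumes F: "suitable S F" and T: "bounded_linear T"
  shows "generator \<kappa> (\<lambda>y. T (F y)) z = T (LM F z)"
proof -
  interpret bounded_linear T by fact
  have "((\<lambda>t. T (difference_quotient \<kappa> t F z)) \<longlongrightarrow> T (LM F z)) (at_right 0)"
    by (intro tendsto LM_tendsto F)
  moreover have "\<forall>\<^sub>F t in at_right 0. T (difference_quotient \<kappa> t F z) = difference_quotient \<kappa> t (\<lambda>y. T (F y)) z"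
    using at_right_0_nonneg
    by eventually_elim (simp add: difference_quotient_def PM_linear[OF F _ T] scaleR diff)
  ultimately have "((\<lambda>t. difference_quotient \<kappa> t (\<lambda>y. T (F y)) z) \<longlongrightarrow> T (LM F z)) (at_right 0)"
    by (rule Lim_transform_eventually)
  then show ?thesis unfolding generator_def by (intro tendsto_Lim) auto
qed

lemma LM_entry:
  assumes "suitable S F"
  shows "Re (LM F z $ i $ j) = L (\<lambda>y. Re (F y $ i $ j)) z" "Im (LM F z $ i $ j) = L (\<lambda>y. Im (F y $ i $ j)) z"
  using LM_linear[OF assms bounded_linear_entry(1)] LM_linear[OF assms bounded_linear_entry(2)] by simp_all

lemma suitable_LM: "suitable S F \<Longrightarrow> suitable S (LM F)"
  unfolding suitable_def by (simp add: LM_entry suitable_def)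

lemma LM_diff:
  assumes F: "suitable S F" and G: "suitable S G"
  shows "LM (\<lambda>y. F y - G y) z = LM F z - LM G z"
proof -
  have "((\<lambda>t. difference_quotient \<kappa> t F z - difference_quotient \<kappa> t G z) \<longlongrightarrow> LM F z - LM G z) (at_right 0)"
    by (intro tendsto_diff LM_tendsto F G)
  moreover have "\<forall>\<^sub>F t in at_right 0. difference_quotient \<kappa> t F z - difference_quotient \<kappa> t G z
      = difference_quotient \<kappa> t (\<lambda>y. F y - G y) z"
    using at_right_0_nonneg
  proof eventually_elim
    case (elim t)
    have "PM t (\<lambda>y. F y - G y) z = PM t F z - PM t G z"
      unfolding semigroup_op_def
      by (intro Bochner_Integration.integral_diff suitable_integrable F G S_kernel_integrable elim)
    then show ?case by (simp add: difference_quotient_def scaleR_diff_right)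
  qed
  ultimately have "((\<lambda>t. difference_quotient \<kappa> t (\<lambda>y. F y - G y) z) \<longlongrightarrow> LM F z - LM G z) (at_right 0)"
    by (rule Lim_transform_eventually)
  then show ?thesis unfolding generator_def[of \<kappa> "\<lambda>y. F y - G y"] by (intro tendsto_Lim) auto
qed

lemma LM_const: "LM (\<lambda>y. A) z = 0"
proof -
  have "\<forall>\<^sub>F t in at_right 0. difference_quotient \<kappa> t (\<lambda>y. A) z = 0"
    using at_right_0_nonneg
    by eventually_elim (simp add: difference_quotient_def semigroup_op_def prob_space.prob_space[OF prob_kernel])
  then show ?thesis
    unfolding generator_def by (intro tendsto_Lim tendsto_eventually) auto
qed

lemma hermitian_PM:
  assumes "suitable S F" "0 \<le> t" "\<And>z. cmat_hermitian (F z)"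
  shows "cmat_hermitian (PM t F z)"
proof -
  have "(\<lambda>y. cmat_adjoint (F y)) = F" using assms(3) by (simp add: cmat_hermitian_def)
  then show ?thesis
    unfolding cmat_hermitian_def PM_linear[OF assms(1,2) bounded_linear_cmat_adjoint, symmetric] by (simp only:)
qed

lemma psd_PM:
  assumes F: "suitable S F" and t: "0 \<le> t" and psd: "\<And>z. cmat_psd (F z)"
  shows "cmat_psd (PM t F z)"
  unfolding cmat_psd_def
proof (intro conjI allI hermitian_PM F t)
  show "cmat_hermitian (F z)" for z using psd by (simp add: cmat_psd_def)
  fix x
  have "0 \<le> P t (\<lambda>y. Re (\<Sum>i\<in>UNIV. cnj (x $ i) * (F y *v x) $ i)) z"
    unfolding semigroup_op_def by (rule Bochner_Integration.integral_nonneg) (use psd in \<open>simp add: cmat_psd_def\<close>)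
  then show "0 \<le> Re (\<Sum>i\<in>UNIV. cnj (x $ i) * (PM t F z *v x) $ i)"
    by (simp only: PM_linear[OF F t bounded_linear_quadratic_form])
qed

lemma hermitian_LM:
  assumes "suitable S F" "\<And>z. cmat_hermitian (F z)"
  shows "cmat_hermitian (LM F z)"
proof -
  have "(\<lambda>y. cmat_adjoint (F y)) = F" using assms(2) by (simp add: cmat_hermitian_def)
  then show ?thesis
    unfolding cmat_hermitian_def LM_linear[OF assms(1) bounded_linear_cmat_adjoint, symmetric] by (simp only:)
qed

lemma suitable_carre: "suitable S F \<Longrightarrow> suitable S G \<Longrightarrow> suitable S (\<Gamma> F G)"
  unfolding carre_du_champ_def[abs_def]
  by (intro suitable_scaleR suitable_diff suitable_LM suitable_mult)

lemma hermitian_carre: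
  assumes F: "suitable S F" "\<And>z. cmat_hermitian (F z)"
  shows "cmat_hermitian (\<Gamma> F F z)"
proof -
  have adj: "cmat_adjoint (F y) = F y" for y using F(2) by (simp add: cmat_hermitian_def)
  have "cmat_hermitian (LM (\<lambda>y. F y ** F y) z)"
    by (rule hermitian_LM) (use F adj in \<open>auto intro: suitable_mult simp: cmat_hermitian_def cmat_adjoint_mult\<close>)
  moreover have "cmat_hermitian (LM F z)" by (rule hermitian_LM[OF F])
  ultimately show ?thesis
    by (simp add: cmat_hermitian_def carre_du_champ_def cmat_adjoint_scaleR cmat_adjoint_diff cmat_adjoint_mult adj)
qed

text \<open>The generator kills constants and commutes with multiplication by them, so all terms that contain \<open>A\<close>
  cancel.\<close>

lemma carre_shift:
  assumes F: "suitable S F"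
  shows "\<Gamma> (\<lambda>y. F y - A) (\<lambda>y. F y - A) z = \<Gamma> F F z"
proof -
  have L1: "LM (\<lambda>y. F y - A) z = LM F z"
    using LM_diff[OF F suitable_const[of A]] by (simp add: LM_const)
  have FF: "suitable S (\<lambda>y. F y ** F y)" "suitable S (\<lambda>y. A ** F y)" "suitable S (\<lambda>y. F y ** A)"
    using F by (auto intro: suitable_mult suitable_const)
  have "(\<lambda>y. (F y - A) ** (F y - A)) = (\<lambda>y. (F y ** F y - A ** F y) - (F y ** A - A ** A))"
    by (simp add: matrix_distribs fun_eq_iff)
  then have "LM (\<lambda>y. (F y - A) ** (F y - A)) z = LM (\<lambda>y. F y ** F y) z - A ** LM F z - LM F z ** A"
    using FF by (simp add: LM_diff suitable_diff suitable_const LM_const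
        LM_linear[OF F bounded_linear_mult_left] LM_linear[OF F bounded_linear_mult_right])
  then show ?thesis by (simp add: carre_du_champ_def L1 matrix_distribs)
qed

lemma carre_uminus:
  assumes F: "suitable S F"
  shows "\<Gamma> (\<lambda>y. - F y) (\<lambda>y. - F y) z = \<Gamma> F F z"
proof -
  have "LM (\<lambda>y. - F y) z = - LM F z"
    by (rule LM_linear[OF F]) (intro bounded_linear_minus bounded_linear_ident)
  moreover have "(- A) ** B = - (A ** B)" "A ** (- B) = - (A ** B)" for A B :: "complex^'b^'b"
    using matrix_scaleR_left[of "-1" A B] matrix_scaleR_right[of A "-1" B] by simp_all
  ultimately show ?thesis by (simp add: carre_du_champ_def)
qed

lemma carre_scaleR:
  assumes F: "suitable S F"
  shows "\<Gamma> (\<lambda>y. r *\<^sub>R F y) (\<lambda>y. r *\<^sub>R F y) z = r\<^sup>2 *\<^sub>R \<Gamma> F F z"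
proof -
  have "LM (\<lambda>y. r *\<^sub>R F y) z = r *\<^sub>R LM F z"
    by (rule LM_linear[OF F bounded_linear_scaleR_right])
  moreover have "LM (\<lambda>y. (r *\<^sub>R F y) ** (r *\<^sub>R F y)) z = r\<^sup>2 *\<^sub>R LM (\<lambda>y. F y ** F y) z"
    using LM_linear[OF suitable_mult[OF F F] bounded_linear_scaleR_right, of "r\<^sup>2"]
    by (simp add: matrix_distribs power2_eq_square)
  ultimately show ?thesis
    by (simp add: carre_du_champ_def matrix_distribs power2_eq_square algebra_simps)
qed

text \<open>All estimates are made after integrating against a matrix-valued test function; these are the two
  pairings that occur.\<close>

definition tr2 :: "('a \<Rightarrow> complex^'n^'n) \<Rightarrow> ('a \<Rightarrow> complex^'n^'n) \<Rightarrow> real" where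
  "tr2 F G = E (\<lambda>z. retr (F z ** G z))"

definition tr3 :: "('a \<Rightarrow> complex^'n^'n) \<Rightarrow> ('a \<Rightarrow> complex^'n^'n) \<Rightarrow> ('a \<Rightarrow> complex^'n^'n) \<Rightarrow> real" where
  "tr3 F G H = E (\<lambda>z. retr (F z ** G z ** H z))"

lemma S_retr: "suitable S F \<Longrightarrow> (\<lambda>z. retr (F z)) \<in> S"
  by (rule suitable_linear_real[OF _ bounded_linear_retr])

lemma tr2_entries:
  assumes F: "suitable S F" and G: "suitable S G"
  shows "tr2 F G = (\<Sum>i\<in>UNIV. \<Sum>j\<in>UNIV. E (\<lambda>z. Re (F z $ i $ j) * Re (G z $ j $ i))
      - E (\<lambda>z. Im (F z $ i $ j) * Im (G z $ j $ i)))"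
  unfolding tr2_def retr_mult_entries
  using suitable_entry[OF F] suitable_entry[OF G]
  by (subst E_sum, simp)+ (intro sum.cong refl E_diff, simp_all)

lemma tr3_entries:
  assumes F: "suitable S F" and G: "suitable S G" and H: "suitable S H"
  shows "tr3 F G H = (\<Sum>i\<in>UNIV. \<Sum>j\<in>UNIV. \<Sum>k\<in>UNIV.
      E (\<lambda>z. Re (F z $ i $ k) * (Re (G z $ k $ j) * Re (H z $ j $ i)))
    - E (\<lambda>z. Re (F z $ i $ k) * (Im (G z $ k $ j) * Im (H z $ j $ i)))
    - E (\<lambda>z. Im (F z $ i $ k) * (Re (G z $ k $ j) * Im (H z $ j $ i)))
    - E (\<lambda>z. Im (F z $ i $ k) * (Im (G z $ k $ j) * Re (H z $ j $ i))))"
  unfolding tr3_def retr_mult3_entries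
  using suitable_entry[OF F] suitable_entry[OF G] suitable_entry[OF H]
  by (simp add: E_sum E_diff)

lemma tr2_PM_symmetric:
  assumes F: "suitable S F" and G: "suitable S G" and t: "0 \<le> t"
  shows "tr2 (PM t F) G = tr2 F (PM t G)"
  using suitable_entry[OF F] suitable_entry[OF G] t
  by (simp add: tr2_entries suitable_PM F G PM_entry E_P_symmetric)

lemma tr2_LM_symmetric:
  assumes F: "suitable S F" and G: "suitable S G"
  shows "tr2 (LM F) G = tr2 F (LM G)"
  using suitable_entry[OF F] suitable_entry[OF G]
  by (simp add: tr2_entries suitable_LM F G LM_entry E_L_symmetric)

lemma tr2_LM_PM:
  assumes F: "suitable S F" and G: "suitable S G" and t: "0 \<le> t"
  shows "tr2 (LM (PM t F)) G = tr2 (PM t (LM F)) G"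
proof -
  have "tr2 (LM (PM t F)) G = (\<Sum>i\<in>UNIV. \<Sum>j\<in>UNIV. E (\<lambda>z. L (P t (\<lambda>y. Re (F y $ i $ j))) z * Re (G z $ j $ i))
      - E (\<lambda>z. L (P t (\<lambda>y. Im (F y $ i $ j))) z * Im (G z $ j $ i)))"
    using F G t by (simp add: tr2_entries suitable_LM suitable_PM LM_entry PM_entry[OF F t, abs_def])
  also have "\<dots> = tr2 (PM t (LM F)) G"
    using suitable_entry[OF F] suitable_entry[OF G] t
    by (simp add: tr2_entries suitable_LM suitable_PM F G PM_entry LM_entry E_L_P)
  finally show ?thesis .
qed

lemma tr2_PM_has_derivative:
  assumes F: "suitable S F" and G: "suitable S G" and r: "0 \<le> r"
  shows "((\<lambda>t. tr2 (PM t F) G) has_real_derivative tr2 (PM r (LM F)) G) (at r within {0..})"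
proof -
  let ?g = "\<lambda>t. \<Sum>i\<in>UNIV. \<Sum>j\<in>UNIV. E (\<lambda>z. P t (\<lambda>y. Re (F y $ i $ j)) z * Re (G z $ j $ i))
      - E (\<lambda>z. P t (\<lambda>y. Im (F y $ i $ j)) z * Im (G z $ j $ i))"
  have "(?g has_real_derivative tr2 (PM r (LM F)) G) (at r within {0..})"
    unfolding tr2_entries[OF suitable_PM[OF suitable_LM[OF F] r] G] PM_entry[OF suitable_LM[OF F] r] LM_entry[OF F]
    using suitable_entry[OF F] suitable_entry[OF G] r
    by (intro DERIV_sum DERIV_diff E_P_has_derivative)
  then show ?thesis
    by (rule has_field_derivative_transform_within[where d=1])
       (use r in \<open>auto simp: tr2_entries suitable_PM F G PM_entry\<close>)
qed

lemma tr2_PM_tendsto_at_top: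
  assumes F: "suitable S F" and G: "suitable S G" and F0: "(\<integral>z. F z \<partial>\<mu>) = 0"
  shows "((\<lambda>t. tr2 (PM t F) G) \<longlongrightarrow> 0) at_top"
proof -
  have int: "integrable \<mu> F" by (rule suitable_integrable[OF F S_integrable])
  have E0: "E (\<lambda>z. Re (F z $ i $ j)) = 0" "E (\<lambda>z. Im (F z $ i $ j)) = 0" for i j
    using integral_bounded_linear[OF bounded_linear_entry(1) int, of i j]
      integral_bounded_linear[OF bounded_linear_entry(2) int, of i j] F0 by simp_all
  let ?g = "\<lambda>t. \<Sum>i\<in>UNIV. \<Sum>j\<in>UNIV. E (\<lambda>z. P t (\<lambda>y. Re (F y $ i $ j)) z * Re (G z $ j $ i))
      - E (\<lambda>z. P t (\<lambda>y. Im (F y $ i $ j)) z * Im (G z $ j $ i))"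
  have "(?g \<longlongrightarrow> (\<Sum>i\<in>UNIV. \<Sum>j\<in>UNIV. E (\<lambda>z. Re (F z $ i $ j)) * E (\<lambda>z. Re (G z $ j $ i))
      - E (\<lambda>z. Im (F z $ i $ j)) * E (\<lambda>z. Im (G z $ j $ i)))) at_top"
    using suitable_entry[OF F] suitable_entry[OF G]
    by (intro tendsto_sum tendsto_diff E_P_tendsto_at_top)
  then have "(?g \<longlongrightarrow> 0) at_top" by (simp add: E0)
  moreover have "\<forall>\<^sub>F t in at_top. ?g t = tr2 (PM t F) G"
    using eventually_ge_at_top[of "0::real"]
    by eventually_elim (simp add: tr2_entries suitable_PM F G PM_entry)
  ultimately show ?thesis by (rule Lim_transform_eventually)
qed

lemma tr3_has_derivative:
  assumes F: "suitable S F" and G: "suitable S G" and H: "suitable S H" and s: "s \<in> {0..t}"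
  shows "((\<lambda>s. tr3 (PM s F) (PM s G) (PM (t - s) H)) has_real_derivative
    tr3 (PM s (LM F)) (PM s G) (PM (t - s) H) + tr3 (PM s F) (PM s (LM G)) (PM (t - s) H)
      - tr3 (PM s F) (PM s G) (PM (t - s) (LM H))) (at s within {0..t})"
proof -
  let ?T = "\<lambda>F G H r. (\<Sum>i\<in>UNIV. \<Sum>j\<in>UNIV. \<Sum>k\<in>UNIV.
      triple (\<lambda>y. Re (F y $ i $ k)) (\<lambda>y. Re (G y $ k $ j)) (\<lambda>y. Re (H y $ j $ i)) r r (t - r)
    - triple (\<lambda>y. Re (F y $ i $ k)) (\<lambda>y. Im (G y $ k $ j)) (\<lambda>y. Im (H y $ j $ i)) r r (t - r)
    - triple (\<lambda>y. Im (F y $ i $ k)) (\<lambda>y. Re (G y $ k $ j)) (\<lambda>y. Im (H y $ j $ i)) r r (t - r)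
    - triple (\<lambda>y. Im (F y $ i $ k)) (\<lambda>y. Im (G y $ k $ j)) (\<lambda>y. Re (H y $ j $ i)) r r (t - r))"
  have T: "tr3 (PM r F) (PM r G) (PM (t - r) H) = ?T F G H r"
    if "suitable S F" "suitable S G" "suitable S H" "r \<in> {0..t}" for F G H :: "'a \<Rightarrow> complex^'b^'b" and r
    using that by (simp add: tr3_entries suitable_PM PM_entry triple_def)
  let ?D = "\<lambda>a b c. triple (L a) b c s s (t - s) + triple a (L b) c s s (t - s) - triple a b (L c) s s (t - s)"
  have "(?T F G H has_real_derivative (\<Sum>i\<in>UNIV. \<Sum>j\<in>UNIV. \<Sum>k\<in>UNIV.
      ?D (\<lambda>y. Re (F y $ i $ k)) (\<lambda>y. Re (G y $ k $ j)) (\<lambda>y. Re (H y $ j $ i))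
    - ?D (\<lambda>y. Re (F y $ i $ k)) (\<lambda>y. Im (G y $ k $ j)) (\<lambda>y. Im (H y $ j $ i))
    - ?D (\<lambda>y. Im (F y $ i $ k)) (\<lambda>y. Re (G y $ k $ j)) (\<lambda>y. Im (H y $ j $ i))
    - ?D (\<lambda>y. Im (F y $ i $ k)) (\<lambda>y. Im (G y $ k $ j)) (\<lambda>y. Re (H y $ j $ i)))) (at s within {0..t})"
    using suitable_entry[OF F] suitable_entry[OF G] suitable_entry[OF H]
    by (intro DERIV_sum DERIV_diff triple_diagonal_has_derivative s) auto
  also have "(\<Sum>i\<in>UNIV. \<Sum>j\<in>UNIV. \<Sum>k\<in>UNIV.
      ?D (\<lambda>y. Re (F y $ i $ k)) (\<lambda>y. Re (G y $ k $ j)) (\<lambda>y. Re (H y $ j $ i))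
    - ?D (\<lambda>y. Re (F y $ i $ k)) (\<lambda>y. Im (G y $ k $ j)) (\<lambda>y. Im (H y $ j $ i))
    - ?D (\<lambda>y. Im (F y $ i $ k)) (\<lambda>y. Re (G y $ k $ j)) (\<lambda>y. Im (H y $ j $ i))
    - ?D (\<lambda>y. Im (F y $ i $ k)) (\<lambda>y. Im (G y $ k $ j)) (\<lambda>y. Re (H y $ j $ i)))
    = ?T (LM F) G H s + ?T F (LM G) H s - ?T F G (LM H) s"
    unfolding LM_entry[OF F] LM_entry[OF G] LM_entry[OF H] sum.distrib[symmetric] sum_subtractf[symmetric]
    by (intro sum.cong refl) linarith
  finally have "(?T F G H has_real_derivative
      ?T (LM F) G H s + ?T F (LM G) H s - ?T F G (LM H) s) (at s within {0..t})" .
  then have "(?T F G H has_real_derivative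
      tr3 (PM s (LM F)) (PM s G) (PM (t - s) H) + tr3 (PM s F) (PM s (LM G)) (PM (t - s) H)
      - tr3 (PM s F) (PM s G) (PM (t - s) (LM H))) (at s within {0..t})"
    by (simp only: T[OF suitable_LM[OF F] G H s] T[OF F suitable_LM[OF G] H s] T[OF F G suitable_LM[OF H] s])
  then show ?thesis
    by (rule has_field_derivative_transform_within[where d=1])
       (use s T[OF F G H] in auto)
qed

section \<open>Decay of the carre du champ\<close>

lemma tr2_diff_left:
  assumes "suitable S F" "suitable S G" "suitable S H"
  shows "tr2 (\<lambda>z. F z - G z) H = tr2 F H - tr2 G H"
  using assms unfolding tr2_def by (simp add: matrix_distribs retr_diff E_diff S_retr suitable_mult)

lemma tr2_scaleR_left: "tr2 (\<lambda>z. r *\<^sub>R F z) H = r * tr2 F H"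
  unfolding tr2_def by (simp add: matrix_distribs retr_scaleR)

lemma tr2_commute: "tr2 F G = tr2 G F"
  unfolding tr2_def by (subst retr_mult_commute) simp

lemma tr2_mult: "tr2 (\<lambda>z. F z ** G z) H = tr3 F G H"
  by (simp add: tr2_def tr3_def)

text \<open>With the generator moved from the product to the test function, the carre du champ becomes a
  trilinear expression in functions that evolve under the semigroup.\<close>

lemma tr2_carre:
  assumes "suitable S F" "suitable S G" "suitable S H"
  shows "tr2 (\<Gamma> F G) H = (tr3 F G (LM H) - tr3 F (LM G) H - tr3 (LM F) G H) / 2"
proof -
  have "tr2 (\<Gamma> F G) H = 1 / 2 * tr2 (\<lambda>z. LM (\<lambda>y. F y ** G y) z - F z ** LM G z - LM F z ** G z) H"
    unfolding carre_du_champ_def[abs_def] by (rule tr2_scaleR_left)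
  also have "tr2 (\<lambda>z. LM (\<lambda>y. F y ** G y) z - F z ** LM G z - LM F z ** G z) H
      = tr2 (LM (\<lambda>y. F y ** G y)) H - tr3 F (LM G) H - tr3 (LM F) G H"
    using assms by (simp add: tr2_diff_left suitable_diff suitable_mult suitable_LM tr2_mult)
  also have "tr2 (LM (\<lambda>y. F y ** G y)) H = tr3 F G (LM H)"
    using assms by (simp add: tr2_LM_symmetric suitable_mult tr2_mult)
  finally show ?thesis by simp
qed

lemma tr2_carre2:
  assumes "suitable S F" "suitable S H"
  shows "tr2 (\<Gamma>2 F F) H = (tr2 (\<Gamma> F F) (LM H) - tr2 (\<Gamma> F (LM F)) H - tr2 (\<Gamma> (LM F) F) H) / 2"
proof -
  have "tr2 (\<Gamma>2 F F) H = 1 / 2 * tr2 (\<lambda>z. LM (\<Gamma> F F) z - \<Gamma> F (LM F) z - \<Gamma> (LM F) F z) H"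
    unfolding carre_du_champ2_def[abs_def] by (rule tr2_scaleR_left)
  also have "tr2 (\<lambda>z. LM (\<Gamma> F F) z - \<Gamma> F (LM F) z - \<Gamma> (LM F) F z) H
      = tr2 (LM (\<Gamma> F F)) H - tr2 (\<Gamma> F (LM F)) H - tr2 (\<Gamma> (LM F) F) H"
    using assms by (simp add: tr2_diff_left suitable_diff suitable_carre suitable_LM)
  also have "tr2 (LM (\<Gamma> F F)) H = tr2 (\<Gamma> F F) (LM H)"
    using assms by (simp add: tr2_LM_symmetric suitable_carre)
  finally show ?thesis by simp
qed

text \<open>The generator is defined pointwise from the kernels, which may charge null sets of \<open>\<mu>\<close>. It respects
  equality almost everywhere because it is symmetric.\<close>

lemma L_cong_AE:
  assumes a: "a \<in> S" and b: "b \<in> S" and ab: "AE z in \<mu>. a z = b z"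
  shows "AE z in \<mu>. L a z = L b z"
proof -
  let ?d = "\<lambda>z. L a z - L b z"
  have d: "?d \<in> S" using a b by simp
  have "E (\<lambda>z. a z * L ?d z) = E (\<lambda>z. b z * L ?d z)"
    using a b d ab by (intro integral_cong_AE) (auto intro!: borel_measurable_integrable[OF S_integrable])
  then have "E (\<lambda>z. ?d z * ?d z) = 0"
    using a b d E_L_symmetric[OF a d] E_L_symmetric[OF b d]
    by (subst left_diff_distrib) (simp add: E_diff)
  then have "AE z in \<mu>. ?d z * ?d z = 0"
    using d by (subst (asm) integral_nonneg_eq_0_iff_AE) (auto intro!: S_integrable)
  then show ?thesis by eventually_elim simp
qed

lemma AE_matrix_eqI:
  assumes "\<And>i j. AE z in \<mu>. Re (F z $ i $ j) = Re (G z $ i $ j)" "\<And>i j. AE z in \<mu>. Im (F z $ i $ j) = Im (G z $ i $ j)"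
  shows "AE z in \<mu>. F z = (G z :: complex^'n^'n)"
proof -
  have "AE z in \<mu>. \<forall>i j. Re (F z $ i $ j) = Re (G z $ i $ j) \<and> Im (F z $ i $ j) = Im (G z $ i $ j)"
    using assms by (auto simp: AE_all_countable intro!: AE_conjI)
  then show ?thesis by eventually_elim (simp add: vec_eq_iff complex_eq_iff)
qed

lemma LM_cong_AE:
  assumes F: "suitable S F" and G: "suitable S G" and FG: "AE z in \<mu>. F z = G z"
  shows "AE z in \<mu>. LM F z = LM G z"
proof (rule AE_matrix_eqI)
  show "AE z in \<mu>. Re (LM F z $ i $ j) = Re (LM G z $ i $ j)" for i j
    unfolding LM_entry[OF F] LM_entry[OF G]
    by (intro L_cong_AE suitable_entry F G) (use FG in \<open>eventually_elim, simp\<close>)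
  show "AE z in \<mu>. Im (LM F z $ i $ j) = Im (LM G z $ i $ j)" for i j
    unfolding LM_entry[OF F] LM_entry[OF G]
    by (intro L_cong_AE suitable_entry F G) (use FG in \<open>eventually_elim, simp\<close>)
qed

lemma LM_PM_commute_AE:
  assumes F: "suitable S F" and t: "0 \<le> t"
  shows "AE z in \<mu>. LM (PM t F) z = PM t (LM F) z"
proof (rule AE_matrix_eqI)
  show "AE z in \<mu>. Re (LM (PM t F) z $ i $ j) = Re (PM t (LM F) z $ i $ j)" for i j
    unfolding LM_entry[OF suitable_PM[OF F t]] PM_entry[OF suitable_LM[OF F] t] PM_entry[OF F t] LM_entry[OF F]
    by (intro L_P_commute_AE suitable_entry F t)
  show "AE z in \<mu>. Im (LM (PM t F) z $ i $ j) = Im (PM t (LM F) z $ i $ j)" for i j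
    unfolding LM_entry[OF suitable_PM[OF F t]] PM_entry[OF suitable_LM[OF F] t] PM_entry[OF F t] LM_entry[OF F]
    by (intro L_P_commute_AE suitable_entry F t)
qed

lemma LM_LM_PM_commute_AE:
  assumes F: "suitable S F" and t: "0 \<le> t"
  shows "AE z in \<mu>. LM (LM (PM t F)) z = PM t (LM (LM F)) z"
proof -
  have "AE z in \<mu>. LM (LM (PM t F)) z = LM (PM t (LM F)) z"
    by (intro LM_cong_AE LM_PM_commute_AE F t suitable_LM suitable_PM)
  moreover have "AE z in \<mu>. LM (PM t (LM F)) z = PM t (LM (LM F)) z"
    by (intro LM_PM_commute_AE F t suitable_LM)
  ultimately show ?thesis by eventually_elim simp
qed

lemma tr3_cong_AE:
  assumes "suitable S F" "suitable S G" "suitable S H" "suitable S F'" "suitable S G'" "suitable S H'"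
    "AE z in \<mu>. F z = F' z" "AE z in \<mu>. G z = G' z" "AE z in \<mu>. H z = H' z"
  shows "tr3 F G H = tr3 F' G' H'"
  unfolding tr3_def
proof (rule integral_cong_AE)
  show "AE z in \<mu>. retr (F z ** G z ** H z) = retr (F' z ** G' z ** H' z)"
    using assms(7-9) by eventually_elim simp
qed (use assms in \<open>auto intro!: borel_measurable_integrable[OF S_integrable] S_retr suitable_mult\<close>)

lemma PM_0: "suitable S F \<Longrightarrow> PM 0 F = F"
  using suitable_entry[of F] by (simp add: fun_eq_iff vec_eq_iff complex_eq_iff PM_entry P_0)

lemma PM_const: "0 \<le> t \<Longrightarrow> PM t (\<lambda>y. A) z = A"
  by (simp add: semigroup_op_def prob_space.prob_space[OF prob_kernel])

text \<open>The first-order terms of the three factors combine to \<open>E tr ((2 \<Gamma>(P_s F, L P_s F) - L \<Gamma>(P_s F)) P_{t-s} H)\<close>,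
  up to symmetrization; this is how the iterated carre du champ arises.\<close>

lemma carre_interpolation_has_derivative:
  fixes F H :: "'a \<Rightarrow> complex^'n^'n"
  assumes F: "suitable S F" and H: "suitable S H" and s: "s \<in> {0..t}"
  shows "((\<lambda>s. tr2 (\<Gamma> (PM s F) (PM s F)) (PM (t - s) H)) has_real_derivative
    - 2 * tr2 (\<Gamma>2 (PM s F) (PM s F)) (PM (t - s) H)) (at s within {0..t})"
proof -
  let ?t3 = "\<lambda>r A B C :: 'a \<Rightarrow> complex^'n^'n. tr3 (PM r A) (PM r B) (PM (t - r) C)"
  note [simp] = F H suitable_LM suitable_PM
  have J: "tr2 (\<Gamma> (PM r F) (PM r F)) (PM (t - r) H) = (?t3 r F F (LM H) - ?t3 r F (LM F) H - ?t3 r (LM F) F H) / 2"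
    if "r \<in> {0..t}" for r
  proof -
    have r: "0 \<le> r" "0 \<le> t - r" using that by auto
    have "tr3 (PM r F) (PM r F) (LM (PM (t - r) H)) = ?t3 r F F (LM H)"
      "tr3 (PM r F) (LM (PM r F)) (PM (t - r) H) = ?t3 r F (LM F) H"
      "tr3 (LM (PM r F)) (PM r F) (PM (t - r) H) = ?t3 r (LM F) F H"
      using r by (auto intro!: tr3_cong_AE LM_PM_commute_AE)
    then show ?thesis using r by (simp add: tr2_carre)
  qed
  let ?D = "\<lambda>A B C. ?t3 s (LM A) B C + ?t3 s A (LM B) C - ?t3 s A B (LM C)"
  have "((\<lambda>r. (?t3 r F F (LM H) - ?t3 r F (LM F) H - ?t3 r (LM F) F H) / 2) has_real_derivative
      (?D F F (LM H) - ?D F (LM F) H - ?D (LM F) F H) / 2) (at s within {0..t})"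
    by (intro DERIV_cdivide DERIV_diff tr3_has_derivative s) auto
  moreover have "(?D F F (LM H) - ?D F (LM F) H - ?D (LM F) F H) / 2
      = - 2 * tr2 (\<Gamma>2 (PM s F) (PM s F)) (PM (t - s) H)"
  proof -
    have r: "0 \<le> s" "0 \<le> t - s" using s by auto
    have eqs: "tr3 (PM s F) (PM s F) (LM (LM (PM (t - s) H))) = ?t3 s F F (LM (LM H))"
      "tr3 (PM s F) (LM (PM s F)) (LM (PM (t - s) H)) = ?t3 s F (LM F) (LM H)"
      "tr3 (LM (PM s F)) (PM s F) (LM (PM (t - s) H)) = ?t3 s (LM F) F (LM H)"
      "tr3 (PM s F) (LM (LM (PM s F))) (PM (t - s) H) = ?t3 s F (LM (LM F)) H"
      "tr3 (LM (PM s F)) (LM (PM s F)) (PM (t - s) H) = ?t3 s (LM F) (LM F) H"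
      "tr3 (LM (LM (PM s F))) (PM s F) (PM (t - s) H) = ?t3 s (LM (LM F)) F H"
      using r by (auto intro!: tr3_cong_AE LM_PM_commute_AE LM_LM_PM_commute_AE)
    show ?thesis using r by (simp add: tr2_carre2 tr2_carre eqs) (simp add: field_simps)
  qed
  ultimately have "((\<lambda>r. (?t3 r F F (LM H) - ?t3 r F (LM F) H - ?t3 r (LM F) F H) / 2) has_real_derivative
      - 2 * tr2 (\<Gamma>2 (PM s F) (PM s F)) (PM (t - s) H)) (at s within {0..t})" by simp
  then show ?thesis
    by (rule has_field_derivative_transform_within[where d=1]) (use s J in auto)
qed

section \<open>A chain rule inequality for the exponential\<close>

lemma P_retr_left:
  assumes "suitable S F" "0 \<le> t"
  shows "P t (\<lambda>y. retr (A ** F y)) z = retr (A ** PM t F z)"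
  by (rule PM_linear[OF assms]) (rule bounded_linear_compose[OF bounded_linear_retr bounded_linear_mult_left])

lemma P_retr:
  assumes "suitable S F" "0 \<le> t"
  shows "P t (\<lambda>y. retr (F y)) z = retr (PM t F z)"
  by (rule PM_linear[OF assms bounded_linear_retr])

text \<open>Half of the two-point expectation \<open>E tr ((X(Z_e) - X(Z_0))\<^sup>2 (G(Z_0) + G(Z_e)))\<close>, written with the
  semigroup; see the next lemma.\<close>

definition increment :: "real \<Rightarrow> ('a \<Rightarrow> complex^'n^'n) \<Rightarrow> ('a \<Rightarrow> complex^'n^'n) \<Rightarrow> real" where
  "increment e X G = tr2 (PM e (\<lambda>y. X y ** X y)) G - tr2 (PM e X) (\<lambda>y. G y ** X y)
     - tr2 (PM e X) (\<lambda>y. X y ** G y) + tr3 X X G"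

text \<open>By reversibility the law of the process at two times is exchangeable, so the weights \<open>G(Z_0)\<close> and
  \<open>G(Z_e)\<close> contribute equally.\<close>

lemma two_point_square:
  fixes X G :: "'a \<Rightarrow> complex^'n^'n"
  assumes X: "suitable S X" and G: "suitable S G" and e: "0 \<le> e"
  defines "h \<equiv> \<lambda>z. P e (\<lambda>y. retr ((X y - X z) ** (X y - X z) ** (G y + G z))) z"
  shows "h \<in> S" "E h = 2 * increment e X G"
proof -
  note [simp] = X G e suitable_mult suitable_PM S_retr
  have exp: "retr ((A - B) ** (A - B) ** (C + D)) = retr (A ** A ** C) - retr (B ** (A ** C)) - retr (B ** (C ** A))
      + retr ((B ** B) ** C) + retr (D ** (A ** A)) - retr ((B ** D) ** A) - retr ((D ** B) ** A) + retr (B ** B ** D)"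
    for A B C D :: "complex^'n^'n"
    using retr_cycle[of A B C] retr_cycle[of A A D] retr_cycle[of A B D] retr_cycle[of B A D] retr_cycle[of D A B]
      retr_cycle[of B D A] retr_cycle[of D B A] retr_cycle[of C A B] retr_cycle[of B C A]
    by (simp add: matrix_distribs retr_add retr_diff matrix_mul_assoc)
  have h: "h z = retr (PM e (\<lambda>y. X y ** X y ** G y) z) - retr (X z ** PM e (\<lambda>y. X y ** G y) z)
      - retr (X z ** PM e (\<lambda>y. G y ** X y) z) + retr (X z ** X z ** PM e G z)
      + retr (G z ** PM e (\<lambda>y. X y ** X y) z) - retr (X z ** G z ** PM e X z) - retr (G z ** X z ** PM e X z)
      + retr (X z ** X z ** G z)" for z
    unfolding h_def exp
    by (simp add: P_add P_diff P_retr[of "\<lambda>y. X y ** X y ** G y"] P_retr_left PM_const suitable_const)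
  show "h \<in> S" unfolding h[abs_def] by simp
  have "E h = E (\<lambda>z. retr (PM e (\<lambda>y. X y ** X y ** G y) z)) - tr2 X (PM e (\<lambda>y. X y ** G y))
      - tr2 X (PM e (\<lambda>y. G y ** X y)) + tr2 (\<lambda>z. X z ** X z) (PM e G)
      + tr2 G (PM e (\<lambda>y. X y ** X y)) - tr2 (\<lambda>z. X z ** G z) (PM e X) - tr2 (\<lambda>z. G z ** X z) (PM e X)
      + tr3 X X G"
    unfolding h[abs_def] tr2_def tr3_def by (simp add: E_add E_diff)
  also have "E (\<lambda>z. retr (PM e (\<lambda>y. X y ** X y ** G y) z)) = tr3 X X G"
  proof -
    have "(\<lambda>z. retr (PM e (\<lambda>y. X y ** X y ** G y) z)) = P e (\<lambda>y. retr (X y ** X y ** G y))"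
      by (simp add: P_retr fun_eq_iff)
    then show ?thesis by (simp add: E_P tr3_def)
  qed
  also have "tr2 X (PM e (\<lambda>y. X y ** G y)) = tr2 (PM e X) (\<lambda>y. X y ** G y)" by (simp add: tr2_PM_symmetric)
  also have "tr2 X (PM e (\<lambda>y. G y ** X y)) = tr2 (PM e X) (\<lambda>y. G y ** X y)" by (simp add: tr2_PM_symmetric)
  also have "tr2 (\<lambda>z. X z ** X z) (PM e G) = tr2 (PM e (\<lambda>y. X y ** X y)) G" by (simp add: tr2_PM_symmetric)
  also have "tr2 G (PM e (\<lambda>y. X y ** X y)) = tr2 (PM e (\<lambda>y. X y ** X y)) G" by (rule tr2_commute)
  also have "tr2 (\<lambda>z. X z ** G z) (PM e X) = tr2 (PM e X) (\<lambda>z. X z ** G z)" by (rule tr2_commute)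
  also have "tr2 (\<lambda>z. G z ** X z) (PM e X) = tr2 (PM e X) (\<lambda>z. G z ** X z)" by (rule tr2_commute)
  finally show "E h = 2 * increment e X G" by (simp add: increment_def)
qed

lemma two_point_product:
  fixes g G :: "'a \<Rightarrow> complex^'n^'n"
  assumes g: "suitable S g" and G: "suitable S G" and e: "0 \<le> e"
  defines "h \<equiv> \<lambda>z. P e (\<lambda>y. retr ((g y - g z) ** (G y - G z))) z"
  shows "h \<in> S" "E h = 2 * (tr2 g G - tr2 (PM e g) G)"
proof -
  note [simp] = g G e suitable_mult suitable_PM S_retr
  have exp: "retr ((A - B) ** (C - D)) = retr (A ** C) - retr (D ** A) - retr (B ** C) + retr (B ** D)"
    for A B C D :: "complex^'n^'n"
    using retr_mult_commute[of D A] by (simp add: matrix_distribs retr_diff)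
  have h: "h z = retr (PM e (\<lambda>y. g y ** G y) z) - retr (G z ** PM e g z) - retr (g z ** PM e G z) + retr (g z ** G z)" for z
    unfolding h_def exp
    by (simp add: P_add P_diff P_retr[of "\<lambda>y. g y ** G y"] P_retr_left PM_const suitable_const)
  show "h \<in> S" unfolding h[abs_def] by simp
  have "E h = E (\<lambda>z. retr (PM e (\<lambda>y. g y ** G y) z)) - tr2 G (PM e g) - tr2 g (PM e G) + tr2 g G"
    unfolding h[abs_def] tr2_def by (simp add: E_add E_diff)
  also have "E (\<lambda>z. retr (PM e (\<lambda>y. g y ** G y) z)) = tr2 g G"
  proof -
    have "(\<lambda>z. retr (PM e (\<lambda>y. g y ** G y) z)) = P e (\<lambda>y. retr (g y ** G y))"
      by (simp add: P_retr fun_eq_iff)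
    then show ?thesis by (simp add: E_P tr2_def)
  qed
  also have "tr2 g (PM e G) = tr2 (PM e g) G" by (simp add: tr2_PM_symmetric)
  also have "tr2 G (PM e g) = tr2 (PM e g) G" by (rule tr2_commute)
  finally show "E h = 2 * (tr2 g G - tr2 (PM e g) G)" by simp
qed

lemma increment_0: "suitable S X \<Longrightarrow> suitable S G \<Longrightarrow> increment 0 X G = 0"
proof -
  assume X: "suitable S X" and G: "suitable S G"
  have "tr2 X (\<lambda>y. G y ** X y) = tr3 X X G" "tr2 X (\<lambda>y. X y ** G y) = tr3 X X G"
    unfolding tr2_def tr3_def
    by (simp_all add: matrix_mul_assoc) (subst retr_cycle, simp)
  then show ?thesis using X G by (simp add: increment_def PM_0 suitable_mult tr2_mult)
qed

text \<open>The carre du champ is the infinitesimal mean square increment.\<close>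

lemma increment_has_derivative:
  assumes X: "suitable S X" and G: "suitable S G"
  shows "((\<lambda>e. increment e X G) has_real_derivative 2 * tr2 (\<Gamma> X X) G) (at 0 within {0..})"
proof -
  note [simp] = X G suitable_mult suitable_LM
  have D: "((\<lambda>e. tr2 (PM e F) K) has_real_derivative tr2 (LM F) K) (at 0 within {0..})"
    if "suitable S F" "suitable S K" for F K :: "'a \<Rightarrow> complex^'b^'b"
    using tr2_PM_has_derivative[OF that, of 0] by (simp add: PM_0 suitable_LM that)
  have "tr2 (LM X) (\<lambda>y. G y ** X y) = tr3 X (LM X) G" "tr2 (LM X) (\<lambda>y. X y ** G y) = tr3 (LM X) X G"
    unfolding tr2_def tr3_def by (simp_all add: matrix_mul_assoc) (subst retr_cycle, simp)
  moreover have "tr2 (LM (\<lambda>y. X y ** X y)) G = tr3 X X (LM G)"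
    by (simp add: tr2_LM_symmetric tr2_mult)
  ultimately have "2 * tr2 (\<Gamma> X X) G = tr2 (LM (\<lambda>y. X y ** X y)) G - tr2 (LM X) (\<lambda>y. G y ** X y)
      - tr2 (LM X) (\<lambda>y. X y ** G y) + 0"
    by (simp add: tr2_carre)
  then show ?thesis
    unfolding increment_def[abs_def] by (simp only:) (intro DERIV_add DERIV_diff D DERIV_const; simp)
qed

text \<open>For a transition of the process from \<open>z\<close> to \<open>y\<close> in time \<open>e\<close>, the trace mean value inequality compares
  the increments of \<open>g\<close>, \<open>X\<close> and \<open>exp X\<close>. Its expectation is an inequality between functions of \<open>e\<close> that
  vanish at \<open>e = 0\<close>, and hence one between their derivatives there.\<close>

lemma exponential_chain_rule:
  fixes g X :: "'a \<Rightarrow> complex^'n^'n"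
  assumes g: "suitable S g" "\<And>z. cmat_hermitian (g z)" and X: "suitable S X" "\<And>z. cmat_hermitian (X z)"
    and G: "suitable S (\<lambda>z. spectral_fun exp (X z))" and s: "0 < s"
  shows "- tr2 (LM g) (\<lambda>z. spectral_fun exp (X z))
    \<le> (s * tr2 (\<Gamma> X X) (\<lambda>z. spectral_fun exp (X z)) + 1 / s * tr2 (\<Gamma> g g) (\<lambda>z. spectral_fun exp (X z))) / 2"
proof -
  define G where "G = (\<lambda>z. spectral_fun exp (X z))"
  have G': "suitable S G" using assms(5) by (simp add: G_def)
  note [simp] = g(1) X(1) G' suitable_mult suitable_LM S_retr suitable_diff suitable_add suitable_const
  define h where "h e = 2 * s * increment e X G + 2 / s * increment e g G - 8 * (tr2 g G - tr2 (PM e g) G)" for e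
  have "0 \<le> 4 * s * tr2 (\<Gamma> X X) G + 4 / s * tr2 (\<Gamma> g g) G + 8 * tr2 (LM g) G"
  proof (rule derivative_nonneg_at_minimum)
    show "(h has_real_derivative 4 * s * tr2 (\<Gamma> X X) G + 4 / s * tr2 (\<Gamma> g g) G + 8 * tr2 (LM g) G) (at 0 within {0..})"
      unfolding h_def[abs_def]
      using increment_has_derivative[OF X(1) G'] increment_has_derivative[OF g(1) G']
        tr2_PM_has_derivative[OF g(1) G', of 0] s
      by (auto intro!: derivative_eq_intros simp: PM_0)
    have h0: "h 0 = 0" by (simp add: h_def increment_0 PM_0)
    fix e :: real assume e: "0 \<le> e"
    define a where "a = (\<lambda>z. P e (\<lambda>y. retr ((g y - g z) ** (G y - G z))) z)"
    define b where "b = (\<lambda>z. P e (\<lambda>y. retr ((X y - X z) ** (X y - X z) ** (G y + G z))) z)"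
    define d where "d = (\<lambda>z. P e (\<lambda>y. retr ((g y - g z) ** (g y - g z) ** (G y + G z))) z)"
    note A = two_point_product[OF g(1) G' e, folded a_def]
      and B = two_point_square[OF X(1) G' e, folded b_def] and D = two_point_square[OF g(1) G' e, folded d_def]
    have "4 * a z \<le> s * b z + 1 / s * d z" for z
    proof -
      have "P e (\<lambda>y. 4 * retr ((g y - g z) ** (G y - G z))) z
          \<le> P e (\<lambda>y. s * retr ((X y - X z) ** (X y - X z) ** (G y + G z))
            + 1 / s * retr ((g y - g z) ** (g y - g z) ** (G y + G z))) z"
      proof (rule P_mono)
        show "4 * retr ((g y - g z) ** (G y - G z)) \<le> s * retr ((X y - X z) ** (X y - X z) ** (G y + G z))
            + 1 / s * retr ((g y - g z) ** (g y - g z) ** (G y + G z))" for y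
          unfolding G_def by (intro trace_mean_value_inequality hermitian_diff g X s)
      qed (use e in \<open>auto intro!: S_add S_cmult simp del: times_divide_eq_left\<close>)
      also have "\<dots> = s * b z + 1 / s * d z"
        unfolding b_def d_def using e by (subst P_add) (auto simp: P_cmult simp del: times_divide_eq_left)
      finally show ?thesis by (simp add: a_def P_cmult)
    qed
    then have "E (\<lambda>z. 4 * a z) \<le> E (\<lambda>z. s * b z + 1 / s * d z)"
      using A(1) B(1) D(1) by (intro E_mono S_add S_cmult)
    also have "\<dots> = s * E b + 1 / s * E d"
      using B(1) D(1) by (subst E_add) (auto simp del: times_divide_eq_left)
    finally show "h 0 \<le> h e" unfolding h0 using A(2) B(2) D(2) by (simp add: h_def algebra_simps)
  qed
  then show ?thesis by (simp add: G_def field_simps)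
qed

end

section \<open>Exponential moments under the Bakry--Emery criterion\<close>

locale bakry_emery_semigroup = symmetric_semigroup \<kappa> \<mu> S
  for \<kappa> :: "real \<Rightarrow> 'a::polish_space \<Rightarrow> 'a measure" and \<mu> and S +
  fixes c :: real and f :: "'a \<Rightarrow> complex^'n^'n"
  assumes S_exp: "\<And>F :: 'a \<Rightarrow> complex^'n^'n. suitable S F \<Longrightarrow> (\<And>z. cmat_hermitian (F z)) \<Longrightarrow>
      suitable S (\<lambda>z. spectral_fun exp (F z))"
    and c_pos: "0 < c"
    and curvature: "\<And>F :: 'a \<Rightarrow> complex^'n^'n. suitable S F \<Longrightarrow> (\<And>z. cmat_hermitian (F z)) \<Longrightarrow>
      AE z in \<mu>. loewner_le (\<Gamma> F F z) (c *\<^sub>R \<Gamma>2 F F z)"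
    and f_suitable: "suitable S f" and f_hermitian: "\<And>z. cmat_hermitian (f z)"
    and f_mean: "(\<integral>z. f z \<partial>\<mu>) = 0"
begin

lemma suitable_carre2: "suitable S F \<Longrightarrow> suitable S (\<Gamma>2 F F)"
  unfolding carre_du_champ2_def[abs_def]
  by (intro suitable_scaleR suitable_diff suitable_LM suitable_carre)

text \<open>The criterion turns the derivative of the interpolation into the differential inequality
  \<open>J' \<le> - (2 / c) J\<close>.\<close>

lemma carre_decay:
  fixes F H :: "'a \<Rightarrow> complex^'n^'n"
  assumes F: "suitable S F" "\<And>z. cmat_hermitian (F z)" and H: "suitable S H" "\<And>z. cmat_psd (H z)" and t: "0 \<le> t"
  shows "tr2 (\<Gamma> (PM t F) (PM t F)) H \<le> exp (- 2 * t / c) * tr2 (\<Gamma> F F) (PM t H)"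
proof -
  define J where "J s = tr2 (\<Gamma> (PM s F) (PM s F)) (PM (t - s) H)" for s
  define J' where "J' s = - 2 * tr2 (\<Gamma>2 (PM s F) (PM s F)) (PM (t - s) H)" for s
  have "exp (2 * t / c) * J t \<le> exp (2 * 0 / c) * J 0"
  proof (rule nonincreasing_from_derivative_within[OF t])
    fix s assume s: "s \<in> {0..t}"
    have "(J has_real_derivative J' s) (at s within {0..t})"
      unfolding J_def[abs_def] J'_def by (rule carre_interpolation_has_derivative[OF F(1) H(1) s])
    then show "((\<lambda>s. exp (2 * s / c) * J s) has_real_derivative exp (2 * s / c) * (2 / c * J s + J' s))
        (at s within {0..t})"
      using c_pos by (auto intro!: derivative_eq_intros simp: algebra_simps)
    have s0: "0 \<le> s" "0 \<le> t - s" using s by auto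
    note P = suitable_PM[OF F(1) s0(1)] suitable_PM[OF H(1) s0(2)]
    have "AE z in \<mu>. loewner_le (\<Gamma> (PM s F) (PM s F) z) (c *\<^sub>R \<Gamma>2 (PM s F) (PM s F) z)"
      by (rule curvature[OF P(1)]) (rule hermitian_PM[OF F(1) s0(1) F(2)])
    then have "AE z in \<mu>. 0 \<le> retr ((c *\<^sub>R \<Gamma>2 (PM s F) (PM s F) z - \<Gamma> (PM s F) (PM s F) z) ** PM (t - s) H z)"
      unfolding loewner_le_def
      by eventually_elim (intro retr_mult_psd_nonneg psd_PM H s0)
    then have "0 \<le> tr2 (\<lambda>z. c *\<^sub>R \<Gamma>2 (PM s F) (PM s F) z - \<Gamma> (PM s F) (PM s F) z) (PM (t - s) H)"
      unfolding tr2_def by (rule integral_nonneg_AE)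
    also have "\<dots> = c * tr2 (\<Gamma>2 (PM s F) (PM s F)) (PM (t - s) H) - J s"
      using P by (simp add: tr2_diff_left tr2_scaleR_left suitable_scaleR suitable_carre suitable_carre2 J_def)
    finally have "2 / c * J s + J' s \<le> 0" using c_pos by (simp add: J'_def field_simps)
    then show "exp (2 * s / c) * (2 / c * J s + J' s) \<le> 0" by (simp add: mult_nonneg_nonpos)
  qed
  then have "exp (2 * t / c) * tr2 (\<Gamma> (PM t F) (PM t F)) H \<le> tr2 (\<Gamma> F F) (PM t H)"
    using F H by (simp add: J_def PM_0)
  then have "exp (- 2 * t / c) * (exp (2 * t / c) * tr2 (\<Gamma> (PM t F) (PM t F)) H)
      \<le> exp (- 2 * t / c) * tr2 (\<Gamma> F F) (PM t H)" by (intro mult_left_mono) auto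
  then show ?thesis by (simp add: mult.assoc[symmetric] exp_add[symmetric])
qed

definition tilt :: "real \<Rightarrow> 'a \<Rightarrow> complex^'n^'n" where
  "tilt r z = spectral_fun exp (r *\<^sub>R f z)"

definition mgf :: "real \<Rightarrow> real" where
  "mgf r = E (\<lambda>z. retr (tilt r z))"

lemma suitable_tilt: "suitable S (tilt r)"
  unfolding tilt_def[abs_def] by (intro S_exp suitable_scaleR f_suitable hermitian_scaleR f_hermitian)

lemma mgf_has_derivative: "(mgf has_real_derivative tr2 f (tilt r)) (at r)"
proof (rule has_real_derivative_quadratic[where e=1 and A=UNIV, simplified])
  fix y assume y: "\<bar>y - r\<bar> \<le> 1"
  define h where "h = y - r"
  note [simp] = S_retr suitable_tilt suitable_mult f_suitable
  have "\<bar>mgf (r + h) - mgf r - h * tr2 f (tilt r)\<bar>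
      = \<bar>E (\<lambda>z. retr (tilt (r + h) z) - retr (tilt r z) - h * retr (f z ** tilt r z))\<bar>"
    by (simp add: mgf_def tr2_def E_diff)
  also have "\<dots> \<le> E (\<lambda>z. \<bar>retr (tilt (r + h) z) - retr (tilt r z) - h * retr (f z ** tilt r z)\<bar>)"
    by (rule integral_abs_bound)
  also have "\<dots> \<le> E (\<lambda>z. h\<^sup>2 * (retr (tilt (r + 2) z) + 2 * retr (tilt r z) + retr (tilt (r - 2) z)))"
  proof (rule integral_mono)
    show "integrable \<mu> (\<lambda>z. \<bar>retr (tilt (r + h) z) - retr (tilt r z) - h * retr (f z ** tilt r z)\<bar>)"
      by (intro integrable_abs S_integrable) simp
    show "integrable \<mu> (\<lambda>z. h\<^sup>2 * (retr (tilt (r + 2) z) + 2 * retr (tilt r z) + retr (tilt (r - 2) z)))"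
      by (intro S_integrable) simp
    show "\<bar>retr (tilt (r + h) z) - retr (tilt r z) - h * retr (f z ** tilt r z)\<bar>
        \<le> h\<^sup>2 * (retr (tilt (r + 2) z) + 2 * retr (tilt r z) + retr (tilt (r - 2) z))" for z
      unfolding tilt_def using y by (intro retr_exp_taylor f_hermitian) (simp add: h_def)
  qed
  also have "\<dots> = (mgf (r + 2) + 2 * mgf r + mgf (r - 2)) * h\<^sup>2"
    by (simp add: mgf_def E_add mult.commute)
  finally show "\<bar>mgf y - mgf r - (y - r) * tr2 f (tilt r)\<bar> \<le> (mgf (r + 2) + 2 * mgf r + mgf (r - 2)) * (y - r)\<^sup>2"
    by (simp add: h_def)
qed

text \<open>Since \<open>exp x \<ge> 1 + x\<close> and \<open>f\<close> has mean zero.\<close>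

lemma mgf_ge: "real CARD('n) \<le> mgf r"
proof -
  note [simp] = S_retr suitable_tilt f_suitable
  have "E (\<lambda>z. retr (f z)) = retr (\<integral>z. f z \<partial>\<mu>)"
    by (rule integral_bounded_linear[OF bounded_linear_retr suitable_integrable[OF f_suitable S_integrable]])
  then have f0: "E (\<lambda>z. retr (f z)) = 0" by (simp add: f_mean)
  have "E (\<lambda>z. real CARD('n) + r * retr (f z)) \<le> mgf r"
    unfolding mgf_def
  proof (intro E_mono)
    show "real CARD('n) + r * retr (f z) \<le> retr (tilt r z)" for z
      using retr_exp_ge[OF hermitian_scaleR[OF f_hermitian]] by (simp add: tilt_def retr_scaleR)
  qed auto
  then show ?thesis by (simp add: E_add f0 mu.prob_space)
qed

lemma mgf_pos: "0 < mgf r"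
  using mgf_ge[of r] by (meson less_le_trans of_nat_0_less_iff zero_less_card_finite)

lemma mgf_0: "mgf 0 = real CARD('n)"
proof -
  have "retr (tilt 0 z) = real CARD('n)" for z
  proof -
    obtain U x where U: "cmat_unitary U" and fU: "f z = spectral_form U x"
      using hermitian_diagonalization[OF f_hermitian] .
    have "tilt 0 z = spectral_form U (\<lambda>i. exp (0 * x i))"
      unfolding tilt_def fU spectral_form_scaleR by (rule spectral_fun_eq[OF U])
    then show ?thesis by (simp add: retr_spectral_form[OF U])
  qed
  then show ?thesis by (simp add: mgf_def mu.prob_space)
qed

text \<open>The Gibbs variational principle, from Klein's inequality with the normalisation
  \<open>l = mgf r / R\<close>.\<close>

lemma entropy_inequality:
  fixes Y :: "'a \<Rightarrow> complex^'n^'n"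
  assumes Y: "suitable S Y" "\<And>z. cmat_hermitian (Y z)" and R: "0 < R"
    and YR: "E (\<lambda>z. retr (spectral_fun exp (b *\<^sub>R Y z))) \<le> R"
  shows "b * tr2 Y (tilt r) \<le> r * tr2 f (tilt r) - mgf r * ln (mgf r / R)"
proof -
  define l where "l = mgf r / R"
  have l: "0 < l" using mgf_pos R by (simp add: l_def)
  have eY: "suitable S (\<lambda>z. spectral_fun exp (b *\<^sub>R Y z))"
    by (intro S_exp suitable_scaleR hermitian_scaleR Y)
  note [simp] = S_retr suitable_tilt suitable_mult f_suitable Y(1) eY
  have "E (\<lambda>z. retr (tilt r z) - l * retr (spectral_fun exp (b *\<^sub>R Y z)))
      \<le> E (\<lambda>z. r * retr (f z ** tilt r z) - b * retr (Y z ** tilt r z) - ln l * retr (tilt r z))"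
  proof (intro E_mono)
    show "retr (tilt r z) - l * retr (spectral_fun exp (b *\<^sub>R Y z))
        \<le> r * retr (f z ** tilt r z) - b * retr (Y z ** tilt r z) - ln l * retr (tilt r z)" for z
      using klein_inequality[OF hermitian_scaleR[OF f_hermitian] hermitian_scaleR[OF Y(2)] l]
      by (simp add: tilt_def matrix_distribs retr_scaleR)
  qed auto
  then have "mgf r - l * E (\<lambda>z. retr (spectral_fun exp (b *\<^sub>R Y z)))
      \<le> r * tr2 f (tilt r) - b * tr2 Y (tilt r) - ln l * mgf r"
    by (simp add: E_diff mgf_def tr2_def)
  moreover have "l * E (\<lambda>z. retr (spectral_fun exp (b *\<^sub>R Y z))) \<le> l * R"
    using YR l by (intro mult_left_mono) auto
  moreover have "l * R = mgf r" using R by (simp add: l_def)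
  ultimately show ?thesis by (simp add: l_def mult.commute)
qed

text \<open>Jensen's inequality for the trace exponential; Klein's inequality supplies the supporting
  hyperplane.\<close>

lemma exp_moment_PM_le:
  fixes Y :: "'a \<Rightarrow> complex^'n^'n"
  assumes Y: "suitable S Y" "\<And>z. cmat_hermitian (Y z)" and t: "0 \<le> t"
  shows "E (\<lambda>z. retr (spectral_fun exp (b *\<^sub>R PM t Y z))) \<le> E (\<lambda>z. retr (spectral_fun exp (b *\<^sub>R Y z)))"
proof -
  have eY: "suitable S (\<lambda>z. spectral_fun exp (b *\<^sub>R Y z))"
    by (intro S_exp suitable_scaleR hermitian_scaleR Y)
  have ePY: "suitable S (\<lambda>z. spectral_fun exp (b *\<^sub>R PM t Y z))"
    by (intro S_exp suitable_scaleR hermitian_scaleR suitable_PM hermitian_PM Y t)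
  note [simp] = S_retr suitable_mult Y(1) eY ePY suitable_const
  have "retr (spectral_fun exp (b *\<^sub>R PM t Y z)) \<le> P t (\<lambda>y. retr (spectral_fun exp (b *\<^sub>R Y y))) z" for z
  proof -
    let ?A = "b *\<^sub>R PM t Y z"
    let ?X = "spectral_fun exp ?A"
    have herm: "cmat_hermitian ?A" by (intro hermitian_scaleR hermitian_PM Y t)
    have "P t (\<lambda>y. retr ?X) z
      \<le> P t (\<lambda>y. retr (spectral_fun exp (b *\<^sub>R Y y)) + (retr (?A ** ?X) - b * retr (?X ** Y y))) z"
    proof (rule P_mono)
      show "retr ?X \<le> retr (spectral_fun exp (b *\<^sub>R Y y)) + (retr (?A ** ?X) - b * retr (?X ** Y y))" for y
        using klein_inequality[OF herm hermitian_scaleR[OF Y(2)], of 1 b y] retr_mult_commute[of ?X "Y y"]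
        by (simp add: matrix_distribs retr_scaleR)
    qed (use t in auto)
    also have "\<dots> = P t (\<lambda>y. retr (spectral_fun exp (b *\<^sub>R Y y))) z + (retr (?A ** ?X) - b * retr (?X ** PM t Y z))"
      using t by (simp add: P_add P_diff P_const P_cmult P_retr_left)
    also have "b * retr (?X ** PM t Y z) = retr (?A ** ?X)"
      using retr_mult_commute[of ?X "PM t Y z"] by (simp add: matrix_distribs retr_scaleR)
    finally show ?thesis using t by (simp add: P_const)
  qed
  then have "E (\<lambda>z. retr (spectral_fun exp (b *\<^sub>R PM t Y z))) \<le> E (P t (\<lambda>y. retr (spectral_fun exp (b *\<^sub>R Y y))))"
    using t by (intro E_mono) auto
  then show ?thesis using t by (simp add: E_P)
qed

lemma exp_carre_moment_pos: "0 < E (\<lambda>z. retr (spectral_fun exp (b *\<^sub>R \<Gamma> f f z)))" (is "0 < E ?h")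
proof -
  have herm: "cmat_hermitian (b *\<^sub>R \<Gamma> f f z)" for z
    by (intro hermitian_scaleR hermitian_carre f_suitable f_hermitian)
  have pos: "0 < ?h z" for z by (rule retr_exp_pos[OF herm])
  have "?h \<in> S"
    by (intro S_retr S_exp suitable_scaleR suitable_carre f_suitable herm)
  then have int: "integrable \<mu> ?h" by (rule S_integrable)
  have "E ?h \<noteq> 0"
  proof
    assume "E ?h = 0"
    then have "AE z in \<mu>. ?h z = 0"
      using integral_nonneg_eq_0_iff_AE[OF int] pos by (auto simp: less_imp_le)
    then have "AE z in \<mu>. False" by eventually_elim (use pos in \<open>metis less_irrefl\<close>)
    then show False by simp
  qed
  moreover have "0 \<le> E ?h" using pos by (intro Bochner_Integration.integral_nonneg) (auto simp: less_imp_le)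
  ultimately show ?thesis by simp
qed

text \<open>The correlation \<open>E tr (P_t f exp(r f))\<close> starts at the left-hand side and tends to zero. Its rate of
  decrease is at most \<open>r B exp(- t / c)\<close>, with \<open>B\<close> the common entropy bound for the weighted means of
  \<open>\<Gamma>(f)\<close> and \<open>P_t \<Gamma>(f)\<close>; the integral of this rate is \<open>c r B\<close>.\<close>

lemma mgf_derivative_le:
  assumes b: "0 < b" and r: "0 < r"
  defines "R \<equiv> E (\<lambda>z. retr (spectral_fun exp (b *\<^sub>R \<Gamma> f f z)))"
  shows "tr2 f (tilt r) \<le> c * r / b * (r * tr2 f (tilt r) - mgf r * ln (mgf r / R))"
proof -
  define B where "B = (r * tr2 f (tilt r) - mgf r * ln (mgf r / R)) / b"
  define G where "G = tilt r"
  note [simp] = f_suitable suitable_LM suitable_PM suitable_carre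
  have G[simp]: "suitable S G" by (simp add: G_def suitable_tilt)
  have R: "0 < R" unfolding R_def by (rule exp_carre_moment_pos)
  have herm: "cmat_hermitian (\<Gamma> f f z)" for z by (intro hermitian_carre f_suitable f_hermitian)
  have B1: "tr2 (\<Gamma> f f) G \<le> B"
    using entropy_inequality[of "\<Gamma> f f" R b r] herm R b by (simp add: R_def B_def G_def field_simps)
  have B2: "tr2 (\<Gamma> f f) (PM t G) \<le> B" if t: "0 \<le> t" for t
  proof -
    have "E (\<lambda>z. retr (spectral_fun exp (b *\<^sub>R PM t (\<Gamma> f f) z))) \<le> R"
      unfolding R_def by (rule exp_moment_PM_le) (use t herm in auto)
    then have "b * tr2 (PM t (\<Gamma> f f)) G \<le> b * B"
      using entropy_inequality[of "PM t (\<Gamma> f f)" R b r] t R b by (simp add: B_def G_def hermitian_PM herm)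
    then show ?thesis using b t by (simp add: tr2_PM_symmetric)
  qed
  have slope: "- tr2 (PM t (LM f)) G \<le> r * B * exp (- t / c)" if t: "0 \<le> t" for t
  proof -
    (* this balances the two terms of the chain rule inequality *)
    define s where "s = exp (- t / c) / r"
    have s: "0 < s" using r by (simp add: s_def)
    have "- tr2 (PM t (LM f)) G = - tr2 (LM (PM t f)) G" using t by (simp add: tr2_LM_PM)
    also have "\<dots> \<le> (s * tr2 (\<Gamma> (\<lambda>z. r *\<^sub>R f z) (\<lambda>z. r *\<^sub>R f z)) G + 1 / s * tr2 (\<Gamma> (PM t f) (PM t f)) G) / 2"
      unfolding G_def tilt_def[abs_def]
      by (rule exponential_chain_rule)
         (use t s in \<open>auto intro!: suitable_scaleR hermitian_scaleR hermitian_PM f_hermitian S_exp\<close>)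
    also have "tr2 (\<Gamma> (\<lambda>z. r *\<^sub>R f z) (\<lambda>z. r *\<^sub>R f z)) G = r\<^sup>2 * tr2 (\<Gamma> f f) G"
    proof -
      have "\<Gamma> (\<lambda>z. r *\<^sub>R f z) (\<lambda>z. r *\<^sub>R f z) = (\<lambda>z. r\<^sup>2 *\<^sub>R \<Gamma> f f z)"
        by (intro ext carre_scaleR f_suitable)
      then show ?thesis by (simp add: tr2_scaleR_left)
    qed
    also have "(s * (r\<^sup>2 * tr2 (\<Gamma> f f) G) + 1 / s * tr2 (\<Gamma> (PM t f) (PM t f)) G) / 2
        \<le> (s * (r\<^sup>2 * B) + 1 / s * (exp (- 2 * t / c) * B)) / 2"
    proof -
      have "tr2 (\<Gamma> (PM t f) (PM t f)) G \<le> exp (- 2 * t / c) * tr2 (\<Gamma> f f) (PM t G)"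
      proof (rule carre_decay)
        show "cmat_psd (G z)" for z
          unfolding G_def tilt_def by (intro psd_exp hermitian_scaleR f_hermitian)
      qed (use t f_hermitian in auto)
      also have "\<dots> \<le> exp (- 2 * t / c) * B" using B2[OF t] by (intro mult_left_mono) auto
      finally show ?thesis using s B1
        by (intro divide_right_mono add_mono mult_left_mono) auto
    qed
    also have "\<dots> = r * B * exp (- t / c)"
    proof -
      have e: "exp (- 2 * t / c) = exp (- t / c) * exp (- t / c)" by (simp add: exp_add[symmetric])
      have "1 / s * (exp (- 2 * t / c) * B) = r * B * exp (- t / c)"
        unfolding e s_def using r by (simp add: field_simps)
      moreover have "s * (r\<^sup>2 * B) = r * B * exp (- t / c)"
        using r by (simp add: s_def power2_eq_square)
      ultimately show ?thesis by simp
    qed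
    finally show ?thesis .
  qed
  define K where "K t = tr2 (PM t f) G - c * r * B * exp (- t / c)" for t
  have K0: "K 0 \<le> K t" if t: "0 \<le> t" for t
  proof -
    have "- K t \<le> - K 0"
    proof (rule nonincreasing_from_derivative_within[OF t])
      fix x assume x: "x \<in> {0..t}"
      then have "((\<lambda>t. tr2 (PM t f) G) has_real_derivative tr2 (PM x (LM f)) G) (at x within {0..t})"
        by (intro has_field_derivative_subset[OF tr2_PM_has_derivative]) auto
      then show "((\<lambda>t. - K t) has_real_derivative - (tr2 (PM x (LM f)) G + r * B * exp (- x / c))) (at x within {0..t})"
        unfolding K_def[abs_def] using c_pos by (auto intro!: derivative_eq_intros)
      show "- (tr2 (PM x (LM f)) G + r * B * exp (- x / c)) \<le> 0" using slope[of x] x by simp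
    qed
    then show ?thesis by simp
  qed
  have "(K \<longlongrightarrow> 0 - c * r * B * 0) at_top"
    unfolding K_def[abs_def]
  proof (intro tendsto_intros)
    show "((\<lambda>t. tr2 (PM t f) G) \<longlongrightarrow> 0) at_top"
      by (rule tr2_PM_tendsto_at_top) (auto simp: f_mean)
    have "filterlim (\<lambda>t. (1 / c) * t) at_top at_top"
      by (rule filterlim_tendsto_pos_mult_at_top[OF tendsto_const _ filterlim_ident]) (simp add: c_pos)
    then have "filterlim (\<lambda>t. - ((1 / c) * t)) at_bot at_top"
      by (simp only: filterlim_uminus_at_bot_at_top filterlim_compose[OF filterlim_uminus_at_bot_at_top])
    then show "((\<lambda>t. exp (- t / c)) \<longlongrightarrow> 0) at_top"
      using filterlim_compose[OF exp_at_bot] by simp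
  qed
  then have "K 0 \<le> 0 - c * r * B * 0"
    by (rule tendsto_lowerbound) (auto intro: eventually_mono[OF eventually_ge_at_top[of 0]] K0)
  then have "tr2 f G \<le> c * r * B" by (simp add: K_def PM_0)
  then show ?thesis by (simp add: B_def G_def)
qed

lemma r_carre_eq:
  "r_carre \<kappa> \<mu> f b = 1 / b * ln (E (\<lambda>z. retr (spectral_fun exp (b *\<^sub>R \<Gamma> f f z))) / real CARD('n))"
  by (simp add: r_carre_def ntrace_eq_retr)

text \<open>The entropy term \<open>ln (mgf r / d)\<close> is nonnegative and may be discarded; what remains is a linear
  differential inequality for the logarithm of \<open>mgf\<close>, which integrates explicitly.\<close>

lemma ln_mgf_le:
  assumes b: "0 < b" and r: "0 \<le> r" and rb: "c * r\<^sup>2 < b"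
  shows "ln (mgf r / real CARD('n)) \<le> - (b * r_carre \<kappa> \<mu> f b / 2) * ln (1 - c * r\<^sup>2 / b)"
proof -
  define v where "v = r_carre \<kappa> \<mu> f b"
  define d where "d = real CARD('n)"
  have d: "0 < d" by (simp add: d_def)
  define R where "R = E (\<lambda>z. retr (spectral_fun exp (b *\<^sub>R \<Gamma> f f z)))"
  have R: "0 < R" unfolding R_def by (rule exp_carre_moment_pos)
  have bv: "b * v = ln (R / d)" using b by (simp add: v_def r_carre_eq R_def d_def)
  define h where "h x = ln (mgf x / d) + b * v / 2 * ln (1 - c * x\<^sup>2 / b)" for x
  have less: "c * x\<^sup>2 < b" if "x \<in> {0..r}" for x
  proof -
    have "c * x\<^sup>2 \<le> c * r\<^sup>2" using that c_pos by (intro mult_left_mono power_mono) auto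
    then show ?thesis using rb by simp
  qed
  have "h r \<le> h 0"
  proof (rule nonincreasing_from_derivative_within[OF r])
    fix x assume x: "x \<in> {0..r}"
    have pos: "0 < 1 - c * x\<^sup>2 / b" using less[OF x] b by simp
    have D: "(mgf has_real_derivative tr2 f (tilt x)) (at x within {0..r})"
      by (rule has_field_derivative_at_within[OF mgf_has_derivative])
    show "(h has_real_derivative tr2 f (tilt x) / mgf x - c * x * v / (1 - c * x\<^sup>2 / b)) (at x within {0..r})"
      unfolding h_def[abs_def]
      by (rule derivative_eq_intros D refl | use mgf_pos[of x] d pos b in force)+
         (use mgf_pos[of x] d pos b in \<open>simp add: field_simps\<close>)
    show "tr2 f (tilt x) / mgf x - c * x * v / (1 - c * x\<^sup>2 / b) \<le> 0"
    proof (cases "x = 0")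
      case True
      (* the exponential moment is smallest at 0 *)
      have "tr2 f (tilt 0) = 0"
      proof -
        have "0 \<le> tr2 f (tilt 0)"
          by (rule derivative_nonneg_at_minimum[of mgf])
             (auto intro: has_field_derivative_at_within[OF mgf_has_derivative] simp: mgf_0 mgf_ge)
        moreover have "0 \<le> - tr2 f (tilt 0)"
        proof (rule derivative_nonneg_at_minimum[of "\<lambda>x. mgf (- x)"])
          show "((\<lambda>x. mgf (- x)) has_real_derivative - tr2 f (tilt 0)) (at 0 within {0..})"
            using DERIV_chain2[of mgf _ uminus 0, OF _ DERIV_minus[OF DERIV_ident]] mgf_has_derivative[of 0]
            by (auto intro!: has_field_derivative_at_within)
        qed (simp add: mgf_0 mgf_ge)
        ultimately show ?thesis by simp
      qed
      then show ?thesis using True by simp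
    next
      case False
      then have x0: "0 < x" using x by simp
      let ?N = "tr2 f (tilt x)" and ?M = "mgf x"
      have "ln (?M / R) = ln (?M / d) - b * v"
        unfolding bv using mgf_pos[of x] R d by (simp add: ln_div)
      moreover have "0 \<le> ln (?M / d)" using mgf_ge[of x] d by (simp add: d_def)
      ultimately have "- (b * v) \<le> ln (?M / R)" by simp
      then have "?M * - (b * v) \<le> ?M * ln (?M / R)" using mgf_pos[of x] by (intro mult_left_mono) auto
      then have "c * x / b * (x * ?N - ?M * ln (?M / R)) \<le> c * x / b * (x * ?N + ?M * (b * v))"
        using c_pos x0 b by (intro mult_left_mono) auto
      then have "?N \<le> c * x / b * (x * ?N + ?M * (b * v))"
        using mgf_derivative_le[OF b x0] unfolding R_def by linarith
      also have "\<dots> = c * x\<^sup>2 / b * ?N + c * x * v * ?M"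
        using b by (simp add: field_simps power2_eq_square)
      finally have "?N * (1 - c * x\<^sup>2 / b) \<le> c * x * v * ?M" by (simp add: algebra_simps)
      then have "?N / ?M \<le> c * x * v / (1 - c * x\<^sup>2 / b)"
        using pos mgf_pos[of x] by (simp add: pos_le_divide_eq pos_divide_le_eq mult.commute)
      then show ?thesis by simp
    qed
  qed
  then show ?thesis using d by (simp add: h_def mgf_0 v_def d_def)
qed

text \<open>The logarithm bounded in the preceding lemma is nonnegative, so its upper bound is.\<close>

lemma r_carre_nonneg: assumes b: "0 < b" shows "0 \<le> r_carre \<kappa> \<mu> f b"
proof -
  define r where "r = sqrt (b / (2 * c))"
  have r: "0 \<le> r" "c * r\<^sup>2 = b / 2" using b c_pos by (simp_all add: r_def)
  have "0 \<le> ln (mgf r / real CARD('n))" using mgf_ge[of r] by (simp add: field_simps)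
  also have "\<dots> \<le> - (b * r_carre \<kappa> \<mu> f b / 2) * ln (1 - c * r\<^sup>2 / b)"
    using b r by (intro ln_mgf_le) auto
  also have "1 - c * r\<^sup>2 / b = 1 / 2" using b r by simp
  also have "- (b * r_carre \<kappa> \<mu> f b / 2) * ln (1 / 2) = b * r_carre \<kappa> \<mu> f b * (ln 2 / 2)"
    by (simp add: ln_div)
  finally show ?thesis using b by (simp add: zero_le_mult_iff)
qed

text \<open>By \<open>- ln (1 - q\<^sup>2) \<le> q\<^sup>2 / (1 - q\<^sup>2) \<le> q\<^sup>2 / (1 - q)\<close> with \<open>q = r sqrt (c / b)\<close>.\<close>

lemma mgf_le:
  assumes b: "0 < b" and r: "0 \<le> r" and rb: "r * sqrt (c / b) < 1"
  shows "mgf r \<le> real CARD('n) * exp (c * r\<^sup>2 * r_carre \<kappa> \<mu> f b / (2 * (1 - r * sqrt (c / b))))"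
proof -
  define v where "v = r_carre \<kappa> \<mu> f b"
  define q where "q = r * sqrt (c / b)"
  have v: "0 \<le> v" unfolding v_def by (rule r_carre_nonneg[OF b])
  have q: "0 \<le> q" "q < 1" using r rb b c_pos by (auto simp: q_def)
  have q2: "q\<^sup>2 = c * r\<^sup>2 / b" using b c_pos by (simp add: q_def power_mult_distrib)
  have q21: "q\<^sup>2 < 1" using q by (simp add: power_less_one_iff abs_square_less_1)
  have "ln (mgf r / real CARD('n)) \<le> - (b * v / 2) * ln (1 - q\<^sup>2)"
    unfolding v_def q2 by (rule ln_mgf_le[OF b r]) (use q21 b in \<open>simp add: q2\<close>)
  also have "\<dots> = (b * v / 2) * ln (1 / (1 - q\<^sup>2))" using q21 by (simp add: ln_div)
  also have "\<dots> \<le> (b * v / 2) * (q\<^sup>2 / (1 - q))"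
  proof (intro mult_left_mono)
    have "ln (1 / (1 - q\<^sup>2)) \<le> 1 / (1 - q\<^sup>2) - 1" using q21 by (intro ln_le_minus_one) simp
    also have "\<dots> = q\<^sup>2 / (1 - q\<^sup>2)" using q21 by (simp add: field_simps)
    also have "\<dots> \<le> q\<^sup>2 / (1 - q)"
    proof (intro divide_left_mono)
      have "q\<^sup>2 \<le> q" using q by (simp add: power2_eq_square mult_left_le_one_le)
      then show "1 - q \<le> 1 - q\<^sup>2" by simp
    qed (use q q21 in auto)
    finally show "ln (1 / (1 - q\<^sup>2)) \<le> q\<^sup>2 / (1 - q)" .
  qed (use v b in auto)
  also have "\<dots> = c * r\<^sup>2 * v / (2 * (1 - q))"
    unfolding q2 using b q by (simp add: field_simps)
  finally have "exp (ln (mgf r / real CARD('n))) \<le> exp (c * r\<^sup>2 * v / (2 * (1 - q)))" by simp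
  then show ?thesis using mgf_pos[of r] by (simp add: v_def q_def field_simps)
qed

end

section \<open>Tail and expectation bounds\<close>

context bakry_emery_semigroup
begin

lemma laplace_transform_bound:
  assumes r: "0 \<le> r"
  shows "measure \<mu> {z. t \<le> lambda_max (f z)} \<le> exp (- (r * t)) * mgf r"
proof (cases "{z. t \<le> lambda_max (f z)} \<in> sets \<mu>")
  (* the measure of a set outside the sigma-algebra is 0 by convention *)
  case False
  then show ?thesis using mgf_pos[of r] by (simp add: measure_notin_sets less_imp_le)
next
  case True
  let ?A = "{z. t \<le> lambda_max (f z)}"
  have "measure \<mu> ?A = E (indicator ?A)" by (simp add: True space_mu)
  also have "\<dots> \<le> E (\<lambda>z. exp (- (r * t)) * retr (tilt r z))"
  proof (rule integral_mono)
    show "integrable \<mu> (indicator ?A :: 'a \<Rightarrow> real)"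
      using True by (simp add: integrable_indicator_iff mu.emeasure_finite less_top[symmetric])
    show "integrable \<mu> (\<lambda>z. exp (- (r * t)) * retr (tilt r z))"
      by (intro S_integrable S_cmult S_retr suitable_tilt)
    fix z
    have e: "exp (r * lambda_max (f z)) \<le> retr (tilt r z)"
      unfolding tilt_def by (rule exp_lambda_max_le_retr_exp[OF f_hermitian r])
    show "indicator ?A z \<le> exp (- (r * t)) * retr (tilt r z)"
    proof (cases "z \<in> ?A")
      case True
      then have "r * t \<le> r * lambda_max (f z)" using r by (intro mult_left_mono) auto
      then have "exp (r * t) \<le> exp (r * lambda_max (f z))" by simp
      then have "exp (r * t) \<le> retr (tilt r z)" using e by (rule order_trans)
      then have "exp (- (r * t)) * exp (r * t) \<le> exp (- (r * t)) * retr (tilt r z)"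
        by (intro mult_left_mono) auto
      then show ?thesis using True by (simp add: exp_add[symmetric])
    next
      case False
      have "0 \<le> retr (tilt r z)" using e exp_gt_zero[of "r * lambda_max (f z)"] by linarith
      then show ?thesis using False by simp
    qed
  qed
  also have "\<dots> = exp (- (r * t)) * mgf r" by (simp add: mgf_def)
  finally show ?thesis .
qed

lemma measure_le_dimension: "measure \<mu> A \<le> real CARD('n)"
proof -
  have "measure \<mu> A \<le> 1" by simp
  also have "1 \<le> real CARD('n)" by (simp add: Suc_leI)
  finally show ?thesis .
qed

text \<open>With \<open>s = sqrt (c / b)\<close>, the choice \<open>r = t / (c v + t s)\<close> makes \<open>1 - r s\<close> equal to \<open>c v / (c v + t s)\<close>, and both
  terms of the exponent become multiples of \<open>t\<^sup>2 / (c v + t s)\<close>. If \<open>v = 0\<close> it is the end point \<open>1 / s\<close> of the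
  admissible range, and half of it suffices.\<close>

lemma tail_bound:
  assumes b: "0 < b" and t: "0 \<le> t"
  shows "measure \<mu> {z. t \<le> lambda_max (f z)}
    \<le> real CARD('n) * exp (- t\<^sup>2 / (2 * c * r_carre \<kappa> \<mu> f b + 2 * t * sqrt (c / b)))"
proof (cases "t = 0")
  case True
  then show ?thesis using measure_le_dimension by simp
next
  case False
  define v where "v = r_carre \<kappa> \<mu> f b"
  define s where "s = sqrt (c / b)"
  have t: "0 < t" using t False by simp
  have v: "0 \<le> v" unfolding v_def by (rule r_carre_nonneg[OF b])
  have s: "0 < s" using b c_pos by (simp add: s_def)
  define r where "r = (if v = 0 then 1 / (2 * s) else t / (c * v + t * s))"
  have cv: "0 \<le> c * v" using c_pos v by simp
  then have den: "0 < c * v + t * s" using s t by (simp add: add_nonneg_pos)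
  have r0: "0 \<le> r" using s t den by (simp add: r_def)
  have rs: "r * s < 1"
  proof (cases "v = 0")
    case True
    then show ?thesis using s by (simp add: r_def)
  next
    case False
    then have "0 < c * v" using c_pos v by simp
    then show ?thesis using False den by (simp add: r_def)
  qed
  have "measure \<mu> {z. t \<le> lambda_max (f z)} \<le> exp (- (r * t)) * mgf r"
    by (rule laplace_transform_bound[OF r0])
  also have "\<dots> \<le> exp (- (r * t)) * (real CARD('n) * exp (c * r\<^sup>2 * v / (2 * (1 - r * s))))"
    unfolding v_def s_def by (intro mult_left_mono mgf_le b r0) (use rs in \<open>auto simp: s_def\<close>)
  also have "\<dots> = real CARD('n) * exp (c * r\<^sup>2 * v / (2 * (1 - r * s)) - r * t)"
    by (simp add: exp_diff exp_minus field_simps)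
  also have "c * r\<^sup>2 * v / (2 * (1 - r * s)) - r * t = - t\<^sup>2 / (2 * c * v + 2 * t * s)"
  proof (cases "v = 0")
    case True
    then show ?thesis using s t by (simp add: r_def power2_eq_square)
  next
    case False
    define q where "q = c * v + t * s"
    have q: "0 < q" "r = t / q" using False den by (simp_all add: q_def r_def)
    have cv0: "c * v \<noteq> 0" using False c_pos by simp
    have "1 - r * s = c * v / q" using q by (simp add: field_simps) (simp add: q_def)
    then have "c * r\<^sup>2 * v / (2 * (1 - r * s)) = (c * v) * r\<^sup>2 * q / (2 * (c * v))"
      using q cv0 by simp
    also have "\<dots> = t\<^sup>2 / (2 * q)" using q cv0 by (simp add: power2_eq_square)
    finally have "c * r\<^sup>2 * v / (2 * (1 - r * s)) = t\<^sup>2 / (2 * q)" .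
    moreover have "r * t = t\<^sup>2 / q" unfolding q(2) by (simp add: power2_eq_square)
    moreover have "t\<^sup>2 / (2 * q) - t\<^sup>2 / q = - t\<^sup>2 / (2 * q)" using q(1) by (simp add: field_simps)
    ultimately have "c * r\<^sup>2 * v / (2 * (1 - r * s)) - r * t = - t\<^sup>2 / (2 * q)" by simp
    then show ?thesis by (simp add: q_def algebra_simps)
  qed
  finally show ?thesis by (simp add: v_def s_def)
qed

lemma tail_bound_INF:
  assumes t: "0 \<le> t"
  shows "measure \<mu> {z. t \<le> lambda_max (f z)}
    \<le> real CARD('n) * (INF b\<in>{0<..}. exp (- t\<^sup>2 / (2 * c * r_carre \<kappa> \<mu> f b + 2 * t * sqrt (c / b))))"
proof -
  have d: "0 < real CARD('n)" by simp
  have "measure \<mu> {z. t \<le> lambda_max (f z)} / real CARD('n)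
    \<le> (INF b\<in>{0<..}. exp (- t\<^sup>2 / (2 * c * r_carre \<kappa> \<mu> f b + 2 * t * sqrt (c / b))))"
  proof (rule cINF_greatest)
    fix b :: real assume "b \<in> {0<..}"
    then have "measure \<mu> {z. t \<le> lambda_max (f z)}
        \<le> real CARD('n) * exp (- t\<^sup>2 / (2 * c * r_carre \<kappa> \<mu> f b + 2 * t * sqrt (c / b)))"
      by (intro tail_bound t) simp
    then show "measure \<mu> {z. t \<le> lambda_max (f z)} / real CARD('n)
        \<le> exp (- t\<^sup>2 / (2 * c * r_carre \<kappa> \<mu> f b + 2 * t * sqrt (c / b)))"
      by (subst pos_divide_le_eq[OF d]) (simp only: mult.commute)
  qed auto
  then show ?thesis by (subst (asm) pos_divide_le_eq[OF d]) (simp only: mult.commute)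
qed

text \<open>An operator norm is nonnegative, which excludes the value \<open>- \<infinity>\<close> of the essential supremum.\<close>

lemma variance_proxy_bound:
  assumes fin: "variance_proxy \<kappa> \<mu> f < \<infinity>"
  defines "v \<equiv> real_of_ereal (variance_proxy \<kappa> \<mu> f)"
  shows "AE z in \<mu>. cmat_opnorm (\<Gamma> f f z) \<le> v" "0 \<le> v"
proof -
  have "AE z in \<mu>. ereal (cmat_opnorm (\<Gamma> f f z)) \<le> variance_proxy \<kappa> \<mu> f"
    unfolding variance_proxy_def by (rule esssup_AE)
  moreover have nonneg: "0 \<le> cmat_opnorm (A :: complex^'n^'n)" for A
    unfolding cmat_opnorm_def by (rule onorm_pos_le[OF bounded_linear_matrix_vector])
  ultimately have "AE z in \<mu>. 0 \<le> cmat_opnorm (\<Gamma> f f z) \<and> ereal (cmat_opnorm (\<Gamma> f f z)) \<le> variance_proxy \<kappa> \<mu> f"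
    by auto
  then have ae: "AE z in \<mu>. 0 \<le> cmat_opnorm (\<Gamma> f f z) \<and> cmat_opnorm (\<Gamma> f f z) \<le> v"
  proof eventually_elim
    case (elim z)
    then have "variance_proxy \<kappa> \<mu> f \<noteq> - \<infinity>" by auto
    then have "ereal v = variance_proxy \<kappa> \<mu> f"
      unfolding v_def using fin by (intro ereal_real') auto
    then show ?case using elim by (metis ereal_less_eq(3))
  qed
  then show "AE z in \<mu>. cmat_opnorm (\<Gamma> f f z) \<le> v" by eventually_elim simp
  from ae have "AE z in \<mu>. 0 \<le> v" by eventually_elim simp
  then show "0 \<le> v" by (simp add: mu.AE_const)
qed

lemma r_carre_le:
  assumes b: "0 < b" and v: "AE z in \<mu>. cmat_opnorm (\<Gamma> f f z) \<le> v"
  shows "r_carre \<kappa> \<mu> f b \<le> v"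
proof -
  let ?h = "\<lambda>z. retr (spectral_fun exp (b *\<^sub>R \<Gamma> f f z))"
  have herm: "cmat_hermitian (\<Gamma> f f z)" for z by (intro hermitian_carre f_suitable f_hermitian)
  have "E ?h \<le> E (\<lambda>z. real CARD('n) * exp (b * v))"
  proof (rule integral_mono_AE)
    show "integrable \<mu> ?h"
      by (intro S_integrable S_retr S_exp suitable_scaleR hermitian_scaleR herm suitable_carre f_suitable)
    show "AE z in \<mu>. ?h z \<le> real CARD('n) * exp (b * v)"
      using v by eventually_elim (rule retr_exp_le_opnorm[OF herm less_imp_le[OF b]])
  qed simp
  then have "E ?h \<le> real CARD('n) * exp (b * v)" by (simp add: mu.prob_space)
  then have "E ?h / real CARD('n) \<le> exp (b * v)" by (simp add: field_simps)
  moreover have "0 < E ?h / real CARD('n)" using exp_carre_moment_pos by simp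
  ultimately have "ln (E ?h / real CARD('n)) \<le> b * v" by (metis ln_exp ln_le_cancel_iff exp_gt_zero)
  then show ?thesis using b by (simp add: r_carre_eq field_simps)
qed

text \<open>Letting \<open>b\<close> tend to infinity in \<open>mgf_le\<close>, with \<open>r_carre\<close> bounded by \<open>v\<close>.\<close>

lemma mgf_subgaussian:
  assumes v: "AE z in \<mu>. cmat_opnorm (\<Gamma> f f z) \<le> v" and r: "0 \<le> r"
  shows "mgf r \<le> real CARD('n) * exp (c * r\<^sup>2 * v / 2)"
proof (rule tendsto_lowerbound)
  have q: "((\<lambda>b. r * sqrt (c / b)) \<longlongrightarrow> r * sqrt 0) at_top"
    by (intro tendsto_intros tendsto_real_sqrt tendsto_divide_0[OF tendsto_const]
        filterlim_at_top_imp_at_infinity filterlim_ident)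
  have "((\<lambda>b. real CARD('n) * exp (c * r\<^sup>2 * v / (2 * (1 - r * sqrt (c / b))))) \<longlongrightarrow>
      real CARD('n) * exp (c * r\<^sup>2 * v / (2 * (1 - r * sqrt 0)))) at_top"
    by (intro tendsto_intros q) simp
  then show "((\<lambda>b. real CARD('n) * exp (c * r\<^sup>2 * v / (2 * (1 - r * sqrt (c / b))))) \<longlongrightarrow>
      real CARD('n) * exp (c * r\<^sup>2 * v / 2)) at_top" by simp
  have "\<forall>\<^sub>F b in at_top. r * sqrt (c / b) < 1" using order_tendstoD(2)[OF q, of 1] by simp
  then show "\<forall>\<^sub>F b in at_top. mgf r \<le> real CARD('n) * exp (c * r\<^sup>2 * v / (2 * (1 - r * sqrt (c / b))))"
    using eventually_gt_at_top[of "0::real"]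
  proof eventually_elim
    case (elim b)
    have "mgf r \<le> real CARD('n) * exp (c * r\<^sup>2 * r_carre \<kappa> \<mu> f b / (2 * (1 - r * sqrt (c / b))))"
      by (rule mgf_le) (use elim r in auto)
    also have "\<dots> \<le> real CARD('n) * exp (c * r\<^sup>2 * v / (2 * (1 - r * sqrt (c / b))))"
      using r_carre_le[OF elim(2) v] elim c_pos
      by (intro mult_left_mono exp_le_cancel_iff[THEN iffD2] divide_right_mono) auto
    finally show ?case .
  qed
qed simp

text \<open>The exponent \<open>c r\<^sup>2 v / 2 - r t\<close> is smallest at \<open>r = t / (c v)\<close>; for \<open>v = 0 < t\<close> it is unbounded below.\<close>

lemma subgaussian_tail:
  assumes v: "AE z in \<mu>. cmat_opnorm (\<Gamma> f f z) \<le> v" "0 \<le> v" and t: "0 \<le> t"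
  shows "measure \<mu> {z. t \<le> lambda_max (f z)} \<le> real CARD('n) * exp_neg_quot (t\<^sup>2) (2 * c * v)"
proof -
  let ?p = "measure \<mu> {z. t \<le> lambda_max (f z)}"
  have chernoff: "?p \<le> real CARD('n) * exp (c * r\<^sup>2 * v / 2 - r * t)" if r: "0 \<le> r" for r
  proof -
    have "?p \<le> exp (- (r * t)) * mgf r" by (rule laplace_transform_bound[OF r])
    also have "\<dots> \<le> exp (- (r * t)) * (real CARD('n) * exp (c * r\<^sup>2 * v / 2))"
      by (intro mult_left_mono mgf_subgaussian v r) auto
    also have "\<dots> = real CARD('n) * exp (c * r\<^sup>2 * v / 2 - r * t)"
    proof -
      have "exp (c * r\<^sup>2 * v / 2 - r * t) = exp (- (r * t)) * exp (c * r\<^sup>2 * v / 2)"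
        by (simp add: exp_add[symmetric])
      then show ?thesis by (simp only: mult.left_commute)
    qed
    finally show ?thesis .
  qed
  consider "v = 0" "t = 0" | "v = 0" "0 < t" | "0 < v" using v t by linarith
  then show ?thesis
  proof cases
    case 1
    then show ?thesis using measure_le_dimension by (simp add: exp_neg_quot_def)
  next
    case 2
    have "filterlim (\<lambda>r. t * r) at_top at_top"
      by (rule filterlim_tendsto_pos_mult_at_top[OF tendsto_const 2(2) filterlim_ident])
    then have "filterlim (\<lambda>r. - (t * r)) at_bot at_top"
      by (rule filterlim_compose[OF filterlim_uminus_at_bot_at_top])
    then have "((\<lambda>r. real CARD('n) * exp (- (t * r))) \<longlongrightarrow> real CARD('n) * 0) at_top"
      by (intro tendsto_intros filterlim_compose[OF exp_at_bot])
    moreover have "\<forall>\<^sub>F r in at_top. ?p \<le> real CARD('n) * exp (- (t * r))"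
      using eventually_ge_at_top[of "0::real"]
      by eventually_elim (use chernoff 2 in \<open>simp add: mult.commute\<close>)
    ultimately have "?p \<le> real CARD('n) * 0" by (rule tendsto_lowerbound) simp
    then show ?thesis using 2 by (simp add: exp_neg_quot_def)
  next
    case 3
    have "?p \<le> real CARD('n) * exp (c * (t / (c * v))\<^sup>2 * v / 2 - t / (c * v) * t)"
      using 3 c_pos t by (intro chernoff) auto
    also have "c * (t / (c * v))\<^sup>2 * v / 2 - t / (c * v) * t = - t\<^sup>2 / (2 * c * v)"
      using 3 c_pos by (simp add: power2_eq_square field_simps)
    finally show ?thesis using 3 c_pos by (simp add: exp_neg_quot_def)
  qed
qed

text \<open>The expectation of \<open>ln (tr exp(r f))\<close> is at most \<open>ln (mgf r)\<close> by the tangent \<open>ln x \<le> x / a - 1 + ln a\<close> at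
  \<open>a = mgf r\<close>; this bounds \<open>r\<close> times the expected maximum eigenvalue by a quadratic in \<open>r\<close>.\<close>

lemma expectation_bound:
  assumes v: "AE z in \<mu>. cmat_opnorm (\<Gamma> f f z) \<le> v" "0 \<le> v"
  shows "(\<integral>z. lambda_max (f z) \<partial>\<mu>) \<le> sqrt (2 * c * v * ln (real CARD('n)))"
proof (cases "integrable \<mu> (\<lambda>z. lambda_max (f z))")
  (* the integral is 0 by convention *)
  case False
  then show ?thesis using v c_pos by (simp add: not_integrable_integral_eq Suc_leI)
next
  case True
  have "E (\<lambda>z. lambda_max (f z)) \<le> sqrt (2 * (c * v) * ln (real CARD('n)))"
  proof (rule le_sqrt_if_linear_le_quadratic)
    fix r :: real assume r: "0 < r"
    have "E (\<lambda>z. r * lambda_max (f z)) \<le> E (\<lambda>z. retr (tilt r z) / mgf r + (ln (mgf r) - 1))"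
    proof (rule integral_mono)
      show "integrable \<mu> (\<lambda>z. r * lambda_max (f z))" using True by simp
      show "integrable \<mu> (\<lambda>z. retr (tilt r z) / mgf r + (ln (mgf r) - 1))"
        using S_integrable[OF S_retr[OF suitable_tilt]] by simp
      fix z
      have e: "exp (r * lambda_max (f z)) \<le> retr (tilt r z)"
        unfolding tilt_def by (rule exp_lambda_max_le_retr_exp[OF f_hermitian less_imp_le[OF r]])
      then have pos: "0 < retr (tilt r z)" by (meson exp_gt_zero less_le_trans)
      have "r * lambda_max (f z) \<le> ln (retr (tilt r z))" using e pos by (simp add: ln_ge_iff)
      also have "\<dots> = ln (retr (tilt r z) / mgf r) + ln (mgf r)" using pos mgf_pos[of r] by (simp add: ln_div)
      also have "\<dots> \<le> (retr (tilt r z) / mgf r - 1) + ln (mgf r)"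
        using pos mgf_pos[of r] by (intro add_mono ln_le_minus_one) auto
      finally show "r * lambda_max (f z) \<le> retr (tilt r z) / mgf r + (ln (mgf r) - 1)" by simp
    qed
    also have "\<dots> = E (\<lambda>z. retr (tilt r z)) / mgf r + (ln (mgf r) - 1)"
      using S_integrable[OF S_retr[OF suitable_tilt]] by (simp add: mu.prob_space)
    also have "\<dots> = ln (mgf r)" using mgf_pos[of r] by (simp add: mgf_def)
    also have "\<dots> \<le> ln (real CARD('n) * exp (c * r\<^sup>2 * v / 2))"
      using mgf_pos[of r] mgf_subgaussian[OF v(1), of r] r by (intro ln_mono) auto
    also have "\<dots> = ln (real CARD('n)) + r\<^sup>2 * (c * v) / 2" by (simp add: ln_mult)
    finally show "r * E (\<lambda>z. lambda_max (f z)) \<le> ln (real CARD('n)) + r\<^sup>2 * (c * v) / 2" by simp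
  qed (use c_pos v in \<open>auto simp: Suc_leI\<close>)
  then show ?thesis by (simp add: mult.assoc)
qed

lemma bakry_emery_uminus: "bakry_emery_semigroup \<kappa> \<mu> S c (\<lambda>z. - f z)"
proof
  show "suitable S (\<lambda>z. - f z)" using suitable_scaleR[OF f_suitable, of "-1"] by simp
  show "cmat_hermitian (- f z)" for z using hermitian_scaleR[OF f_hermitian, of "-1"] by simp
  show "(\<integral>z. - f z \<partial>\<mu>) = 0" by (simp add: f_mean)
qed (use S_exp c_pos curvature in auto)

lemma carre_uminus_eq: "\<Gamma> (\<lambda>z. - f z) (\<lambda>z. - f z) = \<Gamma> f f"
  by (intro ext carre_uminus f_suitable)

end

theorem theorem3p5:
  fixes W :: "'w measure"
    and Pr :: "'a::polish_space \<Rightarrow> 'w measure"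
    and Z :: "real \<Rightarrow> 'w \<Rightarrow> 'a"
    and \<kappa> :: "real \<Rightarrow> 'a \<Rightarrow> 'a measure"
    and \<mu> :: "'a measure"
    and S :: "('a \<Rightarrow> real) set"
    and c :: real
    and F :: "'a \<Rightarrow> complex^'n^'n"
  assumes "markov_process W Pr Z"
    and "\<kappa> = transition_kernel Pr Z"
    and "prob_space \<mu>" and "sets \<mu> = sets borel"
    and "stationary \<kappa> \<mu>" and "reversible \<kappa> \<mu>" and "ergodic \<kappa> \<mu>"
    and "suitable_class \<kappa> \<mu> S TYPE('n)"
    and "0 < c" and "bakry_emery \<kappa> \<mu> S c TYPE('n)"
    and "suitable_hermitian S F"
  shows
    "(\<forall>t\<ge>0.
        measure \<mu> {z. t \<le> lambda_max (centered \<mu> F z)}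
          \<le> real CARD('n) * (INF \<beta>\<in>{0<..}. exp (- t\<^sup>2 / (2 * c * r_carre \<kappa> \<mu> F \<beta> + 2 * t * sqrt (c / \<beta>))))
      \<and> measure \<mu> {z. lambda_min (centered \<mu> F z) \<le> - t}
          \<le> real CARD('n) * (INF \<beta>\<in>{0<..}. exp (- t\<^sup>2 / (2 * c * r_carre \<kappa> \<mu> F \<beta> + 2 * t * sqrt (c / \<beta>)))))
   \<and> (variance_proxy \<kappa> \<mu> F < \<infinity> \<longrightarrow>
       (let v = real_of_ereal (variance_proxy \<kappa> \<mu> F) in
         (\<forall>t\<ge>0.
             measure \<mu> {z. t \<le> lambda_max (centered \<mu> F z)}
               \<le> real CARD('n) * exp_neg_quot (t\<^sup>2) (2 * c * v)
           \<and> measure \<mu> {z. lambda_min (centered \<mu> F z) \<le> - t}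
               \<le> real CARD('n) * exp_neg_quot (t\<^sup>2) (2 * c * v))
         \<and> (\<integral>z. lambda_max (centered \<mu> F z) \<partial>\<mu>) \<le> sqrt (2 * c * v * ln (real CARD('n)))
         \<and> (\<integral>z. lambda_min (centered \<mu> F z) \<partial>\<mu>) \<ge> - sqrt (2 * c * v * ln (real CARD('n)))))"
proof -
  interpret markov_process W Pr Z by fact
  have sym: "symmetric_semigroup \<kappa> \<mu> S"
    by (rule symmetric_semigroup.intro)
       (use assms(3-7) assms(8)[unfolded suitable_class_def] transition_kernel_measurable
          transition_kernel_0 transition_kernel_add in \<open>simp_all add: assms(2)\<close>)
  interpret symmetric_semigroup \<kappa> \<mu> S by (rule sym)
  have F: "suitable S F" "\<And>z. cmat_hermitian (F z)"
    using assms(11) by (auto simp: suitable_hermitian_def)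
  define M where "M = (\<integral>z. F z \<partial>\<mu>)"
  have int: "integrable \<mu> F" by (rule suitable_integrable[OF F(1) S_integrable])
  have "cmat_hermitian M"
  proof -
    have "cmat_adjoint M = (\<integral>z. cmat_adjoint (F z) \<partial>\<mu>)"
      unfolding M_def by (rule integral_bounded_linear[OF bounded_linear_cmat_adjoint int, symmetric])
    also have "\<dots> = M" using F(2) by (simp add: M_def cmat_hermitian_def)
    finally show ?thesis by (simp add: cmat_hermitian_def)
  qed
  have c: "centered \<mu> F = (\<lambda>z. F z - M)" by (simp add: centered_def[abs_def] M_def)
  interpret bakry_emery_semigroup \<kappa> \<mu> S c "centered \<mu> F"
  proof
    show "suitable S (centered \<mu> F)" unfolding c by (intro suitable_diff suitable_const F)
    show "cmat_hermitian (centered \<mu> F z)" for z unfolding c by (intro hermitian_diff F \<open>cmat_hermitian M\<close>)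
    show "(\<integral>z. centered \<mu> F z \<partial>\<mu>) = 0" unfolding c using int by (simp add: M_def mu.prob_space)
    show "suitable S (\<lambda>z. spectral_fun exp (G z))" if "suitable S G" "\<And>z. cmat_hermitian (G z)"
      for G :: "'a \<Rightarrow> complex^'n^'n"
      using assms(8) that unfolding suitable_class_def suitable_hermitian_def by blast
    show "AE z in \<mu>. loewner_le (\<Gamma> G G z) (c *\<^sub>R \<Gamma>2 G G z)" if "suitable S G" "\<And>z. cmat_hermitian (G z)"
      for G :: "'a \<Rightarrow> complex^'n^'n"
      using assms(10) that unfolding bakry_emery_def suitable_hermitian_def by blast
  qed fact
  have "\<Gamma> (centered \<mu> F) (centered \<mu> F) = \<Gamma> F F"
    unfolding c by (intro ext carre_shift F)
  then have eq: "r_carre \<kappa> \<mu> (centered \<mu> F) = r_carre \<kappa> \<mu> F"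
      "variance_proxy \<kappa> \<mu> (centered \<mu> F) = variance_proxy \<kappa> \<mu> F"
    by (simp_all add: r_carre_def[abs_def] variance_proxy_def)
  interpret neg: bakry_emery_semigroup \<kappa> \<mu> S c "\<lambda>z. - centered \<mu> F z" by (rule bakry_emery_uminus)
  have r: "r_carre \<kappa> \<mu> (\<lambda>z. - centered \<mu> F z) = r_carre \<kappa> \<mu> (centered \<mu> F)"
    by (simp add: r_carre_def[abs_def] carre_uminus_eq)
  have lmin: "lambda_min (centered \<mu> F z) = - lambda_max (- centered \<mu> F z)" for z
    by (rule lambda_min_eq_uminus_lambda_max[OF f_hermitian])
  show ?thesis
    unfolding lmin neg_le_iff_le Let_def integral_minus eq[symmetric]
    using tail_bound_INF neg.tail_bound_INF[unfolded r]
      subgaussian_tail[OF variance_proxy_bound] neg.subgaussian_tail[unfolded carre_uminus_eq, OF variance_proxy_bound]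
      expectation_bound[OF variance_proxy_bound] neg.expectation_bound[unfolded carre_uminus_eq, OF variance_proxy_bound]
    by simp
qed

end
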